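(* Let $(M,g)$ be a Riemannian manifold with Levi-Civita connection $\nabla^g$ and curvature tensor $R^g(\overline X,\overline Y)\overline Z=\nabla^g_{\overline X}\nabla^g_{\overline Y}\overline Z-\nabla^g_{\overline Y}\nabla^g_{\overline X}\overline Z-\nabla^g_{[\overline X,\overline Y]}\overline Z$. Let $G=G_g$ be the associated graded metric on $\Omega(M)$, $U\in\Gamma(M,TM)$, and let $R$ be the curvature tensor of the semi-symmetric metric connection $\nabla$ on $(M,\Omega(M),G_g)$ determined by $P=i_U$. Then for all vector fields $\overline X,\overline Y,\overline Z$ on $M$: \begin{align*} R(L_{\overline X},L_{\overline Y})L_{\overline Z}&=L_{R^g(\overline X,\overline Y)\overline Z}+g(\overline Z,\nabla^g_{\overline X}U)L_{\overline Y}-g(\overline Z,\nabla^g_{\overline Y}U)L_{\overline X}\\ &\quad-d(g(\overline Y,\overline Z))\,i_{\nabla^g_{\overline X}U}+d(g(\overline X,\overline Z))\,i_{\nabla^g_{\overline Y}U}+g(\overline Z,U)g(\overline Y,U)L_{\overline X}\\ &\quad-g(\overline Z,U)g(\overline X,U)L_{\overline Y}+d(g(\overline Y,\overline Z))g(\overline X,U)\,i_U-d(g(\overline X,\overline Z))g(\overline Y,U)\,i_U,\\ R(L_{\overline X},L_{\overline Y})i_{\overline Z}&=i_{R^g(\overline X,\overline Y)\overline Z}-g(\overline Y,\overline Z)\,i_{\nabla^g_{\overline X}U}+g(\overline X,\overline Z)\,i_{\nabla^g_{\overline Y}U}\\ &\quad+g(\overline Y,\overline Z)g(\overline X,U)\,i_U-g(\overline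 X,\overline Z)g(\overline Y,U)\,i_U,\\ R(L_{\overline X},i_{\overline Y})L_{\overline Z}&=i_{R^g(\overline X,\overline Y)\overline Z}+g(\overline Z,\nabla^g_{\overline X}U)\,i_{\overline Y}-g(\overline Y,\overline Z)\,i_{\nabla^g_{\overline X}U}\\ &\quad-g(\overline Z,U)g(\overline X,U)\,i_{\overline Y}+g(\overline Y,\overline Z)g(\overline X,U)\,i_U,\\ R(L_{\overline X},i_{\overline Y})i_{\overline Z}&=0,\qquad R(i_{\overline X},i_{\overline Y})=0. \end{align*}
   Context: Let $M$ be a smooth $m$-dimensional manifold, $\Omega(M)$ its $\mathbb Z_2$-graded commutative algebra of differential forms (products are wedge products), and $\mathrm{Der}\,\Omega(M)$ the graded left $\Omega(M)$-module of graded derivations of $\Omega(M)$, with graded commutator $[X,Y]=XY-(-1)^{|X||Y|}YX$; it is also a right module via $X\cdot\alpha=(-1)^{|\alpha||X|}\alpha X$. All elements appearing in formulas with signs are homogeneous. For a vector field $\overline X$ on $M$, $L_{\overline X}$ (even) is the Lie derivative and $i_{\overline X}$ (odd) is the interior product; for a local frame $\{\overline X_k\}$ of $TM$, $\{L_{\overline X_k},i_{\overline X_k}\}$ is a local frame of $\mathrm{Der}\,\Omega(M)$. A graded metric is a map $G:(X,Y)\mapsto\langle X,Y;G\rangle\in\Omega(M)$ on $\mathrm{Der}\,\Omega(M)$ that is biadditive, satisfies $\langle X,Y;G\rangle=(-1)^{|X||Y|}\langle Y,X;G\rangle$ and $\langle\alpha X,Y;G\rangle=\alpha\langle X,Y;G\rangle=(-1)^{|X||\alpha|}\langle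 X,\alpha Y;G\rangle$, and is non-degenerate ($X\mapsto\langle\cdot,X;G\rangle$ is an isomorphism onto $\mathrm{Hom}(\mathrm{Der}\,\Omega(M),\Omega(M))$). It has parity $|G|$ if $|\langle X,Y;G\rangle|=|X|+|Y|+|G|$ mod 2. For a Riemannian metric $g$, the odd graded metric $G_g$ is determined by $\langle L_{\overline X},L_{\overline Y};G_g\rangle=d(g(\overline X,\overline Y))$, $\langle L_{\overline X},i_{\overline Y};G_g\rangle=\langle i_{\overline X},L_{\overline Y};G_g\rangle=g(\overline X,\overline Y)$, $\langle i_{\overline X},i_{\overline Y};G_g\rangle=0$. A graded connection is a $\mathbb Z_2$-degree preserving biadditive map $\nabla:\mathrm{Der}\,\Omega(M)\times\mathrm{Der}\,\Omega(M)\to\mathrm{Der}\,\Omega(M)$ with $\nabla_{\alpha X}Y=\alpha\nabla_XY$ and $\nabla_X(\alpha Y)=X(\alpha)Y+(-1)^{|X||\alpha|}\alpha\nabla_XY$. Its curvature tensor is $R_\nabla(X,Y)Z=\nabla_X\nabla_YZ-(-1)^{|X||Y|}\nabla_Y\nabla_XZ-\nabla_{[X,Y]}Z$. The graded Levi-Civita connection $\nabla^L$ of $G$ is the unique graded connection that is torsion free ($\nabla^L_XY-(-1)^{|X||Y|}\nabla^L_YX=[X,Y]$) and metric ($X\langle Y,Z;G\rangle=\langle\nabla^L_XY,Z;G\rangle+(-1)^{|X||Y|}\langle Y,\nabla^L_XZ;G\rangle$). For $G=G_g$ it satisfies $\nabla^L_{L_{\overline X}}L_{\overline Y}=L_{\nabla^g_{\overline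 X}\overline Y}$, $\nabla^L_{L_{\overline X}}i_{\overline Y}=\nabla^L_{i_{\overline X}}L_{\overline Y}=i_{\nabla^g_{\overline X}\overline Y}$, $\nabla^L_{i_{\overline X}}i_{\overline Y}=0$. For $P\in\mathrm{Der}\,\Omega(M)$ with $|P|+|G|=0$ mod 2, the semi-symmetric metric connection determined by $P$ is $\nabla_XY=\nabla^L_XY+X\cdot\langle Y,P;G\rangle-\langle X,Y;G\rangle P$. *)

theory Defs
  imports "HOL-Analysis.Analysis" "HOL-Library.Function_Algebras"
begin

section \<open>Smooth manifolds, functions and vector fields\<close>

text \<open>The domain \<open>S\<close> is meant to be open in the following two definitions.\<close>

fun Ck_on :: "nat \<Rightarrow> 'b::euclidean_space set \<Rightarrow> ('b \<Rightarrow> 'c::real_normed_vector) \<Rightarrow> bool" where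
  "Ck_on 0 S f \<longleftrightarrow> continuous_on S f"
| "Ck_on (Suc n) S f \<longleftrightarrow> (\<forall>x\<in>S. f differentiable (at x)) \<and>
     (\<forall>v. Ck_on n S (\<lambda>x. frechet_derivative f (at x) v))"

definition smooth_on :: "'b::euclidean_space set \<Rightarrow> ('b \<Rightarrow> 'c::real_normed_vector) \<Rightarrow> bool" where
  "smooth_on S f \<longleftrightarrow> (\<forall>n. Ck_on n S f)"

text \<open>A manifold is the whole type \<open>'a\<close>, Hausdorff and second countable by its type class, with
  an atlas \<open>A\<close> of charts \<open>(D, \<phi>)\<close> into \<open>'b\<close>; its dimension is \<open>DIM('b)\<close>.\<close>

type_synonym ('a, 'b) atlas = "('a set \<times> ('a \<Rightarrow> 'b)) set"

definition smooth_manifold ::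
    "('a::{t2_space,second_countable_topology}, 'b::euclidean_space) atlas \<Rightarrow> bool" where
  "smooth_manifold A \<longleftrightarrow>
     (\<Union>(D, \<phi>)\<in>A. D) = UNIV \<and>
     (\<forall>(D, \<phi>)\<in>A. open D \<and> open (\<phi> ` D) \<and> homeomorphism D (\<phi> ` D) \<phi> (inv_into D \<phi>)) \<and>
     (\<forall>(D, \<phi>)\<in>A. \<forall>(E, \<psi>)\<in>A. smooth_on (\<phi> ` (D \<inter> E)) (\<psi> \<circ> inv_into D \<phi>))"

definition Cinf :: "('a, 'b::euclidean_space) atlas \<Rightarrow> ('a \<Rightarrow> real) set" where
  "Cinf A = {f. \<forall>(D, \<phi>)\<in>A. smooth_on (\<phi> ` D) (f \<circ> inv_into D \<phi>)}"

text \<open>Vector fields are the derivations of the algebra of smooth functions. Sums, differences and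
  products of functions are pointwise throughout. Here and below, maps defined on a set of smooth
  objects are given the value 0 outside of it, so that equality of maps is equality on that set.\<close>

type_synonym 'a vfield = "('a \<Rightarrow> real) \<Rightarrow> 'a \<Rightarrow> real"

definition vfields :: "('a, 'b::euclidean_space) atlas \<Rightarrow> 'a vfield set" where
  "vfields A = {X.
     (\<forall>f\<in>Cinf A. X f \<in> Cinf A) \<and> (\<forall>f. f \<notin> Cinf A \<longrightarrow> X f = 0) \<and>
     (\<forall>f\<in>Cinf A. \<forall>h\<in>Cinf A. X (f + h) = X f + X h) \<and>
     (\<forall>c. \<forall>f\<in>Cinf A. X (\<lambda>p. c * f p) = (\<lambda>p. c * X f p)) \<and>
     (\<forall>f\<in>Cinf A. \<forall>h\<in>Cinf A. X (f * h) = X f * h + f * X h)}"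

definition vscale :: "('a \<Rightarrow> real) \<Rightarrow> 'a vfield \<Rightarrow> 'a vfield" where
  "vscale f X = (\<lambda>h. f * X h)"

definition vbracket :: "'a vfield \<Rightarrow> 'a vfield \<Rightarrow> 'a vfield" where
  "vbracket X Y = (\<lambda>f. X (Y f) - Y (X f))"


section \<open>Riemannian metrics\<close>

definition riemannian_metric ::
    "('a, 'b::euclidean_space) atlas \<Rightarrow> ('a vfield \<Rightarrow> 'a vfield \<Rightarrow> 'a \<Rightarrow> real) \<Rightarrow> bool" where
  "riemannian_metric A g \<longleftrightarrow>
     (\<forall>X\<in>vfields A. \<forall>Y\<in>vfields A. g X Y \<in> Cinf A \<and> g X Y = g Y X) \<and>
     (\<forall>X\<in>vfields A. \<forall>Y\<in>vfields A. \<forall>Z\<in>vfields A. g (X + Y) Z = g X Z + g Y Z) \<and>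
     (\<forall>f\<in>Cinf A. \<forall>X\<in>vfields A. \<forall>Y\<in>vfields A. g (vscale f X) Y = f * g X Y) \<and>
     (\<forall>X\<in>vfields A. \<forall>p. (\<exists>f\<in>Cinf A. X f p \<noteq> 0) \<longrightarrow> g X X p > 0)"

definition levi_civita_connection ::
    "('a, 'b::euclidean_space) atlas \<Rightarrow> ('a vfield \<Rightarrow> 'a vfield \<Rightarrow> 'a \<Rightarrow> real) \<Rightarrow>
     ('a vfield \<Rightarrow> 'a vfield \<Rightarrow> 'a vfield) \<Rightarrow> bool" where
  "levi_civita_connection A g D \<longleftrightarrow>
     (\<forall>X\<in>vfields A. \<forall>Y\<in>vfields A. D X Y \<in> vfields A) \<and>
     (\<forall>X\<in>vfields A. \<forall>Y\<in>vfields A. \<forall>Z\<in>vfields A.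
        D (X + Y) Z = D X Z + D Y Z \<and> D X (Y + Z) = D X Y + D X Z) \<and>
     (\<forall>f\<in>Cinf A. \<forall>X\<in>vfields A. \<forall>Y\<in>vfields A.
        D (vscale f X) Y = vscale f (D X Y) \<and>
        D X (vscale f Y) = vscale (X f) Y + vscale f (D X Y)) \<and>
     (\<forall>X\<in>vfields A. \<forall>Y\<in>vfields A. D X Y - D Y X = vbracket X Y) \<and>
     (\<forall>X\<in>vfields A. \<forall>Y\<in>vfields A. \<forall>Z\<in>vfields A. X (g Y Z) = g (D X Y) Z + g Y (D X Z))"

definition riemann_curvature ::
    "('a vfield \<Rightarrow> 'a vfield \<Rightarrow> 'a vfield) \<Rightarrow> 'a vfield \<Rightarrow> 'a vfield \<Rightarrow> 'a vfield \<Rightarrow> 'a vfield" where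
  "riemann_curvature D X Y Z = D X (D Y Z) - D Y (D X Z) - D (vbracket X Y) Z"


section \<open>Differential forms\<close>

text \<open>A form of degree \<open>k\<close> is an alternating \<open>Cinf A\<close>-multilinear map from \<open>k\<close>-tuples of vector
  fields to smooth functions. An element of the whole algebra is a function of lists of vector
  fields, whose restriction to lists of length \<open>k\<close> is its component of degree \<open>k\<close>. No finiteness
  condition is needed, since components of degree above the dimension of the manifold vanish.\<close>

type_synonym 'a form = "'a vfield list \<Rightarrow> 'a \<Rightarrow> real"

definition forms :: "('a, 'b::euclidean_space) atlas \<Rightarrow> 'a form set" where
  "forms A = {\<omega>.
     (\<forall>xs. set xs \<subseteq> vfields A \<longrightarrow> \<omega> xs \<in> Cinf A) \<and>
     (\<forall>xs. \<not> set xs \<subseteq> vfields A \<longrightarrow> \<omega> xs = 0) \<and>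
     (\<forall>xs ys. \<forall>f\<in>Cinf A. \<forall>X\<in>vfields A. \<forall>Y\<in>vfields A.
        set xs \<subseteq> vfields A \<longrightarrow> set ys \<subseteq> vfields A \<longrightarrow>
        \<omega> (xs @ (vscale f X + Y) # ys) = f * \<omega> (xs @ X # ys) + \<omega> (xs @ Y # ys)) \<and>
     (\<forall>xs. \<not> distinct xs \<longrightarrow> \<omega> xs = 0)}"

text \<open>Parities are natural numbers, of which only the residue modulo 2 matters;
  \<open>psign n x\<close> is \<open>(-1)\<^sup>n x\<close>.\<close>

definition psign :: "nat \<Rightarrow> 'c::uminus \<Rightarrow> 'c" where
  "psign n x = (if even n then x else - x)"

definition hforms :: "('a, 'b::euclidean_space) atlas \<Rightarrow> nat \<Rightarrow> 'a form set" where
  "hforms A p = {\<omega> \<in> forms A. \<forall>xs. odd (length xs + p) \<longrightarrow> \<omega> xs = 0}"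

definition form_part :: "nat \<Rightarrow> 'a form \<Rightarrow> 'a form" where
  "form_part p \<omega> = (\<lambda>xs. if even (length xs + p) then \<omega> xs else 0)"

definition fn :: "('a \<Rightarrow> real) \<Rightarrow> 'a form" where
  "fn f = (\<lambda>xs. if xs = [] then f else 0)"

text \<open>Differential of a function, as a form of degree one.\<close>

definition df :: "('a, 'b::euclidean_space) atlas \<Rightarrow> ('a \<Rightarrow> real) \<Rightarrow> 'a form" where
  "df A f = (\<lambda>xs. if length xs = 1 \<and> set xs \<subseteq> vfields A then (hd xs) f else 0)"

text \<open>The sum runs over the sets \<open>I\<close> of argument positions that are fed to \<open>\<alpha>\<close>, that is, over all
  shuffles; the exponent counts the inversions of the shuffle.\<close>

definition wedge :: "'a form \<Rightarrow> 'a form \<Rightarrow> 'a form" (infixr "\<^bold>\<and>" 70) where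
  "\<alpha> \<^bold>\<and> \<beta> = (\<lambda>xs. \<Sum>I\<in>Pow {..<length xs}.
     psign (card {(i, j). i < j \<and> i \<in> {..<length xs} - I \<and> j \<in> I})
       (\<alpha> (nths xs I) * \<beta> (nths xs (- I))))"


section \<open>Graded derivations\<close>

type_synonym 'a oper = "'a form \<Rightarrow> 'a form"

text \<open>Homogeneous derivations of parity \<open>p\<close>, and all graded derivations.\<close>

definition hder :: "('a, 'b::euclidean_space) atlas \<Rightarrow> nat \<Rightarrow> 'a oper set" where
  "hder A p = {D.
     (\<forall>\<omega>. \<omega> \<notin> forms A \<longrightarrow> D \<omega> = 0) \<and>
     (\<forall>q. \<forall>\<omega>\<in>hforms A q. D \<omega> \<in> hforms A (p + q)) \<and>
     (\<forall>\<alpha>\<in>forms A. \<forall>\<beta>\<in>forms A. D (\<alpha> + \<beta>) = D \<alpha> + D \<beta>) \<and>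
     (\<forall>c. \<forall>\<alpha>\<in>forms A. D (\<lambda>xs x. c * \<alpha> xs x) = (\<lambda>xs x. c * D \<alpha> xs x)) \<and>
     (\<forall>q. \<forall>\<alpha>\<in>hforms A q. \<forall>\<beta>\<in>forms A. D (\<alpha> \<^bold>\<and> \<beta>) = D \<alpha> \<^bold>\<and> \<beta> + psign (p * q) (\<alpha> \<^bold>\<and> D \<beta>))}"

definition Der :: "('a, 'b::euclidean_space) atlas \<Rightarrow> 'a oper set" where
  "Der A = {D + E | D E. D \<in> hder A 0 \<and> E \<in> hder A 1}"

definition der_part :: "('a, 'b::euclidean_space) atlas \<Rightarrow> nat \<Rightarrow> 'a oper \<Rightarrow> 'a oper" where
  "der_part A p D =
     (\<lambda>\<omega>. if \<omega> \<in> forms A then \<Sum>q<2. form_part (p + q) (D (form_part q \<omega>)) else 0)"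

definition lmul :: "'a form \<Rightarrow> 'a oper \<Rightarrow> 'a oper" (infixr "\<odot>" 68) where
  "\<alpha> \<odot> D = (\<lambda>\<omega>. \<alpha> \<^bold>\<and> D \<omega>)"

text \<open>The next two operations, and the curvature below, involve signs and are given by the usual
  formulas on homogeneous elements (see the lemmas below); on arbitrary elements they are the
  additive extensions.\<close>

definition rmul :: "('a, 'b::euclidean_space) atlas \<Rightarrow> 'a oper \<Rightarrow> 'a form \<Rightarrow> 'a oper" where
  "rmul A D \<alpha> = (\<Sum>p<2. \<Sum>q<2. psign (p * q) (form_part q \<alpha> \<odot> der_part A p D))"

definition gbracket :: "('a, 'b::euclidean_space) atlas \<Rightarrow> 'a oper \<Rightarrow> 'a oper \<Rightarrow> 'a oper" where
  "gbracket A D E = (\<Sum>p<2. \<Sum>q<2.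
     (der_part A p D \<circ> der_part A q E) - psign (p * q) (der_part A q E \<circ> der_part A p D))"

definition Lie :: "('a, 'b::euclidean_space) atlas \<Rightarrow> 'a vfield \<Rightarrow> 'a oper" where
  "Lie A X = (\<lambda>\<omega>. if \<omega> \<in> forms A then
     (\<lambda>xs. if set xs \<subseteq> vfields A
        then X (\<omega> xs) - (\<Sum>i<length xs. \<omega> (xs[i := vbracket X (xs ! i)])) else 0)
     else 0)"

definition iprod :: "('a, 'b::euclidean_space) atlas \<Rightarrow> 'a vfield \<Rightarrow> 'a oper" where
  "iprod A X = (\<lambda>\<omega>. if \<omega> \<in> forms A then (\<lambda>xs. \<omega> (X # xs)) else 0)"


section \<open>Graded metrics, connections and curvature\<close>

type_synonym 'a gmetric = "'a oper \<Rightarrow> 'a oper \<Rightarrow> 'a form"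
type_synonym 'a gconn = "'a oper \<Rightarrow> 'a oper \<Rightarrow> 'a oper"

text \<open>The module of homomorphisms from graded derivations to forms; since the argument is paired
  from the left, these are the left linear maps without signs.\<close>

definition Der_dual :: "('a, 'b::euclidean_space) atlas \<Rightarrow> ('a oper \<Rightarrow> 'a form) set" where
  "Der_dual A = {\<theta>.
     (\<forall>D\<in>Der A. \<theta> D \<in> forms A) \<and>
     (\<forall>D\<in>Der A. \<forall>E\<in>Der A. \<theta> (D + E) = \<theta> D + \<theta> E) \<and>
     (\<forall>\<alpha>\<in>forms A. \<forall>D\<in>Der A. \<theta> (\<alpha> \<odot> D) = \<alpha> \<^bold>\<and> \<theta> D)}"

definition graded_metric :: "('a, 'b::euclidean_space) atlas \<Rightarrow> 'a gmetric \<Rightarrow> bool" where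
  "graded_metric A G \<longleftrightarrow>
     (\<forall>X\<in>Der A. \<forall>Y\<in>Der A. G X Y \<in> forms A) \<and>
     (\<forall>X\<in>Der A. \<forall>Y\<in>Der A. \<forall>Z\<in>Der A.
        G (X + Y) Z = G X Z + G Y Z \<and> G X (Y + Z) = G X Y + G X Z) \<and>
     (\<forall>p q. \<forall>X\<in>hder A p. \<forall>Y\<in>hder A q. G X Y = psign (p * q) (G Y X)) \<and>
     (\<forall>\<alpha>\<in>forms A. \<forall>X\<in>Der A. \<forall>Y\<in>Der A. G (\<alpha> \<odot> X) Y = \<alpha> \<^bold>\<and> G X Y) \<and>
     (\<forall>p q. \<forall>\<alpha>\<in>hforms A q. \<forall>X\<in>hder A p. \<forall>Y\<in>Der A.
        \<alpha> \<^bold>\<and> G X Y = psign (p * q) (G X (\<alpha> \<odot> Y))) \<and>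
     (\<forall>\<theta>\<in>Der_dual A. \<exists>!X. X \<in> Der A \<and> (\<forall>Y\<in>Der A. \<theta> Y = G Y X))"

definition metric_parity :: "('a, 'b::euclidean_space) atlas \<Rightarrow> 'a gmetric \<Rightarrow> nat \<Rightarrow> bool" where
  "metric_parity A G r \<longleftrightarrow>
     (\<forall>p q. \<forall>X\<in>hder A p. \<forall>Y\<in>hder A q. G X Y \<in> hforms A (p + q + r))"

text \<open>\<open>G\<close> is the odd graded metric determined by the Riemannian metric \<open>g\<close>.\<close>

definition associated_graded_metric ::
    "('a, 'b::euclidean_space) atlas \<Rightarrow> ('a vfield \<Rightarrow> 'a vfield \<Rightarrow> 'a \<Rightarrow> real) \<Rightarrow> 'a gmetric \<Rightarrow> bool" where
  "associated_graded_metric A g G \<longleftrightarrow>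
     graded_metric A G \<and> metric_parity A G 1 \<and>
     (\<forall>X\<in>vfields A. \<forall>Y\<in>vfields A.
        G (Lie A X) (Lie A Y) = df A (g X Y) \<and>
        G (Lie A X) (iprod A Y) = fn (g X Y) \<and>
        G (iprod A X) (Lie A Y) = fn (g X Y) \<and>
        G (iprod A X) (iprod A Y) = 0)"

definition graded_connection :: "('a, 'b::euclidean_space) atlas \<Rightarrow> 'a gconn \<Rightarrow> bool" where
  "graded_connection A N \<longleftrightarrow>
     (\<forall>p q. \<forall>X\<in>hder A p. \<forall>Y\<in>hder A q. N X Y \<in> hder A (p + q)) \<and>
     (\<forall>X\<in>Der A. \<forall>Y\<in>Der A. \<forall>Z\<in>Der A.
        N (X + Y) Z = N X Z + N Y Z \<and> N X (Y + Z) = N X Y + N X Z) \<and>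
     (\<forall>\<alpha>\<in>forms A. \<forall>X\<in>Der A. \<forall>Y\<in>Der A. N (\<alpha> \<odot> X) Y = \<alpha> \<odot> N X Y) \<and>
     (\<forall>p q. \<forall>\<alpha>\<in>hforms A q. \<forall>X\<in>hder A p. \<forall>Y\<in>Der A.
        N X (\<alpha> \<odot> Y) = X \<alpha> \<odot> Y + psign (p * q) (\<alpha> \<odot> N X Y))"

definition graded_levi_civita ::
    "('a, 'b::euclidean_space) atlas \<Rightarrow> 'a gmetric \<Rightarrow> 'a gconn \<Rightarrow> bool" where
  "graded_levi_civita A G N \<longleftrightarrow>
     graded_connection A N \<and>
     (\<forall>p q. \<forall>X\<in>hder A p. \<forall>Y\<in>hder A q. N X Y - psign (p * q) (N Y X) = gbracket A X Y) \<and>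
     (\<forall>p q. \<forall>X\<in>hder A p. \<forall>Y\<in>hder A q. \<forall>Z\<in>Der A.
        X (G Y Z) = G (N X Y) Z + psign (p * q) (G Y (N X Z)))"

definition graded_curvature ::
    "('a, 'b::euclidean_space) atlas \<Rightarrow> 'a gconn \<Rightarrow> 'a oper \<Rightarrow> 'a oper \<Rightarrow> 'a oper \<Rightarrow> 'a oper" where
  "graded_curvature A N X Y Z = (\<Sum>p<2. \<Sum>q<2.
     let X' = der_part A p X; Y' = der_part A q Y
     in N X' (N Y' Z) - psign (p * q) (N Y' (N X' Z)) - N (gbracket A X' Y') Z)"

text \<open>The semi-symmetric metric connection determined by \<open>P\<close>, where \<open>N\<close> is the graded
  Levi-Civita connection of \<open>G\<close>.\<close>

definition semi_symmetric ::
    "('a, 'b::euclidean_space) atlas \<Rightarrow> 'a gmetric \<Rightarrow> 'a gconn \<Rightarrow> 'a oper \<Rightarrow> 'a gconn" where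
  "semi_symmetric A G N P X Y = N X Y + rmul A X (G Y P) - G X Y \<odot> P"


section \<open>The signed operations on homogeneous elements\<close>

lemma sum_lessThan_2: "(\<Sum>p<(2::nat). f p) = f 0 + f 1"
  for f :: "nat \<Rightarrow> 'c::comm_monoid_add"
  by (simp add: numeral_2_eq_2)

lemma Ck_on_zero: "Ck_on n S (\<lambda>_. 0)"
  by (induction n) auto

lemma zero_Cinf: "0 \<in> Cinf A"
proof -
  have "((0 :: 'a \<Rightarrow> real) \<circ> h) = (\<lambda>_. 0)" for h :: "'b \<Rightarrow> 'a"
    by (simp add: fun_eq_iff)
  then show ?thesis
    by (auto simp: Cinf_def smooth_on_def Ck_on_zero)
qed

lemma form_part_forms: "\<omega> \<in> forms A \<Longrightarrow> form_part p \<omega> \<in> hforms A p"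
  unfolding forms_def form_part_def hforms_def by (auto simp: zero_Cinf)

lemma form_part_hforms:
  assumes "\<omega> \<in> hforms A q"
  shows "form_part p \<omega> = (if even (p + q) then \<omega> else 0)"
  using assms by (auto simp: hforms_def form_part_def fun_eq_iff)

lemma zero_forms: "0 \<in> forms A"
  by (auto simp: forms_def zero_Cinf)

lemma hder_zero: "D \<in> hder A p \<Longrightarrow> D 0 = 0"
proof -
  assume D: "D \<in> hder A p"
  have "D (0 + 0) = D 0 + D 0"
    using D zero_forms[of A] unfolding hder_def by blast
  then show ?thesis by simp
qed

lemma form_part_sum: "form_part 0 \<omega> + form_part 1 \<omega> = \<omega>"
  by (auto simp: form_part_def fun_eq_iff)

lemma der_part_hder:
  assumes D: "D \<in> hder A q"
  shows "der_part A p D = (if even (p + q) then D else 0)"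
proof
  fix \<omega>
  show "der_part A p D \<omega> = (if even (p + q) then D else 0) \<omega>"
  proof (cases "\<omega> \<in> forms A")
    case True
    have f: "form_part r \<omega> \<in> hforms A r" for r
      using form_part_forms[OF True] .
    then have h: "D (form_part r \<omega>) \<in> hforms A (q + r)" for r
      using D unfolding hder_def by blast
    have "D (form_part 0 \<omega> + form_part 1 \<omega>) = D (form_part 0 \<omega>) + D (form_part 1 \<omega>)"
      using D f[of 0] f[of 1] unfolding hder_def hforms_def by blast
    then have s: "D (form_part 0 \<omega>) + D (form_part 1 \<omega>) = D \<omega>"
      by (simp only: form_part_sum)
    have e: "form_part (p + r) (D (form_part r \<omega>)) = (if even (p + q) then D (form_part r \<omega>) else 0)"
      for r
    proof -
      have "even (p + r + (q + r)) = even (p + q)" by presburger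
      then show ?thesis
        using form_part_hforms[OF h[of r], of "p + r"] by (simp only: if_True if_False)
    qed
    have "der_part A p D \<omega> =
        form_part (p + 0) (D (form_part 0 \<omega>)) + form_part (p + 1) (D (form_part 1 \<omega>))"
      using True unfolding der_part_def by (simp only: sum_lessThan_2 if_True)
    also have "\<dots> = (if even (p + q) then D \<omega> else 0)"
      unfolding e using s by auto
    finally show ?thesis by auto
  next
    case False
    then show ?thesis using D by (auto simp: der_part_def hder_def)
  qed
qed

lemma psign_zero: "psign n (0::'c::group_add) = 0"
  by (simp add: psign_def)

lemma rmul_homogeneous:
  assumes "D \<in> hder A p" "\<alpha> \<in> hforms A q"
  shows "rmul A D \<alpha> = psign (p * q) (\<alpha> \<odot> D)"
proof -
  have z: "(0 \<odot> E) = 0" "\<beta> \<odot> 0 = 0" for E :: "'a oper" and \<beta> :: "'a form"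
    by (simp_all add: lmul_def wedge_def psign_zero zero_fun_def[symmetric])
  show ?thesis
    unfolding rmul_def sum_lessThan_2 der_part_hder[OF assms(1)] form_part_hforms[OF assms(2)]
    by (auto simp: psign_def z)
qed

lemma gbracket_homogeneous:
  assumes "D \<in> hder A p" "E \<in> hder A q"
  shows "gbracket A D E = (D \<circ> E) - psign (p * q) (E \<circ> D)"
proof -
  have z: "(0 \<circ> F) = 0" "D \<circ> 0 = 0" "E \<circ> 0 = 0" for F :: "'a oper"
    using hder_zero[OF assms(1)] hder_zero[OF assms(2)] by (simp_all add: fun_eq_iff)
  show ?thesis
    unfolding gbracket_def sum_lessThan_2 der_part_hder[OF assms(1)] der_part_hder[OF assms(2)]
    by (auto simp: psign_def z)
qed

end

theory Submission
  imports Defs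
begin

text \<open>The curvature is computed from the values of the semi-symmetric connection on Lie derivatives
  and interior products, which requires the graded Levi-Civita connection on them. The difference
  between that connection and the expected formula, paired with a third generator, is graded
  symmetric in the first two and graded antisymmetric in the last two arguments, so it vanishes.

  To conclude from this by non-degeneracy, and to extend the vanishing of the curvature on two
  interior products to all of the derivations, one needs that Lie derivatives and interior products
  generate the derivations locally. Let \<open>\<rho>\<close> be a bump function in a chart. After multiplication by a
  power of \<open>\<rho>\<close>, Hadamard's lemma expands a derivation on functions and on their differentials in
  terms of globally defined multiples of the coordinate fields; a derivation that vanishes on
  functions and differentials vanishes on all forms by Euler's identity and induction on the degree.\<close>

section \<open>Calculus of smooth functions\<close>

text \<open>Vector fields are derivations of the algebra of global functions, so neither restriction
  to a chart nor a frame of the tangent bundle is available to start from. Local statements are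
  phrased by globally defined objects and multiplied by a function that vanishes outside of a chart;
  division by it takes place only at the end, at a single point where it is nonzero. The second
  obstacle are the signs. The wedge product is a sum over shuffles; its Leibniz rule for contraction
  with the leading argument is extracted from this sum once, and later identities between forms are
  inductions on the list of arguments. Writing Lie derivatives and interior products as one family
  indexed by parity, with value 0 from parity 2 on, merges the cases of bracket, metric and
  connection into single formulas. In the symmetry argument each of the exponents
  \<open>p * q\<close>, \<open>p * r\<close>, \<open>q * r\<close> occurs twice, so the graded signs
  cancel and the classical conclusion \<open>w = - w\<close> remains.\<close>

lemma Ck_on_mono: "Ck_on n T f \<Longrightarrow> S \<subseteq> T \<Longrightarrow> Ck_on n S f"
  by (induction n arbitrary: f) (auto intro: continuous_on_subset)

lemma Ck_on_SucD: "Ck_on (Suc n) S f \<Longrightarrow> Ck_on n S f"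
proof (induction n arbitrary: f)
  case 0
  then have "\<forall>x\<in>S. f differentiable (at x)"
    by simp
  then show ?case
    by (simp add: continuous_on_eq_continuous_within continuous_at_imp_continuous_at_within
        differentiable_imp_continuous_within)
qed auto

lemma Ck_on_imp_continuous_on: "Ck_on n S f \<Longrightarrow> continuous_on S f"
proof (induction n)
  case (Suc n)
  then show ?case using Ck_on_SucD by blast
qed simp

lemma frechet_derivative_eq:
  "(f has_derivative f') (at x) \<Longrightarrow> frechet_derivative f (at x) = f'"
  using frechet_derivative_at by metis

lemma Ck_on_cong:
  assumes "open S" "\<And>x. x \<in> S \<Longrightarrow> f x = g x" "Ck_on n S f"
  shows "Ck_on n S g"
  using assms(2,3)
proof (induction n arbitrary: f g)
  case 0
  then show ?case
    by (metis Ck_on.simps(1) continuous_on_cong)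
next
  case (Suc n)
  have d: "(g has_derivative frechet_derivative f (at x)) (at x)" if "x \<in> S" for x
  proof (rule has_derivative_transform_within_open[OF _ assms(1) that])
    show "(f has_derivative frechet_derivative f (at x)) (at x)"
      using Suc.prems(2) that frechet_derivative_works[of f "at x"] by simp
  qed (rule Suc.prems(1))
  have "Ck_on n S (\<lambda>x. frechet_derivative g (at x) v)" for v
  proof (rule Suc.IH)
    show "Ck_on n S (\<lambda>x. frechet_derivative f (at x) v)"
      using Suc.prems by simp
  qed (use d frechet_derivative_eq in metis)
  then show ?case
    using d by (auto simp: differentiable_def)
qed

lemma Ck_on_Un:
  assumes "open S" "open T" "Ck_on n S f" "Ck_on n T f"
  shows "Ck_on n (S \<union> T) f"
  using assms(3,4) by (induction n arbitrary: f) (auto simp: assms(1,2) continuous_on_open_Un)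

text \<open>\<open>frechet_derivative\<close> is a choice, but at a point of differentiability any
  explicit derivative determines it. The recursion may thus be checked on a derivative
  \<open>f'\<close> in closed form; \<open>Ck_on_cong\<close> carries the regularity over on the
  open set.\<close>

lemma Ck_on_SucI:
  assumes "open S" "\<And>x. x \<in> S \<Longrightarrow> (f has_derivative f' x) (at x)"
    and "\<And>v. Ck_on n S (\<lambda>x. f' x v)"
  shows "Ck_on (Suc n) S f"
proof -
  have "Ck_on n S (\<lambda>x. frechet_derivative f (at x) v)" for v
    by (rule Ck_on_cong[OF assms(1) _ assms(3)[of v]])
      (simp add: frechet_derivative_eq[OF assms(2)])
  then show ?thesis
    using assms(2) by (auto simp: differentiable_def)
qed

lemma Ck_on_SucE:
  assumes "Ck_on (Suc n) S f"
  obtains f' where "\<And>x. x \<in> S \<Longrightarrow> (f has_derivative f' x) (at x)"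
    and "\<And>v. Ck_on n S (\<lambda>x. f' x v)"
  using assms frechet_derivative_works[of f] by fastforce

lemma Ck_on_const: "Ck_on n S (\<lambda>_. c)"
  by (induction n arbitrary: c) auto

lemma Ck_on_add:
  assumes "open S" "Ck_on n S f" "Ck_on n S g"
  shows "Ck_on n S (\<lambda>x. f x + g x)"
  using assms(2,3)
proof (induction n arbitrary: f g)
  case 0
  then show ?case by (auto intro: continuous_on_add)
next
  case (Suc n)
  obtain f' where f': "\<And>x. x \<in> S \<Longrightarrow> (f has_derivative f' x) (at x)"
    "\<And>v. Ck_on n S (\<lambda>x. f' x v)"
    by (rule Ck_on_SucE[OF Suc.prems(1)]) (rule that)
  obtain g' where g': "\<And>x. x \<in> S \<Longrightarrow> (g has_derivative g' x) (at x)"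
    "\<And>v. Ck_on n S (\<lambda>x. g' x v)"
    by (rule Ck_on_SucE[OF Suc.prems(2)]) (rule that)
  show ?case
    by (rule Ck_on_SucI[OF assms(1) has_derivative_add[OF f'(1) g'(1)] Suc.IH[OF f'(2) g'(2)]])
qed

lemma Ck_on_linear:
  assumes "open S" "bounded_linear L" "Ck_on n S f"
  shows "Ck_on n S (\<lambda>x. L (f x))"
  using assms(3)
proof (induction n arbitrary: f)
  case 0
  then show ?case
    by (auto intro: bounded_linear.continuous_on[OF assms(2)])
next
  case (Suc n)
  obtain f' where f': "\<And>x. x \<in> S \<Longrightarrow> (f has_derivative f' x) (at x)"
    "\<And>v. Ck_on n S (\<lambda>x. f' x v)"
    by (rule Ck_on_SucE[OF Suc.prems]) (rule that)
  show ?case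
    by (rule Ck_on_SucI[OF assms(1) bounded_linear.has_derivative[OF assms(2) f'(1)] Suc.IH[OF f'(2)]])
qed

lemma Ck_on_mult:
  fixes f g :: "'b::euclidean_space \<Rightarrow> real"
  assumes "open S" "Ck_on n S f" "Ck_on n S g"
  shows "Ck_on n S (\<lambda>x. f x * g x)"
  using assms(2,3)
proof (induction n arbitrary: f g)
  case 0
  then show ?case by (auto intro: continuous_on_mult)
next
  case (Suc n)
  obtain f' where f': "\<And>x. x \<in> S \<Longrightarrow> (f has_derivative f' x) (at x)"
    "\<And>v. Ck_on n S (\<lambda>x. f' x v)"
    by (rule Ck_on_SucE[OF Suc.prems(1)]) (rule that)
  obtain g' where g': "\<And>x. x \<in> S \<Longrightarrow> (g has_derivative g' x) (at x)"
    "\<And>v. Ck_on n S (\<lambda>x. g' x v)"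
    by (rule Ck_on_SucE[OF Suc.prems(2)]) (rule that)
  note 0 = Suc.prems[THEN Ck_on_SucD]
  show ?case
    by (rule Ck_on_SucI[OF assms(1) has_derivative_mult[OF f'(1) g'(1)]
        Ck_on_add[OF assms(1) Suc.IH[OF 0(1) g'(2)] Suc.IH[OF f'(2) 0(2)]]])
qed

lemma Ck_on_sum:
  assumes "open S" "\<And>i. i \<in> I \<Longrightarrow> Ck_on n S (f i)"
  shows "Ck_on n S (\<lambda>x. \<Sum>i\<in>I. f i x)"
  using assms(2)
  by (induction I rule: infinite_finite_induct) (auto intro: Ck_on_const Ck_on_add[OF assms(1)])

lemma Ck_on_ident:
  assumes "open S" shows "Ck_on n S (\<lambda>x. x)"
proof (cases n)
  case (Suc m)
  then show ?thesis
    by (auto intro!: Ck_on_SucI[where f' = "\<lambda>x v. v"] assms Ck_on_const)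
qed simp

text \<open>The chain rule gives the derivative of \<open>f\<close> at \<open>g x\<close> in the
  direction \<open>g' x v\<close>, which varies with \<open>x\<close>, whereas the induction
  hypothesis concerns fixed directions. Expanding in the basis leaves products of components of
  \<open>g'\<close> with partial derivatives of \<open>f\<close>.\<close>

lemma Ck_on_compose:
  fixes g :: "'b::euclidean_space \<Rightarrow> 'c::euclidean_space" and f :: "'c \<Rightarrow> real"
  assumes "open S" "open T" "g ` S \<subseteq> T" "Ck_on n S g" "Ck_on n T f"
  shows "Ck_on n S (\<lambda>x. f (g x))"
  using assms(4,5)
proof (induction n arbitrary: f)
  case 0
  then show ?case
    using assms(3) by (auto intro: continuous_on_compose2)
next
  case (Suc n)
  obtain f' where f': "\<And>x. x \<in> T \<Longrightarrow> (f has_derivative f' x) (at x)"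
    "\<And>v. Ck_on n T (\<lambda>x. f' x v)"
    by (rule Ck_on_SucE[OF Suc.prems(2)]) (rule that)
  obtain g' where g': "\<And>x. x \<in> S \<Longrightarrow> (g has_derivative g' x) (at x)"
    "\<And>v. Ck_on n S (\<lambda>x. g' x v)"
    by (rule Ck_on_SucE[OF Suc.prems(1)]) (rule that)
  show ?case
  proof (rule Ck_on_SucI[where f' = "\<lambda>x v. \<Sum>e\<in>Basis. (g' x v \<bullet> e) * f' (g x) e"])
    fix x assume x: "x \<in> S"
    then have f: "(f has_derivative f' (g x)) (at (g x))"
      using f'(1) assms(3) by blast
    then have eq: "f' (g x) u = (\<Sum>e\<in>Basis. (u \<bullet> e) * f' (g x) e)" for u
    proof -
      interpret linear "f' (g x)"
        using f by (simp add: has_derivative_linear)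
      have "f' (g x) u = f' (g x) (\<Sum>e\<in>Basis. (u \<bullet> e) *\<^sub>R e)"
        by (simp add: euclidean_representation)
      then show ?thesis
        by (simp add: sum scale)
    qed
    have "(\<lambda>v. f' (g x) (g' x v)) = (\<lambda>v. \<Sum>e\<in>Basis. (g' x v \<bullet> e) * f' (g x) e)"
      by (rule ext) (rule eq)
    then show "((\<lambda>x. f (g x)) has_derivative (\<lambda>v. \<Sum>e\<in>Basis. (g' x v \<bullet> e) * f' (g x) e)) (at x)"
      using has_derivative_compose[OF g'(1)[OF x] f] by (simp only:)
  next
    fix v
    show "Ck_on n S (\<lambda>x. \<Sum>e\<in>Basis. (g' x v \<bullet> e) * f' (g x) e)"
      by (rule Ck_on_sum[OF assms(1)], rule Ck_on_mult[OF assms(1)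
            Ck_on_linear[OF assms(1) bounded_linear_inner_left g'(2)]])
        (rule Suc.IH[OF Suc.prems(1)[THEN Ck_on_SucD] f'(2)])
  qed (rule assms(1))
qed

section \<open>Integrals along rays and Hadamard's expansion\<close>

lemma convex_ray:
  fixes a x :: "'b::real_vector"
  assumes "convex S" "a \<in> S" "x \<in> S" "t \<in> {0..1}"
  shows "a + t *\<^sub>R (x - a) \<in> S"
proof -
  have "a + t *\<^sub>R (x - a) = (1 - t) *\<^sub>R a + t *\<^sub>R x"
    by (simp add: algebra_simps)
  then show ?thesis
    using convexD_alt[OF assms(1-3), of t] assms(4) by simp
qed

text \<open>Differentiation under the integral sign. Each derivative along the ray brings out
  another factor \<open>t\<close>, so the statement carries a power \<open>t ^ m\<close> and the
  induction on \<open>n\<close> is for all \<open>m\<close>.\<close>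

lemma Ck_on_ray_integral:
  fixes f :: "'b::euclidean_space \<Rightarrow> real"
  assumes "open S" "convex S" "a \<in> S" "Ck_on n S f"
  shows "Ck_on n S (\<lambda>x. integral (cbox 0 1) (\<lambda>t. t ^ m * f (a + t *\<^sub>R (x - a))))"
  using assms(4)
proof (induction n arbitrary: f m)
  case 0
  have r: "(\<lambda>z. a + snd z *\<^sub>R (fst z - a)) ` (S \<times> cbox 0 1) \<subseteq> S"
    using convex_ray[OF assms(2,3)] by auto
  have f: "continuous_on S f"
    using 0 by simp
  have "continuous_on (S \<times> cbox 0 1) (\<lambda>z. a + snd z *\<^sub>R (fst z - a))"
    by (intro continuous_intros)
  then have "continuous_on (S \<times> cbox 0 1) (\<lambda>z. f (a + snd z *\<^sub>R (fst z - a)))"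
    by (rule continuous_on_compose2[OF f _ r])
  then have "continuous_on (S \<times> cbox 0 1) (\<lambda>(x, t). t ^ m * f (a + t *\<^sub>R (x - a)))"
    unfolding case_prod_unfold by (intro continuous_intros)
  then show ?case
    unfolding Ck_on.simps by (rule integral_continuous_on_param)
next
  case (Suc n)
  obtain f' where d: "\<And>x. x \<in> S \<Longrightarrow> (f has_derivative f' x) (at x)"
    "\<And>v. Ck_on n S (\<lambda>x. f' x v)"
    by (rule Ck_on_SucE[OF Suc.prems]) (rule that)
  note c0 = Ck_on_imp_continuous_on[OF Suc.prems] and c1 = Ck_on_imp_continuous_on[OF d(2)]
  define \<rho> where "\<rho> x t = a + t *\<^sub>R (x - a)" for x and t :: real
  have \<rho>: "\<rho> x t \<in> S" if "x \<in> S" "t \<in> cbox 0 1" for x t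
    using convex_ray[OF assms(2,3)] that by (simp add: \<rho>_def)
  \<comment> \<open>\<open>leibniz_rule\<close> expects the derivative as a bounded linear function
    that depends continuously on the parameters; in basis components this continuity is that of the
    partial derivatives.\<close>
  define F where "F x t = (\<Sum>e\<in>Basis. (t ^ Suc m * f' (\<rho> x t) e) *\<^sub>R blinfun_inner_left e)" for x t
  have lin: "f' y u = (\<Sum>e\<in>Basis. (u \<bullet> e) * f' y e)" if "y \<in> S" for y u
  proof -
    interpret linear "f' y"
      using d(1)[OF that] by (simp add: has_derivative_linear)
    have "f' y u = f' y (\<Sum>e\<in>Basis. (u \<bullet> e) *\<^sub>R e)"
      by (simp add: euclidean_representation)
    then show ?thesis
      by (simp add: sum scale)
  qed
  have Fa: "blinfun_apply (F x t) v = t ^ Suc m * f' (\<rho> x t) v" if "x \<in> S" "t \<in> cbox 0 1" for x t v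
    using lin[OF \<rho>[OF that], of v]
    by (simp add: F_def blinfun.sum_left blinfun.scaleR_left sum_distrib_left inner_commute algebra_simps)
  have cF: "continuous_on (S \<times> cbox 0 1) (\<lambda>(x, t). F x t)"
  proof -
    have r: "(\<lambda>z. \<rho> (fst z) (snd z)) ` (S \<times> cbox 0 1) \<subseteq> S"
      using \<rho> by auto
    have "continuous_on (S \<times> cbox 0 1) (\<lambda>z. \<rho> (fst z) (snd z))"
      unfolding \<rho>_def by (intro continuous_intros)
    then have "continuous_on (S \<times> cbox 0 1) (\<lambda>z. f' (\<rho> (fst z) (snd z)) e)" for e
      by (rule continuous_on_compose2[OF c1 _ r])
    then show ?thesis
      unfolding F_def case_prod_unfold by (intro continuous_intros)
  qed
  have cr: "continuous_on (cbox 0 1) (\<rho> x)" and ri: "x \<in> S \<Longrightarrow> \<rho> x ` cbox 0 1 \<subseteq> S" for x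
    using \<rho> unfolding \<rho>_def by (auto intro!: continuous_intros)
  have int0: "(\<lambda>t. t ^ m * f (\<rho> x t)) integrable_on cbox 0 1" if "x \<in> S" for x
    by (intro integrable_continuous continuous_on_mult continuous_on_power continuous_on_id
        continuous_on_compose2[OF c0 cr ri[OF that]])
  have int1: "(\<lambda>t. t ^ Suc m * f' (\<rho> x t) e) integrable_on cbox 0 1" if "x \<in> S" for x e
    by (intro integrable_continuous continuous_on_mult continuous_on_power continuous_on_id
        continuous_on_compose2[OF c1 cr ri[OF that]])
  show ?case
  proof (rule Ck_on_SucI[where f' = "\<lambda>x v. \<Sum>e\<in>Basis. (v \<bullet> e) *
        integral (cbox 0 1) (\<lambda>t. t ^ Suc m * f' (a + t *\<^sub>R (x - a)) e)"])
    fix x assume x: "x \<in> S"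
    have lr: "((\<lambda>x. integral (cbox 0 1) (\<lambda>t. t ^ m * f (\<rho> x t))) has_derivative
        integral (cbox 0 1) (F x)) (at x within S)"
    proof (rule leibniz_rule[OF _ int0 cF x assms(2)])
      fix x t assume xt: "x \<in> S" "t \<in> cbox (0::real) 1"
      have "((\<lambda>x. \<rho> x t) has_derivative (\<lambda>v. t *\<^sub>R v)) (at x within S)"
        unfolding \<rho>_def by (auto intro!: derivative_eq_intros)
      then have "((\<lambda>x. f (\<rho> x t)) has_derivative (\<lambda>v. f' (\<rho> x t) (t *\<^sub>R v))) (at x within S)"
        by (rule has_derivative_compose) (rule d(1)[OF \<rho>[OF xt]])
      moreover have "f' (\<rho> x t) (t *\<^sub>R v) = t * f' (\<rho> x t) v" for v
        using has_derivative_linear[OF d(1)[OF \<rho>[OF xt]]] by (simp add: linear_cmul)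
      ultimately have "((\<lambda>x. t ^ m * f (\<rho> x t)) has_derivative (\<lambda>v. t ^ m * (t * f' (\<rho> x t) v))) (at x within S)"
        by (auto intro!: derivative_eq_intros)
      then show "((\<lambda>x. t ^ m * f (\<rho> x t)) has_derivative blinfun_apply (F x t)) (at x within S)"
      proof (rule back_subst[where P = "\<lambda>d. (_ has_derivative d) _"])
        show "(\<lambda>v. t ^ m * (t * f' (\<rho> x t) v)) = blinfun_apply (F x t)"
          using Fa[OF xt] by (simp add: fun_eq_iff)
      qed
    qed
    have bl: "blinfun_apply (integral (cbox 0 1) (F x)) v =
        (\<Sum>e\<in>Basis. (v \<bullet> e) * integral (cbox 0 1) (\<lambda>t. t ^ Suc m * f' (\<rho> x t) e))" for v
    proof -
      have "(F x has_integral (\<Sum>e\<in>Basis.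
          integral (cbox 0 1) (\<lambda>t. t ^ Suc m * f' (\<rho> x t) e) *\<^sub>R blinfun_inner_left e)) (cbox 0 1)"
        unfolding F_def
        by (rule has_integral_sum[OF finite_Basis], rule has_integral_scaleR_left)
          (rule integrable_integral[OF int1[OF x]])
      then have "integral (cbox 0 1) (F x) = (\<Sum>e\<in>Basis.
          integral (cbox 0 1) (\<lambda>t. t ^ Suc m * f' (\<rho> x t) e) *\<^sub>R blinfun_inner_left e)"
        by (rule integral_unique)
      then show ?thesis
        by (simp add: blinfun.sum_left blinfun.scaleR_left inner_commute mult.commute)
    qed
    have "blinfun_apply (integral (cbox 0 1) (F x)) = (\<lambda>v. \<Sum>e\<in>Basis. (v \<bullet> e) *
          integral (cbox 0 1) (\<lambda>t. t ^ Suc m * f' (\<rho> x t) e))"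
      by (rule ext) (rule bl)
    with lr show "((\<lambda>x. integral (cbox 0 1) (\<lambda>t. t ^ m * f (a + t *\<^sub>R (x - a)))) has_derivative
        (\<lambda>v. \<Sum>e\<in>Basis. (v \<bullet> e) *
          integral (cbox 0 1) (\<lambda>t. t ^ Suc m * f' (a + t *\<^sub>R (x - a)) e))) (at x)"
      unfolding at_within_open[OF x assms(1)] \<rho>_def by (simp only:)
  next
    fix v
    show "Ck_on n S (\<lambda>x. \<Sum>e\<in>Basis. (v \<bullet> e) *
          integral (cbox 0 1) (\<lambda>t. t ^ Suc m * f' (a + t *\<^sub>R (x - a)) e))"
    proof (rule Ck_on_sum[OF assms(1)])
      fix e :: 'b
      have "Ck_on n S (\<lambda>x. integral (cbox 0 1) (\<lambda>t. t ^ Suc m * f' (a + t *\<^sub>R (x - a)) e))"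
        using Suc.IH[OF d(2)[of e], of "Suc m"] .
      then show "Ck_on n S (\<lambda>x. (v \<bullet> e) *
          integral (cbox 0 1) (\<lambda>t. t ^ Suc m * f' (a + t *\<^sub>R (x - a)) e))"
        by (rule Ck_on_linear[OF assms(1) bounded_linear_mult_right])
    qed
  qed (rule assms(1))
qed

lemma smooth_on_mono: "smooth_on T f \<Longrightarrow> S \<subseteq> T \<Longrightarrow> smooth_on S f"
  unfolding smooth_on_def using Ck_on_mono by blast

lemma smooth_on_cong: "open S \<Longrightarrow> (\<And>x. x \<in> S \<Longrightarrow> f x = g x) \<Longrightarrow> smooth_on S f \<Longrightarrow> smooth_on S g"
  unfolding smooth_on_def using Ck_on_cong[of S f g] by simp

lemma smooth_on_Un: "open S \<Longrightarrow> open T \<Longrightarrow> smooth_on S f \<Longrightarrow> smooth_on T f \<Longrightarrow> smooth_on (S \<union> T) f"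
  unfolding smooth_on_def using Ck_on_Un by blast

lemma smooth_on_const: "smooth_on S (\<lambda>_. c)"
  unfolding smooth_on_def using Ck_on_const by blast

lemma smooth_on_add:
  "open S \<Longrightarrow> smooth_on S f \<Longrightarrow> smooth_on S g \<Longrightarrow> smooth_on S (\<lambda>x. f x + g x)"
  unfolding smooth_on_def by (simp add: Ck_on_add)

lemma smooth_on_mult:
  fixes f g :: "'b::euclidean_space \<Rightarrow> real"
  shows "open S \<Longrightarrow> smooth_on S f \<Longrightarrow> smooth_on S g \<Longrightarrow> smooth_on S (\<lambda>x. f x * g x)"
  unfolding smooth_on_def by (simp add: Ck_on_mult)

lemma smooth_on_sum:
  "open S \<Longrightarrow> (\<And>i. i \<in> I \<Longrightarrow> smooth_on S (f i)) \<Longrightarrow> smooth_on S (\<lambda>x. \<Sum>i\<in>I. f i x)"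
  unfolding smooth_on_def by (simp add: Ck_on_sum)

lemma smooth_on_inner: "open S \<Longrightarrow> smooth_on S (\<lambda>x. x \<bullet> e)"
  unfolding smooth_on_def by (simp add: Ck_on_linear[OF _ bounded_linear_inner_left Ck_on_ident])

lemma smooth_on_compose:
  fixes g :: "'b::euclidean_space \<Rightarrow> 'c::euclidean_space" and f :: "'c \<Rightarrow> real"
  assumes "open S" "open T" "g ` S \<subseteq> T" "smooth_on S g" "smooth_on T f"
  shows "smooth_on S (\<lambda>x. f (g x))"
  using assms(4,5) Ck_on_compose[OF assms(1-3)] unfolding smooth_on_def by simp

lemma smooth_on_derivative:
  "smooth_on S f \<Longrightarrow> smooth_on S (\<lambda>x. frechet_derivative f (at x) v)"
  unfolding smooth_on_def using Ck_on.simps(2) by blast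

lemma smooth_on_has_derivative:
  "smooth_on S f \<Longrightarrow> x \<in> S \<Longrightarrow> (f has_derivative frechet_derivative f (at x)) (at x)"
  unfolding smooth_on_def using Ck_on.simps(2) frechet_derivative_works by blast

lemma smooth_on_ray_integral:
  fixes f :: "'b::euclidean_space \<Rightarrow> real"
  assumes "open S" "convex S" "a \<in> S" "smooth_on S f"
  shows "smooth_on S (\<lambda>x. integral {0..1} (\<lambda>t. f (a + t *\<^sub>R (x - a))))"
  using Ck_on_ray_integral[OF assms(1-3), where m = 0] assms(4)
  unfolding smooth_on_def by simp

text \<open>The fundamental theorem of calculus along the ray from \<open>a\<close> to
  \<open>x\<close>: \<open>f x - f a\<close> is the integral of the derivative of \<open>f\<close>
  in the direction \<open>x - a\<close>. In components, \<open>h e\<close> is the mean of the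
  partial derivative over the ray, which at \<open>x = a\<close> is the partial derivative
  itself.\<close>

lemma hadamard_lemma:
  fixes f :: "'b::euclidean_space \<Rightarrow> real"
  assumes S: "open S" "convex S" "a \<in> S" and f: "smooth_on S f"
  obtains h where "\<And>e. smooth_on S (h e)"
    and "\<And>x. x \<in> S \<Longrightarrow> f x = f a + (\<Sum>e\<in>Basis. (x \<bullet> e - a \<bullet> e) * h e x)"
    and "\<And>e. h e a = frechet_derivative f (at a) e"
proof
  let ?f' = "\<lambda>x. frechet_derivative f (at x)"
  let ?h = "\<lambda>e x. integral {0..1} (\<lambda>t. ?f' (a + t *\<^sub>R (x - a)) e)"
  show "smooth_on S (?h e)" for e
    by (rule smooth_on_ray_integral[OF S smooth_on_derivative[OF f]])
  show "?h e a = ?f' a e" for e by simp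
  fix x assume x: "x \<in> S"
  define r where "r t = a + t *\<^sub>R (x - a)" for t :: real
  have r: "r t \<in> S" if "t \<in> {0..1}" for t
    using convex_ray[OF S(2,3) x that] by (simp add: r_def)
  have cont: "continuous_on {0..1} (\<lambda>t. ?f' (r t) e)" for e
  proof -
    have "continuous_on S (\<lambda>y. ?f' y e)"
      using smooth_on_derivative[OF f, of e] Ck_on_imp_continuous_on unfolding smooth_on_def by blast
    moreover have "continuous_on {0..1} r"
      unfolding r_def by (intro continuous_intros)
    moreover have "r ` {0..1} \<subseteq> S"
      using r by auto
    ultimately show ?thesis
      by (rule continuous_on_compose2)
  qed
  have lin: "?f' (r t) (x - a) = (\<Sum>e\<in>Basis. (x \<bullet> e - a \<bullet> e) * ?f' (r t) e)" if "t \<in> {0..1}" for t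
  proof -
    interpret linear "?f' (r t)"
      using smooth_on_has_derivative[OF f r[OF that]] by (simp add: has_derivative_linear)
    have "?f' (r t) (x - a) = ?f' (r t) (\<Sum>e\<in>Basis. ((x - a) \<bullet> e) *\<^sub>R e)"
      by (simp only: euclidean_representation)
    also have "\<dots> = (\<Sum>e\<in>Basis. (x \<bullet> e - a \<bullet> e) * ?f' (r t) e)"
      by (simp only: sum scale real_scaleR_def inner_diff_left)
    finally show ?thesis .
  qed
  have "((\<lambda>t. ?f' (r t) (x - a)) has_integral (f (r 1) - f (r 0))) {0..1}"
  proof (rule fundamental_theorem_of_calculus)
    fix t :: real assume t: "t \<in> {0..1}"
    have "(r has_derivative (\<lambda>s. s *\<^sub>R (x - a))) (at t within {0..1})"
      unfolding r_def by (auto intro!: derivative_eq_intros)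
    then have "((\<lambda>t. f (r t)) has_derivative (\<lambda>s. ?f' (r t) (s *\<^sub>R (x - a)))) (at t within {0..1})"
      by (rule has_derivative_compose) (rule smooth_on_has_derivative[OF f r[OF t]])
    moreover have "?f' (r t) (s *\<^sub>R (x - a)) = s *\<^sub>R ?f' (r t) (x - a)" for s
      using has_derivative_linear[OF smooth_on_has_derivative[OF f r[OF t]]]
      by (rule linear_cmul)
    ultimately show "((\<lambda>t. f (r t)) has_vector_derivative ?f' (r t) (x - a)) (at t within {0..1})"
      by (simp add: has_vector_derivative_def)
  qed simp
  then have "((\<lambda>t. \<Sum>e\<in>Basis. (x \<bullet> e - a \<bullet> e) * ?f' (r t) e) has_integral (f x - f a)) {0..1}"
    using lin has_integral_cong[of "{0..1}" "\<lambda>t. ?f' (r t) (x - a)"] by (simp add: r_def)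
  moreover have "((\<lambda>t. \<Sum>e\<in>Basis. (x \<bullet> e - a \<bullet> e) * ?f' (r t) e) has_integral
      (\<Sum>e\<in>Basis. (x \<bullet> e - a \<bullet> e) * ?h e x)) {0..1}"
  proof (rule has_integral_sum)
    fix e :: 'b
    have "((\<lambda>t. ?f' (r t) e) has_integral ?h e x) {0..1}"
      using integrable_integral[OF integrable_continuous_real[OF cont]] unfolding r_def .
    then show "((\<lambda>t. (x \<bullet> e - a \<bullet> e) * ?f' (r t) e) has_integral
        (x \<bullet> e - a \<bullet> e) * ?h e x) {0..1}"
      by (rule has_integral_mult_right)
  qed simp
  ultimately have "f x - f a = (\<Sum>e\<in>Basis. (x \<bullet> e - a \<bullet> e) * ?h e x)"
    by (rule has_integral_unique)
  then show "f x = f a + (\<Sum>e\<in>Basis. (x \<bullet> e - a \<bullet> e) * ?h e x)" by simp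
qed

text \<open>The function \<open>exp (- 1 / t)\<close> extended by 0, together with its multiples by
  powers of \<open>1 / t\<close>. Derivatives of these are linear combinations of members of the
  same family, which makes all of them smooth by induction.\<close>

definition flat :: "nat \<Rightarrow> real \<Rightarrow> real" where
  "flat k t = (if t > 0 then exp (- inverse t) * inverse t ^ k else 0)"

lemma flat_tendsto_0: "(flat k \<longlongrightarrow> 0) (at 0)"
proof -
  have "((\<lambda>t. inverse t ^ k / exp (inverse t)) \<longlongrightarrow> 0) (at_right (0::real))"
    by (rule filterlim_compose[OF tendsto_power_div_exp_0 filterlim_inverse_at_top_right])
  then have "(flat k \<longlongrightarrow> 0) (at_right 0)"
  proof (rule Lim_transform_eventually)
    show "\<forall>\<^sub>F t in at_right 0. inverse t ^ k / exp (inverse t) = flat k t"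
      using eventually_at_right_less
      by eventually_elim (simp add: flat_def exp_minus divide_inverse mult.commute)
  qed
  moreover have "(flat k \<longlongrightarrow> 0) (at_left 0)"
  proof (rule Lim_transform_eventually[OF tendsto_const])
    show "\<forall>\<^sub>F t in at_left 0. 0 = flat k t"
      by (auto simp: flat_def eventually_at_filter)
  qed
  ultimately show ?thesis
    by (simp add: filterlim_split_at)
qed

lemma flat_has_derivative:
  "(flat k has_derivative (\<lambda>v. v * (flat (k + 2) t - k * flat (k + 1) t))) (at t)"
proof -
  consider "t > 0" | "t < 0" | "t = 0" by linarith
  then have "(flat k has_real_derivative (flat (k + 2) t - real k * flat (k + 1) t)) (at t)"
  proof cases
    case 1
    have i: "(inverse has_real_derivative - (inverse t ^ 2)) (at t)"
      using DERIV_inverse[of t] 1 by (simp add: power2_eq_square)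
    have "((\<lambda>t. inverse t ^ k) has_real_derivative - (real k * inverse t ^ (k + 1))) (at t)"
    proof (cases k)
      case (Suc m)
      show ?thesis
        by (rule DERIV_cong[OF DERIV_power[OF i]]) (simp add: Suc power2_eq_square)
    qed simp
    moreover have "((\<lambda>t. exp (- inverse t)) has_real_derivative exp (- inverse t) * - (- (inverse t ^ 2))) (at t)"
      by (rule DERIV_fun_exp[OF DERIV_minus[OF i]])
    ultimately have "((\<lambda>t. exp (- inverse t) * inverse t ^ k) has_real_derivative
        exp (- inverse t) * - (- (inverse t ^ 2)) * inverse t ^ k
        + - (real k * inverse t ^ (k + 1)) * exp (- inverse t)) (at t)"
      by (rule DERIV_mult[rotated])
    then have "((\<lambda>t. exp (- inverse t) * inverse t ^ k) has_real_derivative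
        (flat (k + 2) t - k * flat (k + 1) t)) (at t)"
      by (rule DERIV_cong) (use 1 in \<open>simp add: flat_def power_add power2_eq_square\<close>)
    then show ?thesis
    proof (rule has_field_derivative_transform_within_open[where S = "{0<..}"])
      show "\<And>x. x \<in> {0<..} \<Longrightarrow> exp (- inverse x) * inverse x ^ k = flat k x"
        by (simp add: flat_def)
    qed (use 1 in auto)
  next
    case 2
    have "((\<lambda>t. 0) has_real_derivative (flat (k + 2) t - k * flat (k + 1) t)) (at t)"
      using 2 by (simp add: flat_def)
    then show ?thesis
    proof (rule has_field_derivative_transform_within_open[where S = "{..<0}"])
      show "\<And>x. x \<in> {..<0} \<Longrightarrow> 0 = flat k x"
        by (simp add: flat_def)
    qed (use 2 in auto)
  next
    case 3
    \<comment> \<open>At 0 the difference quotient of \<open>flat k\<close> is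
      \<open>flat (Suc k)\<close>, which tends to 0; the claimed formula has the value 0 there
      too.\<close>
    have "((\<lambda>h. (flat k (0 + h) - flat k 0) / h) \<longlongrightarrow> 0) (at 0)"
      by (rule Lim_transform_eventually[OF flat_tendsto_0[of "Suc k"]])
        (simp add: flat_def eventually_at_filter divide_inverse)
    then show ?thesis
      using 3 by (simp add: DERIV_def flat_def)
  qed
  moreover have "(*) (flat (k + 2) t - k * flat (k + 1) t) = (\<lambda>v. v * (flat (k + 2) t - k * flat (k + 1) t))"
    by (rule ext) (rule mult.commute)
  ultimately show ?thesis
    unfolding has_field_derivative_def by (simp only:)
qed

lemma smooth_on_flat: "smooth_on UNIV (flat k)"
proof -
  have "Ck_on n UNIV (flat k)" for n
  proof (induction n arbitrary: k)
    case 0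
    show ?case
      using has_derivative_continuous[OF flat_has_derivative]
      by (simp add: continuous_on_eq_continuous_within)
  next
    case (Suc n)
    show ?case
    proof (rule Ck_on_SucI[OF open_UNIV flat_has_derivative])
      fix v
      have "Ck_on n UNIV (\<lambda>t. flat (k + 2) t + - real k * flat (k + 1) t)"
        by (rule Ck_on_add[OF open_UNIV Suc.IH Ck_on_mult[OF open_UNIV Ck_on_const Suc.IH]])
      then have "Ck_on n UNIV (\<lambda>t. v * (flat (k + 2) t + - real k * flat (k + 1) t))"
        by (rule Ck_on_linear[OF open_UNIV bounded_linear_mult_right])
      then show "Ck_on n UNIV (\<lambda>t. v * (flat (k + 2) t - real k * flat (k + 1) t))"
        by simp
    qed
  qed
  then show ?thesis
    by (simp add: smooth_on_def)
qed

lemma smooth_bump: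
  fixes c :: "'b::euclidean_space"
  obtains u :: "'b \<Rightarrow> real" where "smooth_on UNIV u"
    and "\<And>x. dist c x < r \<Longrightarrow> u x > 0" and "\<And>x. dist c x \<ge> r \<Longrightarrow> u x = 0"
proof
  \<comment> \<open>With \<open>r\<close> times its absolute value instead of the square of
    \<open>r\<close>, the bump is identically 0 for negative \<open>r\<close>, in accordance with
    the empty ball.\<close>
  let ?u = "\<lambda>x. flat 0 (r * \<bar>r\<bar> + (-1) * (\<Sum>e\<in>Basis. (x \<bullet> e + - (c \<bullet> e)) * (x \<bullet> e + - (c \<bullet> e))))"
  have d: "smooth_on UNIV (\<lambda>x. x \<bullet> e + - (c \<bullet> e))" for e
    by (rule smooth_on_add[OF open_UNIV smooth_on_inner[OF open_UNIV] smooth_on_const])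
  have "smooth_on UNIV (\<lambda>x. \<Sum>e\<in>Basis. (x \<bullet> e + - (c \<bullet> e)) * (x \<bullet> e + - (c \<bullet> e)))"
    by (rule smooth_on_sum[OF open_UNIV smooth_on_mult[OF open_UNIV d d]])
  then have "smooth_on UNIV (\<lambda>x. r * \<bar>r\<bar> + (-1) * (\<Sum>e\<in>Basis. (x \<bullet> e + - (c \<bullet> e)) * (x \<bullet> e + - (c \<bullet> e))))"
    by (rule smooth_on_add[OF open_UNIV smooth_on_const smooth_on_mult[OF open_UNIV smooth_on_const]])
  then show "smooth_on UNIV ?u"
    by (rule smooth_on_compose[OF open_UNIV open_UNIV subset_UNIV _ smooth_on_flat])
  have eq: "(\<Sum>e\<in>Basis. (x \<bullet> e + - (c \<bullet> e)) * (x \<bullet> e + - (c \<bullet> e))) = (dist c x)\<^sup>2" for x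
  proof -
    have "(dist c x)\<^sup>2 = (x - c) \<bullet> (x - c)"
      by (simp only: dist_norm norm_minus_commute[of c] power2_norm_eq_inner)
    then show ?thesis
      unfolding euclidean_inner[of "x - c" "x - c"] by (simp add: inner_diff_left)
  qed
  show "?u x > 0" if "dist c x < r" for x
  proof -
    have "(dist c x)\<^sup>2 < r\<^sup>2"
      using that by (simp add: power_strict_mono)
    then show ?thesis
      unfolding eq using order_le_less_trans[OF zero_le_dist that]
      by (simp add: flat_def power2_eq_square)
  qed
  show "?u x = 0" if "dist c x \<ge> r" for x
  proof -
    have "r * \<bar>r\<bar> \<le> (dist c x)\<^sup>2"
    proof (cases "r \<ge> 0")
      case True
      then show ?thesis
        using power_mono[OF that True, of 2] by (simp add: power2_eq_square)
    next
      case False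
      then have "r * \<bar>r\<bar> \<le> 0"
        by (simp add: mult_nonpos_nonneg)
      then show ?thesis
        by (meson order_trans zero_le_power2)
    qed
    then have "\<not> r * \<bar>r\<bar> + (-1) * (dist c x)\<^sup>2 > 0"
      by linarith
    then show ?thesis
      unfolding eq flat_def by (rule if_not_P)
  qed
qed

section \<open>The wedge product\<close>

text \<open>The interior product without the domain test of \<open>iprod\<close>: its Leibniz rule
  then holds for arbitrary functions of lists, and the algebra of the wedge product can be developed
  without reference to a manifold.\<close>

definition contr :: "'a vfield \<Rightarrow> 'a form \<Rightarrow> 'a form" where
  "contr X \<omega> = (\<lambda>xs. \<omega> (X # xs))"

text \<open>The grading involution. It supplies the sign of the Leibniz rule for inhomogeneous
  forms, for which there is no single exponent.\<close>

definition grade_inv :: "'a form \<Rightarrow> 'a form" where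
  "grade_inv \<omega> = (\<lambda>xs. psign (length xs) (\<omega> xs))"

text \<open>The parity half of \<open>hforms\<close>, separated from membership in
  \<open>forms\<close> so that signs can be computed for arbitrary functions of lists.\<close>

definition homog :: "nat \<Rightarrow> 'a form \<Rightarrow> bool" where
  "homog p \<omega> \<longleftrightarrow> (\<forall>xs. odd (length xs + p) \<longrightarrow> \<omega> xs = 0)"

lemma psign_simps:
  fixes x y :: "'c::ring"
  shows "psign (m + n) x = psign m (psign n x)" "psign n (- x) = - psign n x"
    "psign n (x + y) = psign n x + psign n y" "psign n (x - y) = psign n x - psign n y"
    "psign n (x * y) = psign n x * y" "psign 0 x = x" "psign (Suc n) x = - psign n x"
    "psign n (0 :: 'c) = 0"
  by (auto simp: psign_def)

lemma psign_form: "psign n \<omega> xs = psign n (\<omega> xs)" for \<omega> :: "'a form"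
  by (simp add: psign_def)

lemma psign_mult2: "psign n (x * y) = x * psign n y" for x y :: "'c::ring"
  by (simp add: psign_def)

lemma wedge_Nil: "(\<alpha> \<^bold>\<and> \<beta>) [] = \<alpha> [] * \<beta> []"
  by (simp add: wedge_def psign_def)

text \<open>The inversions of a shuffle that involve position 0 exist only if \<open>x\<close> goes to \<open>\<beta>\<close>; then
  there is one for each argument of \<open>\<alpha>\<close>, which is what \<open>grade_inv\<close> counts.\<close>

lemma wedge_Cons:
  "(\<alpha> \<^bold>\<and> \<beta>) (x # xs) = (contr x \<alpha> \<^bold>\<and> \<beta>) xs + (grade_inv \<alpha> \<^bold>\<and> contr x \<beta>) xs"
proof -
  let ?n = "length xs"
  define inv where "inv n I = {(i, j). i < j \<and> i \<in> {..<n} - I \<and> j \<in> I}" for n :: nat and I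
  define T where "T I = psign (card (inv (Suc ?n) I)) (\<alpha> (nths (x # xs) I) * \<beta> (nths (x # xs) (- I)))" for I
  \<comment> \<open>The sets of positions are split according to whether they contain 0; the other
    positions are shifted by one.\<close>
  have P: "Pow {..<Suc ?n} = (\<lambda>I. Suc ` I) ` Pow {..<?n} \<union> (\<lambda>I. insert 0 (Suc ` I)) ` Pow {..<?n}"
  proof (rule set_eqI)
    fix I :: "nat set"
    have "I \<in> Pow {..<Suc ?n} \<longleftrightarrow> I \<in> Pow (insert 0 (Suc ` {..<?n}))"
      by (simp add: lessThan_Suc_eq_insert_0)
    also have "\<dots> \<longleftrightarrow> I \<in> Pow (Suc ` {..<?n}) \<union> insert 0 ` Pow (Suc ` {..<?n})"
      by (simp only: Pow_insert)
    also have "Pow (Suc ` {..<?n}) = (\<lambda>I. Suc ` I) ` Pow {..<?n}"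
      by (rule image_Pow_surj[OF refl, symmetric])
    finally show "I \<in> Pow {..<Suc ?n} \<longleftrightarrow>
        I \<in> (\<lambda>I. Suc ` I) ` Pow {..<?n} \<union> (\<lambda>I. insert 0 (Suc ` I)) ` Pow {..<?n}"
      by (simp add: image_image)
  qed
  have inj: "inj_on (\<lambda>I. Suc ` I) (Pow {..<?n})" "inj_on (\<lambda>I. insert 0 (Suc ` I)) (Pow {..<?n})"
    by (auto simp: inj_on_def)
  have "(\<alpha> \<^bold>\<and> \<beta>) (x # xs) = (\<Sum>I\<in>Pow {..<Suc ?n}. T I)"
    by (simp add: wedge_def T_def inv_def)
  also have "\<dots> = (\<Sum>I\<in>(\<lambda>I. Suc ` I) ` Pow {..<?n}. T I)
      + (\<Sum>I\<in>(\<lambda>I. insert 0 (Suc ` I)) ` Pow {..<?n}. T I)"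
    unfolding P by (rule sum.union_disjoint) auto
  also have "\<dots> = (\<Sum>I\<in>Pow {..<?n}. T (Suc ` I)) + (\<Sum>I\<in>Pow {..<?n}. T (insert 0 (Suc ` I)))"
    by (simp add: sum.reindex[OF inj(1)] sum.reindex[OF inj(2)])
  also have "(\<Sum>I\<in>Pow {..<?n}. T (insert 0 (Suc ` I))) = (contr x \<alpha> \<^bold>\<and> \<beta>) xs"
    unfolding wedge_def
  proof (rule sum.cong[OF refl])
    fix I assume "I \<in> Pow {..<?n}"
    have "inv (Suc ?n) (insert 0 (Suc ` I)) = map_prod Suc Suc ` inv ?n I"
      unfolding inv_def by (force simp: less_Suc_eq_0_disj)
    then have "card (inv (Suc ?n) (insert 0 (Suc ` I))) = card (inv ?n I)"
      using card_image[OF inj_on_subset[OF prod.inj_map[OF inj_Suc inj_Suc] subset_UNIV]] by simp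
    moreover have "{j. Suc j \<in> insert 0 (Suc ` I)} = I" "{j. Suc j \<in> - insert 0 (Suc ` I)} = - I"
      by auto
    ultimately show "T (insert 0 (Suc ` I)) = psign (card {(i, j). i < j \<and> i \<in> {..<?n} - I \<and> j \<in> I})
        (contr x \<alpha> (nths xs I) * \<beta> (nths xs (- I)))"
      by (simp add: T_def nths_Cons contr_def inv_def)
  qed
  also have "(\<Sum>I\<in>Pow {..<?n}. T (Suc ` I)) = (grade_inv \<alpha> \<^bold>\<and> contr x \<beta>) xs"
    unfolding wedge_def
  proof (rule sum.cong[OF refl])
    fix I assume I: "I \<in> Pow {..<?n}"
    then have fI: "finite I"
      by (auto intro: finite_subset)
    have "inv (Suc ?n) (Suc ` I) = (\<lambda>j. (0, Suc j)) ` I \<union> map_prod Suc Suc ` inv ?n I"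
      unfolding inv_def by (force simp: less_Suc_eq_0_disj)
    moreover have "inv ?n I \<subseteq> {..<?n} \<times> I"
      unfolding inv_def by auto
    then have "finite (inv ?n I)"
      using fI finite_subset by blast
    moreover have "card ((\<lambda>j. (0 :: nat, Suc j)) ` I) = card I"
      by (rule card_image) (simp add: inj_on_def)
    moreover have "card (map_prod Suc Suc ` inv ?n I) = card (inv ?n I)"
      by (rule card_image[OF inj_on_subset[OF prod.inj_map[OF inj_Suc inj_Suc] subset_UNIV]])
    moreover have "(\<lambda>j. (0, Suc j)) ` I \<inter> map_prod Suc Suc ` inv ?n I = {}"
      by auto
    ultimately have "card (inv (Suc ?n) (Suc ` I)) = card I + card (inv ?n I)"
      using fI card_Un_disjoint[of "(\<lambda>j. (0, Suc j)) ` I" "map_prod Suc Suc ` inv ?n I"] by simp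
    moreover have "card I = length (nths xs I)"
    proof -
      have "{i. i < ?n \<and> i \<in> I} = I"
        using I by auto
      then show ?thesis
        by (simp add: length_nths)
    qed
    moreover have "{j. Suc j \<in> Suc ` I} = I" "{j. Suc j \<in> - Suc ` I} = - I"
      by auto
    ultimately show "T (Suc ` I) = psign (card {(i, j). i < j \<and> i \<in> {..<?n} - I \<and> j \<in> I})
        (grade_inv \<alpha> (nths xs I) * contr x \<beta> (nths xs (- I)))"
      by (simp add: T_def nths_Cons contr_def inv_def grade_inv_def psign_simps)
        (simp add: psign_def)
  qed
  finally show ?thesis
    by (simp only: add.commute)
qed

lemma contr_wedge: "contr x (\<alpha> \<^bold>\<and> \<beta>) = contr x \<alpha> \<^bold>\<and> \<beta> + grade_inv \<alpha> \<^bold>\<and> contr x \<beta>"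
  by (rule ext) (simp add: contr_def[of _ "_ \<^bold>\<and> _"] wedge_Cons)

lemma wedge_add_left: "(\<alpha> + \<beta>) \<^bold>\<and> \<gamma> = \<alpha> \<^bold>\<and> \<gamma> + \<beta> \<^bold>\<and> \<gamma>"
  by (rule ext) (simp add: wedge_def psign_simps distrib_right sum.distrib)

lemma wedge_add_right: "\<gamma> \<^bold>\<and> (\<alpha> + \<beta>) = \<gamma> \<^bold>\<and> \<alpha> + \<gamma> \<^bold>\<and> \<beta>"
  by (rule ext) (simp add: wedge_def psign_simps distrib_left sum.distrib)

lemma wedge_zero: "0 \<^bold>\<and> \<gamma> = 0" "\<gamma> \<^bold>\<and> 0 = 0"
  by (simp_all add: wedge_def psign_simps fun_eq_iff)

lemma wedge_uminus: "(- \<alpha>) \<^bold>\<and> \<gamma> = - (\<alpha> \<^bold>\<and> \<gamma>)" "\<gamma> \<^bold>\<and> (- \<alpha>) = - (\<gamma> \<^bold>\<and> \<alpha>)"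
  using wedge_add_left[of \<alpha> "- \<alpha>" \<gamma>] wedge_add_right[of \<gamma> \<alpha> "- \<alpha>"]
  by (simp_all add: wedge_zero minus_unique)

lemma wedge_diff_left: "(\<alpha> - \<beta>) \<^bold>\<and> \<gamma> = \<alpha> \<^bold>\<and> \<gamma> - \<beta> \<^bold>\<and> \<gamma>"
  using wedge_add_left[of \<alpha> "- \<beta>" \<gamma>] by (simp add: wedge_uminus)

lemma wedge_diff_right: "\<gamma> \<^bold>\<and> (\<alpha> - \<beta>) = \<gamma> \<^bold>\<and> \<alpha> - \<gamma> \<^bold>\<and> \<beta>"
  using wedge_add_right[of \<gamma> \<alpha> "- \<beta>"] by (simp add: wedge_uminus)

lemma wedge_psign: "psign n \<alpha> \<^bold>\<and> \<gamma> = psign n (\<alpha> \<^bold>\<and> \<gamma>)" "\<gamma> \<^bold>\<and> psign n \<alpha> = psign n (\<gamma> \<^bold>\<and> \<alpha>)"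
  by (simp_all add: psign_def wedge_uminus)

lemmas wedge_linear = wedge_add_left wedge_add_right wedge_zero wedge_uminus wedge_diff_left
  wedge_diff_right wedge_psign

lemma contr_simps:
  "contr X (\<alpha> + \<beta>) = contr X \<alpha> + contr X \<beta>" "contr X (- \<alpha>) = - contr X \<alpha>"
  "contr X (\<alpha> - \<beta>) = contr X \<alpha> - contr X \<beta>" "contr X 0 = 0"
  "contr X (psign n \<alpha>) = psign n (contr X \<alpha>)" "contr X (fn f) = 0"
  by (auto simp: contr_def psign_def fn_def fun_eq_iff)

lemma contr_grade_inv: "contr X (grade_inv \<alpha>) = - grade_inv (contr X \<alpha>)"
  by (simp add: contr_def grade_inv_def psign_simps fun_eq_iff)

lemma grade_inv_grade_inv: "grade_inv (grade_inv \<alpha>) = \<alpha>"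
  by (rule ext) (simp add: grade_inv_def psign_def)

lemma grade_inv_simps:
  "grade_inv (\<alpha> + \<beta>) = grade_inv \<alpha> + grade_inv \<beta>" "grade_inv (- \<alpha>) = - grade_inv \<alpha>"
  "grade_inv (\<alpha> - \<beta>) = grade_inv \<alpha> - grade_inv \<beta>" "grade_inv 0 = 0" "grade_inv (fn f) = fn f"
  by (auto simp: grade_inv_def psign_simps fn_def fun_eq_iff)

text \<open>The contraction of \<open>fn f\<close> is 0 and \<open>grade_inv\<close> fixes it, so in
  each step of the induction only the term that contracts \<open>\<alpha>\<close> survives.\<close>

lemma fn_wedge: "(fn f \<^bold>\<and> \<alpha>) xs = f * \<alpha> xs"
  by (induction xs arbitrary: \<alpha>)
    (simp_all add: wedge_Nil wedge_Cons contr_simps grade_inv_simps wedge_zero, simp_all add: fn_def contr_def)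

lemma wedge_fn: "\<alpha> \<^bold>\<and> fn f = fn f \<^bold>\<and> \<alpha>"
proof
  fix xs show "(\<alpha> \<^bold>\<and> fn f) xs = (fn f \<^bold>\<and> \<alpha>) xs"
    unfolding fn_wedge
    by (induction xs arbitrary: \<alpha>)
      (simp_all add: wedge_Nil wedge_Cons contr_simps grade_inv_simps wedge_zero, simp_all add: fn_def contr_def mult.commute)
qed

lemma grade_inv_wedge: "grade_inv (\<alpha> \<^bold>\<and> \<beta>) = grade_inv \<alpha> \<^bold>\<and> grade_inv \<beta>"
proof
  fix xs show "grade_inv (\<alpha> \<^bold>\<and> \<beta>) xs = (grade_inv \<alpha> \<^bold>\<and> grade_inv \<beta>) xs"
  proof (induction xs arbitrary: \<alpha> \<beta>)
    case Nil
    then show ?case by (simp add: wedge_Nil grade_inv_def psign_def)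
  next
    case (Cons x xs)
    have "grade_inv (\<alpha> \<^bold>\<and> \<beta>) (x # xs) = contr x (grade_inv (\<alpha> \<^bold>\<and> \<beta>)) xs"
      by (simp add: contr_def)
    also have "\<dots> = - grade_inv (contr x \<alpha> \<^bold>\<and> \<beta>) xs - grade_inv (grade_inv \<alpha> \<^bold>\<and> contr x \<beta>) xs"
      by (simp add: contr_grade_inv contr_wedge grade_inv_simps)
    finally show ?case
      by (simp add: Cons.IH wedge_Cons contr_grade_inv wedge_linear grade_inv_grade_inv)
  qed
qed

text \<open>By \<open>contr_wedge\<close> both sides satisfy the same recursion in the leading
  argument, which replaces the bookkeeping of iterated shuffles. The factors vary in the induction
  because contraction and \<open>grade_inv\<close> change them.\<close>

lemma wedge_assoc: "(\<alpha> \<^bold>\<and> \<beta>) \<^bold>\<and> \<gamma> = \<alpha> \<^bold>\<and> (\<beta> \<^bold>\<and> \<gamma>)"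
proof
  fix xs show "((\<alpha> \<^bold>\<and> \<beta>) \<^bold>\<and> \<gamma>) xs = (\<alpha> \<^bold>\<and> (\<beta> \<^bold>\<and> \<gamma>)) xs"
    by (induction xs arbitrary: \<alpha> \<beta> \<gamma>)
      (simp_all add: wedge_Nil mult.assoc wedge_Cons contr_wedge wedge_linear grade_inv_wedge)
qed

lemma grade_inv_homog: "homog p \<alpha> \<Longrightarrow> grade_inv \<alpha> = psign p \<alpha>"
  by (rule ext) (auto simp: homog_def grade_inv_def psign_def)

lemma homog_contr: "homog p \<alpha> \<Longrightarrow> homog (Suc p) (contr x \<alpha>)"
  by (auto simp: homog_def contr_def)

lemma homog_grade_inv: "homog p \<alpha> \<Longrightarrow> homog p (grade_inv \<alpha>)"
  by (auto simp: homog_def grade_inv_def psign_simps)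

lemma homog_wedge:
  assumes "homog p \<alpha>" "homog q \<beta>"
  shows "homog (p + q) (\<alpha> \<^bold>\<and> \<beta>)"
proof -
  have "odd (length xs + (p + q)) \<Longrightarrow> (\<alpha> \<^bold>\<and> \<beta>) xs = 0" for xs
    using assms
  proof (induction xs arbitrary: p q \<alpha> \<beta>)
    case Nil
    then have "\<alpha> [] = 0 \<or> \<beta> [] = 0"
      by (auto simp: homog_def)
    then show ?case
      by (auto simp: wedge_Nil)
  next
    case (Cons x xs)
    have "(contr x \<alpha> \<^bold>\<and> \<beta>) xs = 0"
      by (rule Cons.IH[where p = "Suc p" and q = q]) (use Cons.prems homog_contr in auto)
    moreover have "(grade_inv \<alpha> \<^bold>\<and> contr x \<beta>) xs = 0"
      by (rule Cons.IH[where p = p and q = "Suc q"]) (use Cons.prems homog_contr homog_grade_inv[OF Cons.prems(2)] in auto)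
    ultimately show ?case
      by (simp add: wedge_Cons)
  qed
  then show ?thesis
    by (simp add: homog_def)
qed

text \<open>Contraction shifts the parity of one factor by one, so that exchanging the factors costs
  \<open>(p + 1) * q\<close> or \<open>p * (q + 1)\<close>; the extra \<open>q\<close> or
  \<open>p\<close> accounts for the contraction passing \<open>\<beta>\<close> or
  \<open>\<alpha>\<close>.\<close>

lemma wedge_commute:
  assumes "homog p \<alpha>" "homog q \<beta>"
  shows "\<alpha> \<^bold>\<and> \<beta> = psign (p * q) (\<beta> \<^bold>\<and> \<alpha>)"
proof
  fix xs show "(\<alpha> \<^bold>\<and> \<beta>) xs = psign (p * q) (\<beta> \<^bold>\<and> \<alpha>) xs"
    using assms
  proof (induction xs arbitrary: p q \<alpha> \<beta>)
    case Nil
    show ?case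
    proof (cases "even p \<or> even q")
      case False
      then have "\<alpha> [] = 0"
        using Nil by (auto simp: homog_def)
      then show ?thesis by (simp add: psign_form wedge_Nil psign_simps)
    qed (auto simp: psign_def wedge_Nil mult.commute)
  next
    case (Cons x xs)
    have "(\<alpha> \<^bold>\<and> \<beta>) (x # xs) = (contr x \<alpha> \<^bold>\<and> \<beta>) xs + psign p (\<alpha> \<^bold>\<and> contr x \<beta>) xs"
      by (simp add: wedge_Cons grade_inv_homog[OF Cons.prems(1)] wedge_psign)
    also have "\<dots> = psign (Suc p * q) (\<beta> \<^bold>\<and> contr x \<alpha>) xs + psign p (psign (p * Suc q) (contr x \<beta> \<^bold>\<and> \<alpha>) xs)"
      using Cons.IH[OF homog_contr[OF Cons.prems(1)] Cons.prems(2)]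
        Cons.IH[OF Cons.prems(1) homog_contr[OF Cons.prems(2)]] by (simp add: psign_form)
    also have "\<dots> = psign (p * q) (\<beta> \<^bold>\<and> \<alpha>) (x # xs)"
      by (simp add: psign_form wedge_Cons grade_inv_homog[OF Cons.prems(2)] wedge_psign psign_simps)
        (auto simp: psign_def psign_form)
    finally show ?case .
  qed
qed

lemma wedge_fn_left: "\<alpha> \<^bold>\<and> (fn f \<^bold>\<and> \<beta>) = fn f \<^bold>\<and> (\<alpha> \<^bold>\<and> \<beta>)"
  by (simp only: wedge_assoc[symmetric] wedge_fn[of \<alpha>])

lemmas fun_apply = plus_fun_apply zero_fun_apply one_fun_apply times_fun_apply minus_apply uminus_apply

text \<open>Removed from the simpset because they also rewrite eta-expanded functions inside of other terms.\<close>

declare fun_apply [simp del]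

lemma form_apply:
  fixes \<alpha> \<beta> :: "'a form"
  shows "(\<alpha> + \<beta>) xs = \<alpha> xs + \<beta> xs" "(\<alpha> - \<beta>) xs = \<alpha> xs - \<beta> xs" "(- \<alpha>) xs = - \<alpha> xs"
    "(0 :: 'a form) xs = 0"
  by (rule fun_apply)+

lemma vfield_apply:
  fixes X Y :: "'a vfield"
  shows "(X + Y) f = X f + Y f" "(X - Y) f = X f - Y f" "(- X) f = - X f" "(0 :: 'a vfield) f = 0"
  by (rule fun_apply)+

section \<open>Smooth functions, vector fields and forms\<close>

locale smooth_mfd =
  fixes A :: "('a::{t2_space,second_countable_topology}, 'b::euclidean_space) atlas"
  assumes mfd: "smooth_manifold A"
begin

lemma chart_open: "(D, \<phi>) \<in> A \<Longrightarrow> open D" "(D, \<phi>) \<in> A \<Longrightarrow> open (\<phi> ` D)"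
  using mfd unfolding smooth_manifold_def by blast+

lemma chart_homeomorphism: "(D, \<phi>) \<in> A \<Longrightarrow> homeomorphism D (\<phi> ` D) \<phi> (inv_into D \<phi>)"
  using mfd unfolding smooth_manifold_def by blast

lemma chart_transition:
  "(D, \<phi>) \<in> A \<Longrightarrow> (E, \<psi>) \<in> A \<Longrightarrow> smooth_on (\<phi> ` (D \<inter> E)) (\<psi> \<circ> inv_into D \<phi>)"
  using mfd unfolding smooth_manifold_def by blast

lemma chart_image_open:
  assumes "(D, \<phi>) \<in> A" "open S"
  shows "open (\<phi> ` (D \<inter> S))"
proof -
  have "openin (top_of_set (\<phi> ` D)) (\<phi> ` (D \<inter> S))"
    using homeomorphism_imp_open_map[OF chart_homeomorphism[OF assms(1)]] assms(2)
    by (simp add: openin_open_Int)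
  then show ?thesis
    using openin_open_trans chart_open(2)[OF assms(1)] by blast
qed

lemma ex_chart: "\<exists>D \<phi>. (D, \<phi>) \<in> A \<and> q \<in> D"
proof -
  have "q \<in> (\<Union>(D, \<phi>)\<in>A. D)"
    using mfd unfolding smooth_manifold_def by simp
  then show ?thesis by auto
qed

lemma Cinf_iff: "f \<in> Cinf A \<longleftrightarrow> (\<forall>D \<phi>. (D, \<phi>) \<in> A \<longrightarrow> smooth_on (\<phi> ` D) (\<lambda>x. f (inv_into D \<phi> x)))"
  by (auto simp: Cinf_def comp_def)

lemma Cinf_const: "(\<lambda>_. c) \<in> Cinf A"
  by (simp add: Cinf_iff smooth_on_const)

lemma Cinf_one: "1 \<in> Cinf A"
  using Cinf_const[of 1] by (simp add: one_fun_def)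

lemma Cinf_add: "f \<in> Cinf A \<Longrightarrow> h \<in> Cinf A \<Longrightarrow> f + h \<in> Cinf A"
  by (simp add: Cinf_iff plus_fun_def smooth_on_add chart_open)

lemma Cinf_mult: "f \<in> Cinf A \<Longrightarrow> h \<in> Cinf A \<Longrightarrow> f * h \<in> Cinf A"
  by (simp add: Cinf_iff times_fun_def smooth_on_mult chart_open)

lemma Cinf_uminus: "f \<in> Cinf A \<Longrightarrow> - f \<in> Cinf A"
  using Cinf_mult[OF Cinf_const[of "- 1"], of f] by (simp add: times_fun_def fun_Compl_def)

lemma Cinf_diff: "f \<in> Cinf A \<Longrightarrow> h \<in> Cinf A \<Longrightarrow> f - h \<in> Cinf A"
  by (metis Cinf_add Cinf_uminus add_uminus_conv_diff)

lemma Cinf_sum: "(\<And>i. i \<in> I \<Longrightarrow> f i \<in> Cinf A) \<Longrightarrow> sum f I \<in> Cinf A"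
  by (induction I rule: infinite_finite_induct) (simp_all add: zero_Cinf Cinf_add)

lemma Cinf_psign: "f \<in> Cinf A \<Longrightarrow> psign n f \<in> Cinf A"
  by (simp add: psign_def Cinf_uminus)

lemmas Cinf_intros = zero_Cinf Cinf_const Cinf_one Cinf_add Cinf_mult Cinf_uminus Cinf_diff Cinf_sum
  Cinf_psign

lemma vf_Cinf: "X \<in> vfields A \<Longrightarrow> X f \<in> Cinf A"
  by (cases "f \<in> Cinf A") (simp_all add: vfields_def zero_Cinf)

lemma vf_outside: "X \<in> vfields A \<Longrightarrow> f \<notin> Cinf A \<Longrightarrow> X f = 0"
  unfolding vfields_def by blast

lemma vf_add: "X \<in> vfields A \<Longrightarrow> f \<in> Cinf A \<Longrightarrow> h \<in> Cinf A \<Longrightarrow> X (f + h) = X f + X h"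
  unfolding vfields_def by blast

lemma vf_mult: "X \<in> vfields A \<Longrightarrow> f \<in> Cinf A \<Longrightarrow> h \<in> Cinf A \<Longrightarrow> X (f * h) = X f * h + f * X h"
  unfolding vfields_def by blast

lemma vf_scale: "X \<in> vfields A \<Longrightarrow> f \<in> Cinf A \<Longrightarrow> X (\<lambda>p. c * f p) = (\<lambda>p. c * X f p)"
  unfolding vfields_def by blast

text \<open>From \<open>1 = 1 * 1\<close> one gets that \<open>X 1\<close> is twice itself; real
  multiples follow by linearity.\<close>

lemma vf_const: assumes "X \<in> vfields A" shows "X (\<lambda>_. c) = 0"
proof -
  have "X (\<lambda>_. 1) = 0"
    using vf_mult[OF assms Cinf_one Cinf_one] by (simp add: one_fun_def[symmetric])
  then show ?thesis
    using vf_scale[OF assms Cinf_const[of 1], of c] by (simp add: zero_fun_def)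
qed

lemma vf_zero: "X \<in> vfields A \<Longrightarrow> X 0 = 0"
  using vf_const[of X 0] by (simp add: zero_fun_def)

lemma vf_uminus: assumes X: "X \<in> vfields A" shows "X (- f) = - X f"
proof (cases "f \<in> Cinf A")
  case True
  have "X (f + - f) = X f + X (- f)"
    by (rule vf_add[OF X True Cinf_uminus[OF True]])
  then have "X f + X (- f) = 0"
    using vf_zero[OF X] by simp
  then show ?thesis
    by (rule minus_unique[symmetric])
next
  \<comment> \<open>Smoothness is invariant under negation, so both sides take the default value
    0.\<close>
  case False
  then have "- f \<notin> Cinf A"
    using Cinf_uminus[of "- f"] by auto
  then show ?thesis
    using False vf_outside[OF X, of f] vf_outside[OF X, of "- f"] by simp
qed

lemma vf_diff:
  assumes "X \<in> vfields A" "f \<in> Cinf A" "h \<in> Cinf A"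
  shows "X (f - h) = X f - X h"
  using vf_add[OF assms(1,2) Cinf_uminus[OF assms(3)]]
  by (simp only: vf_uminus[OF assms(1)] add_uminus_conv_diff)

lemma vf_sum:
  "X \<in> vfields A \<Longrightarrow> (\<And>i. i \<in> I \<Longrightarrow> f i \<in> Cinf A) \<Longrightarrow> X (sum f I) = (\<Sum>i\<in>I. X (f i))"
  by (induction I rule: infinite_finite_induct) (simp_all add: vf_zero vf_add Cinf_sum)

lemma vfieldsI:
  assumes "\<And>f. f \<in> Cinf A \<Longrightarrow> X f \<in> Cinf A" "\<And>f. f \<notin> Cinf A \<Longrightarrow> X f = 0"
    and "\<And>f h. f \<in> Cinf A \<Longrightarrow> h \<in> Cinf A \<Longrightarrow> X (f + h) = X f + X h"
    and "\<And>c f. f \<in> Cinf A \<Longrightarrow> X (\<lambda>p. c * f p) = (\<lambda>p. c * X f p)"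
    and "\<And>f h. f \<in> Cinf A \<Longrightarrow> h \<in> Cinf A \<Longrightarrow> X (f * h) = X f * h + f * X h"
  shows "X \<in> vfields A"
  using assms unfolding vfields_def by blast

lemma vfields_zero: "0 \<in> vfields A"
  by (rule vfieldsI) (simp_all add: zero_Cinf fun_eq_iff fun_apply)

lemma vfields_add: "X \<in> vfields A \<Longrightarrow> Y \<in> vfields A \<Longrightarrow> X + Y \<in> vfields A"
  by (rule vfieldsI)
    (simp_all add: vfield_apply Cinf_add vf_Cinf vf_outside vf_add vf_scale vf_mult, simp_all add: fun_eq_iff fun_apply algebra_simps)

lemma vfields_vscale: "f \<in> Cinf A \<Longrightarrow> X \<in> vfields A \<Longrightarrow> vscale f X \<in> vfields A"
  by (rule vfieldsI)
    (simp_all add: vscale_def Cinf_mult vf_Cinf vf_outside vf_add vf_scale vf_mult, simp_all add: fun_eq_iff fun_apply algebra_simps)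

lemma vfields_uminus: "X \<in> vfields A \<Longrightarrow> - X \<in> vfields A"
  using vfields_vscale[OF Cinf_const[of "- 1"], of X]
  by (simp add: vscale_def times_fun_def fun_Compl_def)

lemma vfields_diff: "X \<in> vfields A \<Longrightarrow> Y \<in> vfields A \<Longrightarrow> X - Y \<in> vfields A"
  by (metis vfields_add vfields_uminus add_uminus_conv_diff)

lemma vfields_vbracket:
  assumes "X \<in> vfields A" "Y \<in> vfields A"
  shows "vbracket X Y \<in> vfields A"
proof (rule vfieldsI)
  note [simp] = vf_Cinf[OF assms(1)] vf_Cinf[OF assms(2)] vf_add[OF assms(1)] vf_add[OF assms(2)]
    vf_mult[OF assms(1)] vf_mult[OF assms(2)] vf_scale[OF assms(1)] vf_scale[OF assms(2)]
  show "vbracket X Y f \<in> Cinf A" if "f \<in> Cinf A" for f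
    using that by (simp add: vbracket_def Cinf_diff)
  show "vbracket X Y f = 0" if "f \<notin> Cinf A" for f
    using that by (simp add: vbracket_def vf_outside assms vf_zero)
  show "vbracket X Y (f + h) = vbracket X Y f + vbracket X Y h" if "f \<in> Cinf A" "h \<in> Cinf A" for f h
    using that by (simp add: vbracket_def)
  show "vbracket X Y (\<lambda>p. c * f p) = (\<lambda>p. c * vbracket X Y f p)" if "f \<in> Cinf A" for f c
    using that by (simp add: vbracket_def fun_eq_iff fun_apply algebra_simps)
  show "vbracket X Y (f * h) = vbracket X Y f * h + f * vbracket X Y h" if "f \<in> Cinf A" "h \<in> Cinf A" for f h
    using that by (simp add: vbracket_def Cinf_mult algebra_simps)
qed

lemmas vfields_intros = vfields_zero vfields_add vfields_vscale vfields_uminus vfields_diff vfields_vbracket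

section \<open>Forms: linearity in each slot, alternation and closure properties\<close>

lemma forms_Cinf: "\<omega> \<in> forms A \<Longrightarrow> \<omega> xs \<in> Cinf A"
  by (cases "set xs \<subseteq> vfields A") (simp_all add: forms_def zero_Cinf)

lemma forms_outside: "\<omega> \<in> forms A \<Longrightarrow> \<not> set xs \<subseteq> vfields A \<Longrightarrow> \<omega> xs = 0"
  unfolding forms_def by blast

lemma forms_not_distinct: "\<omega> \<in> forms A \<Longrightarrow> \<not> distinct xs \<Longrightarrow> \<omega> xs = 0"
  unfolding forms_def by blast

lemma forms_slot:
  assumes "\<omega> \<in> forms A" "f \<in> Cinf A" "X \<in> vfields A" "Y \<in> vfields A"
  shows "\<omega> (xs @ (vscale f X + Y) # ys) = f * \<omega> (xs @ X # ys) + \<omega> (xs @ Y # ys)"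
proof (cases "set xs \<subseteq> vfields A \<and> set ys \<subseteq> vfields A")
  case True
  then show ?thesis
    using assms unfolding forms_def by blast
next
  case False
  then have "\<omega> (xs @ Z # ys) = 0" for Z
    by (intro forms_outside[OF assms(1)]) auto
  then show ?thesis by simp
qed

text \<open>Polarization turns vanishing on equal neighbours into antisymmetry under neighbouring
  transpositions; these move equal arguments at any distance next to each other.\<close>

lemma forms_alternatingI:
  assumes smooth: "\<And>xs. \<omega> xs \<in> Cinf A"
    and out: "\<And>xs. \<not> set xs \<subseteq> vfields A \<Longrightarrow> \<omega> xs = 0"
    and slot: "\<And>xs ys f X Y. f \<in> Cinf A \<Longrightarrow> X \<in> vfields A \<Longrightarrow> Y \<in> vfields A \<Longrightarrow>
      \<omega> (xs @ (vscale f X + Y) # ys) = f * \<omega> (xs @ X # ys) + \<omega> (xs @ Y # ys)"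
    and adj: "\<And>xs X ys. X \<in> vfields A \<Longrightarrow> \<omega> (xs @ X # X # ys) = 0"
  shows "\<omega> \<in> forms A"
proof -
  have one: "vscale 1 X = X" for X :: "'a vfield"
    by (simp add: vscale_def)
  have add: "\<omega> (xs @ (X + Y) # ys) = \<omega> (xs @ X # ys) + \<omega> (xs @ Y # ys)"
    if "X \<in> vfields A" "Y \<in> vfields A" for xs X Y ys
    using slot[OF Cinf_one that] by (simp add: one)
  have swap: "\<omega> (xs @ X # Y # ys) = - \<omega> (xs @ Y # X # ys)"
    if XY: "X \<in> vfields A" "Y \<in> vfields A" for xs X Y ys
  proof -
    have "0 = \<omega> (xs @ (X + Y) # (X + Y) # ys)"
      by (simp add: adj vfields_add XY)
    also have "\<dots> = \<omega> (xs @ X # (X + Y) # ys) + \<omega> (xs @ Y # (X + Y) # ys)"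
      by (rule add[OF XY])
    also have "\<omega> (xs @ X # (X + Y) # ys) = \<omega> (xs @ X # X # ys) + \<omega> (xs @ X # Y # ys)"
      using add[OF XY, of "xs @ [X]" ys] by simp
    also have "\<omega> (xs @ Y # (X + Y) # ys) = \<omega> (xs @ Y # X # ys) + \<omega> (xs @ Y # Y # ys)"
      using add[OF XY, of "xs @ [Y]" ys] by simp
    finally show ?thesis
      using XY by (simp add: adj eq_neg_iff_add_eq_0)
  qed
  have rep: "\<omega> (us @ X # ws @ X # vs) = 0"
    if "X \<in> vfields A" "set ws \<subseteq> vfields A" for us X ws vs
    using that(2)
  proof (induction ws arbitrary: us)
    case Nil
    then show ?case using adj[OF that(1)] by simp
  next
    case (Cons w ws)
    then show ?case
      using swap[OF that(1), of w us "ws @ X # vs"] Cons.IH[of "us @ [w]"] by simp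
  qed
  have "\<omega> xs = 0" if nd: "\<not> distinct xs" for xs
  proof (cases "set xs \<subseteq> vfields A")
    case True
    obtain us X ws vs where "xs = us @ [X] @ ws @ [X] @ vs"
      using not_distinct_decomp[OF nd] by blast
    with True rep[of X ws us vs] show ?thesis by simp
  qed (rule out)
  then show ?thesis
    unfolding forms_def using smooth out slot by simp
qed

text \<open>Coinduction: the conditions only concern the first argument, but are required for all
  contractions as well.\<close>

lemma forms_coinduct:
  assumes "\<omega> \<in> \<Phi>"
    and "\<And>\<omega>. \<omega> \<in> \<Phi> \<Longrightarrow> \<omega> [] \<in> Cinf A"
    and "\<And>\<omega> X. \<omega> \<in> \<Phi> \<Longrightarrow> X \<in> vfields A \<Longrightarrow> contr X \<omega> \<in> \<Phi>"
    and "\<And>\<omega> X. \<omega> \<in> \<Phi> \<Longrightarrow> X \<notin> vfields A \<Longrightarrow> contr X \<omega> = 0"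
    and "\<And>\<omega> f X Y. \<omega> \<in> \<Phi> \<Longrightarrow> f \<in> Cinf A \<Longrightarrow> X \<in> vfields A \<Longrightarrow> Y \<in> vfields A \<Longrightarrow>
      contr (vscale f X + Y) \<omega> = fn f \<^bold>\<and> contr X \<omega> + contr Y \<omega>"
    and "\<And>\<omega> X. \<omega> \<in> \<Phi> \<Longrightarrow> X \<in> vfields A \<Longrightarrow> contr X (contr X \<omega>) = 0"
  shows "\<omega> \<in> forms A"
proof (rule forms_alternatingI)
  have cons: "\<omega> (X # xs) = contr X \<omega> xs" for \<omega> X xs
    by (simp add: contr_def)
  show "\<omega> xs \<in> Cinf A" for xs
    using assms(1)
  proof (induction xs arbitrary: \<omega>)
    case (Cons X xs)
    then show ?case
      using assms(3,4)[of \<omega> X] zero_Cinf[of A] by (cases "X \<in> vfields A") (simp_all add: cons form_apply)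
  qed (rule assms(2))
  show "\<not> set xs \<subseteq> vfields A \<Longrightarrow> \<omega> xs = 0" for xs
    using assms(1)
  proof (induction xs arbitrary: \<omega>)
    case (Cons X xs)
    then show ?case
      using assms(3,4)[of \<omega> X] by (cases "X \<in> vfields A") (simp_all add: cons form_apply)
  qed simp
  show "\<omega> (xs @ (vscale f X + Y) # ys) = f * \<omega> (xs @ X # ys) + \<omega> (xs @ Y # ys)"
    if "f \<in> Cinf A" "X \<in> vfields A" "Y \<in> vfields A" for xs ys f X Y
    using assms(1)
  proof (induction xs arbitrary: \<omega>)
    case Nil
    then show ?case
      using assms(5)[OF Nil that] by (simp only: append_Nil cons form_apply fn_wedge)
  next
    case (Cons Z xs)
    then show ?case
      using assms(3,4)[of \<omega> Z] by (cases "Z \<in> vfields A") (simp_all add: cons form_apply)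
  qed
  show "\<omega> (xs @ X # X # ys) = 0" if "X \<in> vfields A" for xs X ys
    using assms(1)
  proof (induction xs arbitrary: \<omega>)
    case Nil
    then show ?case
      using assms(6)[OF _ that] by (simp add: cons form_apply)
  next
    case (Cons Z xs)
    then show ?case
      using assms(3,4)[of \<omega> Z] by (cases "Z \<in> vfields A") (simp_all add: cons form_apply)
  qed
qed

lemma forms_contr:
  assumes "\<omega> \<in> forms A" "X \<in> vfields A"
  shows "contr X \<omega> \<in> forms A"
proof (rule forms_alternatingI)
  show "contr X \<omega> xs \<in> Cinf A" for xs
    by (simp add: contr_def forms_Cinf assms)
  show "\<not> set xs \<subseteq> vfields A \<Longrightarrow> contr X \<omega> xs = 0" for xs
    by (simp add: contr_def forms_outside[OF assms(1)])
  show "contr X \<omega> (xs @ (vscale f Y + Z) # ys) = f * contr X \<omega> (xs @ Y # ys) + contr X \<omega> (xs @ Z # ys)"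
    if "f \<in> Cinf A" "Y \<in> vfields A" "Z \<in> vfields A" for xs ys f Y Z
    using forms_slot[OF assms(1) that, of "X # xs" ys] by (simp add: contr_def)
  show "contr X \<omega> (xs @ Y # Y # ys) = 0" for xs Y ys
    by (simp add: contr_def forms_not_distinct[OF assms(1)])
qed

lemma contr_outside: "\<omega> \<in> forms A \<Longrightarrow> X \<notin> vfields A \<Longrightarrow> contr X \<omega> = 0"
  by (rule ext) (simp add: contr_def forms_outside form_apply)

lemma contr_slot:
  assumes "\<omega> \<in> forms A" "f \<in> Cinf A" "X \<in> vfields A" "Y \<in> vfields A"
  shows "contr (vscale f X + Y) \<omega> = fn f \<^bold>\<and> contr X \<omega> + contr Y \<omega>"
  using forms_slot[OF assms, of "[]"] by (simp add: contr_def fun_eq_iff[where 'a = "'a vfield list"] fn_wedge form_apply)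

lemma contr_vadd:
  assumes "\<omega> \<in> forms A" "X \<in> vfields A" "Y \<in> vfields A"
  shows "contr (X + Y) \<omega> = contr X \<omega> + contr Y \<omega>"
proof -
  have "vscale 1 X = X" "fn 1 \<^bold>\<and> contr X \<omega> = contr X \<omega>"
    by (simp_all add: vscale_def fun_eq_iff[where 'a = "'a vfield list"] fn_wedge form_apply)
  then show ?thesis
    using contr_slot[OF assms(1) Cinf_one assms(2,3)] by simp
qed

lemma contr_vdiff:
  assumes "\<omega> \<in> forms A" "X \<in> vfields A" "Y \<in> vfields A"
  shows "contr (X - Y) \<omega> = contr X \<omega> - contr Y \<omega>"
  using contr_vadd[OF assms(1) vfields_diff[OF assms(2,3)] assms(3)] by (simp add: algebra_simps)

lemma contr_vzero: "\<omega> \<in> forms A \<Longrightarrow> contr 0 \<omega> = 0"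
  using contr_vdiff[of \<omega> 0 0] vfields_zero by simp

lemma contr_vscale:
  assumes "\<omega> \<in> forms A" "f \<in> Cinf A" "X \<in> vfields A"
  shows "contr (vscale f X) \<omega> = fn f \<^bold>\<and> contr X \<omega>"
  using contr_slot[OF assms vfields_zero] by (simp add: contr_vzero[OF assms(1)])

lemma contr_vsum:
  assumes "\<omega> \<in> forms A" "\<And>i. i \<in> I \<Longrightarrow> X i \<in> vfields A"
  shows "contr (\<Sum>i\<in>I. X i) \<omega> = (\<Sum>i\<in>I. contr (X i) \<omega>) \<and> (\<Sum>i\<in>I. X i) \<in> vfields A"
  using assms(2)
  by (induction I rule: infinite_finite_induct)
    (simp_all add: contr_vzero contr_vadd assms(1) vfields_zero vfields_add)

lemma contr_contr: "\<omega> \<in> forms A \<Longrightarrow> contr X (contr X \<omega>) = 0"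
  by (rule ext) (simp add: contr_def forms_not_distinct form_apply)

lemma contr_swap:
  assumes "\<omega> \<in> forms A" "X \<in> vfields A" "Y \<in> vfields A"
  shows "contr X (contr Y \<omega>) = - contr Y (contr X \<omega>)"
proof -
  have "0 = contr (X + Y) (contr (X + Y) \<omega>)"
    using contr_contr[OF assms(1)] by simp
  also have "\<dots> = contr X (contr Y \<omega>) + contr Y (contr X \<omega>)"
    using assms by (simp add: contr_vadd vfields_add forms_contr contr_simps contr_contr)
  finally show ?thesis
    by (simp add: eq_neg_iff_add_eq_0)
qed

lemma forms_add:
  assumes "\<omega> \<in> forms A" "\<eta> \<in> forms A"
  shows "\<omega> + \<eta> \<in> forms A"
proof (rule forms_alternatingI)
  show "(\<omega> + \<eta>) (xs @ (vscale f X + Y) # ys) = f * (\<omega> + \<eta>) (xs @ X # ys) + (\<omega> + \<eta>) (xs @ Y # ys)"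
    if "f \<in> Cinf A" "X \<in> vfields A" "Y \<in> vfields A" for xs ys f X Y
    unfolding form_apply forms_slot[OF assms(1) that] forms_slot[OF assms(2) that]
    by (simp add: algebra_simps)
qed (simp_all add: form_apply assms Cinf_add forms_Cinf forms_outside forms_not_distinct)

lemma forms_mult:
  assumes "h \<in> Cinf A" "\<omega> \<in> forms A"
  shows "fn h \<^bold>\<and> \<omega> \<in> forms A"
proof (rule forms_alternatingI)
  show "(fn h \<^bold>\<and> \<omega>) (xs @ (vscale f X + Y) # ys) = f * (fn h \<^bold>\<and> \<omega>) (xs @ X # ys) + (fn h \<^bold>\<and> \<omega>) (xs @ Y # ys)"
    if "f \<in> Cinf A" "X \<in> vfields A" "Y \<in> vfields A" for xs ys f X Y
    unfolding fn_wedge forms_slot[OF assms(2) that] by (simp add: algebra_simps)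
qed (simp_all add: assms Cinf_mult forms_Cinf forms_outside forms_not_distinct fn_wedge)

lemma forms_uminus: "\<omega> \<in> forms A \<Longrightarrow> - \<omega> \<in> forms A"
proof -
  have "fn (- 1) \<^bold>\<and> \<omega> = - \<omega>"
    by (rule ext) (simp add: fn_wedge form_apply)
  then show "\<omega> \<in> forms A \<Longrightarrow> - \<omega> \<in> forms A"
    using forms_mult[OF Cinf_uminus[OF Cinf_one], of \<omega>] by simp
qed

lemma forms_diff: "\<omega> \<in> forms A \<Longrightarrow> \<eta> \<in> forms A \<Longrightarrow> \<omega> - \<eta> \<in> forms A"
  by (metis forms_add forms_uminus add_uminus_conv_diff)

lemma forms_sum: "(\<And>i. i \<in> I \<Longrightarrow> \<omega> i \<in> forms A) \<Longrightarrow> sum \<omega> I \<in> forms A"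
  by (induction I rule: infinite_finite_induct) (simp_all add: zero_forms forms_add)

lemma forms_grade_inv:
  assumes "\<omega> \<in> forms A"
  shows "grade_inv \<omega> \<in> forms A"
proof (rule forms_alternatingI)
  show "grade_inv \<omega> (xs @ (vscale f X + Y) # ys) = f * grade_inv \<omega> (xs @ X # ys) + grade_inv \<omega> (xs @ Y # ys)"
    if "f \<in> Cinf A" "X \<in> vfields A" "Y \<in> vfields A" for xs ys f X Y
    unfolding grade_inv_def forms_slot[OF assms that] by (simp add: psign_simps(1-4) psign_mult2[of _ f])
qed (simp_all add: grade_inv_def assms Cinf_psign forms_Cinf forms_outside forms_not_distinct psign_simps)

text \<open>Contraction turns one product into a sum of two, so the coinduction runs over finite
  sums of products. They are represented by lists of pairs, on which contraction replaces each pair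
  by two.\<close>

lemma forms_wedge:
  assumes "\<alpha> \<in> forms A" "\<beta> \<in> forms A"
  shows "\<alpha> \<^bold>\<and> \<beta> \<in> forms A"
proof -
  define \<Phi> where "\<Phi> = {\<Sum>(\<alpha>, \<beta>)\<leftarrow>l. \<alpha> \<^bold>\<and> \<beta> | l. set l \<subseteq> forms A \<times> forms A}"
  define W where "W l = (\<Sum>(\<alpha>, \<beta>)\<leftarrow>l. \<alpha> \<^bold>\<and> \<beta>)" for l :: "('a form \<times> 'a form) list"
  have W: "W [] = 0" "W ((\<alpha>, \<beta>) # l) = \<alpha> \<^bold>\<and> \<beta> + W l" for \<alpha> \<beta> l
    by (simp_all add: W_def)
  have cW: "contr X (W l) = W (concat (map (\<lambda>(\<alpha>, \<beta>). [(contr X \<alpha>, \<beta>), (grade_inv \<alpha>, contr X \<beta>)]) l))" for X l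
    by (induction l) (auto simp: W contr_simps contr_wedge add.assoc)
  show ?thesis
  proof (rule forms_coinduct[where \<Phi> = "W ` {l. set l \<subseteq> forms A \<times> forms A}"])
    show "\<alpha> \<^bold>\<and> \<beta> \<in> W ` {l. set l \<subseteq> forms A \<times> forms A}"
      using assms by (intro image_eqI[of _ _ "[(\<alpha>, \<beta>)]"]) (simp_all add: W)
  next
    fix \<omega> assume "\<omega> \<in> W ` {l. set l \<subseteq> forms A \<times> forms A}"
    then obtain l where l: "\<omega> = W l" "set l \<subseteq> forms A \<times> forms A" by blast
    show "\<omega> [] \<in> Cinf A"
      using l(2) unfolding l(1)
      by (induction l) (auto simp: W zero_Cinf wedge_Nil form_apply Cinf_add Cinf_mult forms_Cinf)
    show "contr X \<omega> \<in> W ` {l. set l \<subseteq> forms A \<times> forms A}" if "X \<in> vfields A" for X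
      using l(2) that unfolding l(1) cW
      by (intro imageI) (auto intro!: forms_contr forms_grade_inv)
    show "contr X \<omega> = 0" if "X \<notin> vfields A" for X
      using l(2) that unfolding l(1)
      by (induction l) (auto simp: W contr_simps contr_wedge contr_outside wedge_zero)
    show "contr (vscale f X + Y) \<omega> = fn f \<^bold>\<and> contr X \<omega> + contr Y \<omega>"
      if f: "f \<in> Cinf A" "X \<in> vfields A" "Y \<in> vfields A" for f X Y
    proof -
      show ?thesis
        using l(2) unfolding l(1)
      proof (induction l)
        case Nil
        show ?case by (simp only: W contr_simps wedge_zero add_0)
      next
        case (Cons z l)
        obtain \<alpha> \<beta> where z: "z = (\<alpha>, \<beta>)" by force
        with Cons.prems have ab: "\<alpha> \<in> forms A" "\<beta> \<in> forms A" by auto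
        show ?case
          using Cons.IH Cons.prems
          by (simp add: z W contr_simps contr_wedge contr_slot[OF ab(1) f] contr_slot[OF ab(2) f]
              wedge_linear wedge_assoc wedge_fn_left)
      qed
    qed
    show "contr X (contr X \<omega>) = 0" for X
      using l(2) unfolding l(1)
      by (induction l)
        (auto simp: W contr_simps contr_wedge contr_contr wedge_zero contr_grade_inv wedge_uminus grade_inv_grade_inv)
  qed
qed

lemma forms_fn: "f \<in> Cinf A \<Longrightarrow> fn f \<in> forms A"
  by (rule forms_alternatingI) (auto simp: fn_def zero_Cinf)

lemma contr_df: "contr X (df A f) = (if X \<in> vfields A then fn (X f) else 0)"
  by (rule ext) (auto simp: contr_def df_def fn_def form_apply)

text \<open>Contracting \<open>df A f\<close> gives a function and contracting a function gives 0,
  so adding all smooth functions to the differential yields a set closed under contraction.\<close>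

lemma forms_df: "df A f \<in> forms A"
proof (rule forms_coinduct[where \<Phi> = "insert (df A f) (fn ` Cinf A)"])
  have [simp]: "fn h \<^bold>\<and> fn k + fn l = fn (h * k + l)" for h k l :: "'a \<Rightarrow> real"
    by (rule ext) (simp add: fn_wedge form_apply, simp add: fn_def)
  have z: "fn (0 :: 'a \<Rightarrow> real) = 0"
    by (rule ext) (simp add: fn_def form_apply)
  fix \<omega> assume w: "\<omega> \<in> insert (df A f) (fn ` Cinf A)"
  then show "\<omega> [] \<in> Cinf A"
    by (auto simp: df_def fn_def zero_Cinf)
  show "contr X \<omega> \<in> insert (df A f) (fn ` Cinf A)" if "X \<in> vfields A" for X
    using w that zero_Cinf[of A] by (auto simp: contr_df contr_simps vf_Cinf simp flip: z)
  show "contr X \<omega> = 0" if "X \<notin> vfields A" for X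
    using w that by (auto simp: contr_df contr_simps)
  show "contr (vscale h X + Y) \<omega> = fn h \<^bold>\<and> contr X \<omega> + contr Y \<omega>"
    if "h \<in> Cinf A" "X \<in> vfields A" "Y \<in> vfields A" for h X Y
    using w that vfields_add[OF vfields_vscale[OF that(1,2)] that(3)]
    by (auto simp: contr_df contr_simps wedge_zero) (simp add: vscale_def vfield_apply)
  show "contr X (contr X \<omega>) = 0" for X
    using w by (auto simp: contr_df contr_simps)
qed simp

end

section \<open>Lie derivatives, interior products and graded derivations\<close>

context smooth_mfd begin

lemma vbracket_slot:
  assumes "X \<in> vfields A" "f \<in> Cinf A" "Y \<in> vfields A" "Z \<in> vfields A"
  shows "vbracket X (vscale f Y + Z) = vscale (X f) Y + (vscale f (vbracket X Y) + vbracket X Z)"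
proof
  fix h
  show "vbracket X (vscale f Y + Z) h = (vscale (X f) Y + (vscale f (vbracket X Y) + vbracket X Z)) h"
  proof (cases "h \<in> Cinf A")
    case True
    then show ?thesis
      using assms by (simp add: vfield_apply vbracket_def vscale_def vf_add vf_mult vf_Cinf Cinf_mult algebra_simps)
  next
    case False
    then show ?thesis
      using assms by (simp add: vfield_apply vbracket_def vscale_def vf_outside vf_zero)
  qed
qed

lemma vbracket_jacobi:
  assumes "X \<in> vfields A" "Y \<in> vfields A" "Z \<in> vfields A"
  shows "vbracket X (vbracket Y Z) - vbracket Y (vbracket X Z) = vbracket (vbracket X Y) Z"
proof
  fix h
  show "(vbracket X (vbracket Y Z) - vbracket Y (vbracket X Z)) h = vbracket (vbracket X Y) Z h"
    using assms by (simp add: vfield_apply vbracket_def vf_diff vf_Cinf)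
qed

lemma Lie_outside: "\<omega> \<notin> forms A \<Longrightarrow> Lie A X \<omega> = 0"
  by (simp add: Lie_def)

lemma Lie_Nil: "\<omega> \<in> forms A \<Longrightarrow> Lie A X \<omega> [] = X (\<omega> [])"
  by (simp add: Lie_def)

lemma Lie_apply_outside: "\<not> set xs \<subseteq> vfields A \<Longrightarrow> Lie A X \<omega> xs = 0"
  by (simp add: Lie_def form_apply)

text \<open>Cartan's relation between Lie derivative and interior product: the summand of index 0 in
  \<open>Lie\<close> is the one in which the bracket hits the removed argument. It serves as the
  recursion for \<open>Lie\<close> in the inductions on the arguments.\<close>

lemma contr_Lie:
  assumes "\<omega> \<in> forms A" "X \<in> vfields A" "Y \<in> vfields A"
  shows "contr Y (Lie A X \<omega>) = Lie A X (contr Y \<omega>) - contr (vbracket X Y) \<omega>"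
proof
  fix xs
  show "contr Y (Lie A X \<omega>) xs = (Lie A X (contr Y \<omega>) - contr (vbracket X Y) \<omega>) xs"
  proof (cases "set xs \<subseteq> vfields A")
    case True
    have "Lie A X \<omega> (Y # xs) = X (\<omega> (Y # xs))
        - (\<Sum>i<Suc (length xs). \<omega> ((Y # xs)[i := vbracket X ((Y # xs) ! i)]))"
      using True assms by (simp add: form_apply Lie_def)
    also have "(\<Sum>i<Suc (length xs). \<omega> ((Y # xs)[i := vbracket X ((Y # xs) ! i)]))
        = \<omega> (vbracket X Y # xs) + (\<Sum>i<length xs. \<omega> (Y # xs[i := vbracket X (xs ! i)]))"
      unfolding sum.lessThan_Suc_shift by simp
    moreover have "Lie A X (contr Y \<omega>) xs = X (\<omega> (Y # xs))
        - (\<Sum>i<length xs. \<omega> (Y # xs[i := vbracket X (xs ! i)]))"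
      using True forms_contr[OF assms(1,3)] by (simp add: form_apply Lie_def contr_def)
    ultimately show ?thesis
      by (simp add: form_apply contr_def)
  next
    case False
    then show ?thesis
      using assms(1) by (simp add: form_apply contr_def Lie_apply_outside forms_outside)
  qed
qed

lemma contr_Lie_outside: "Y \<notin> vfields A \<Longrightarrow> contr Y (Lie A X \<omega>) = 0"
  by (rule ext) (simp add: form_apply contr_def Lie_apply_outside)

lemma Lie_add:
  assumes "X \<in> vfields A" "\<alpha> \<in> forms A" "\<beta> \<in> forms A"
  shows "Lie A X (\<alpha> + \<beta>) = Lie A X \<alpha> + Lie A X \<beta>"
  by (rule ext) (simp add: form_apply Lie_def assms forms_add vf_add forms_Cinf sum.distrib algebra_simps)

lemma Lie_zero: "X \<in> vfields A \<Longrightarrow> Lie A X 0 = 0"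
  using Lie_add[OF _ zero_forms zero_forms] by simp

lemma Lie_fn_wedge:
  assumes "X \<in> vfields A" "\<alpha> \<in> forms A" "f \<in> Cinf A"
  shows "Lie A X (fn f \<^bold>\<and> \<alpha>) = fn (X f) \<^bold>\<and> \<alpha> + fn f \<^bold>\<and> Lie A X \<alpha>"
proof
  fix xs
  show "Lie A X (fn f \<^bold>\<and> \<alpha>) xs = (fn (X f) \<^bold>\<and> \<alpha> + fn f \<^bold>\<and> Lie A X \<alpha>) xs"
    using assms by (cases "set xs \<subseteq> vfields A")
      (simp_all add: form_apply Lie_def fn_wedge forms_mult vf_mult forms_Cinf sum_distrib_left[symmetric]
        right_diff_distrib forms_outside)
qed

lemma Lie_grade_inv:
  assumes "X \<in> vfields A" "\<alpha> \<in> forms A"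
  shows "Lie A X (grade_inv \<alpha>) = grade_inv (Lie A X \<alpha>)"
  using assms(2) forms_grade_inv[OF assms(2)] vf_uminus[OF assms(1)]
  by (intro ext[where 'a = "'a vfield list"])
    (simp add: Lie_def grade_inv_def psign_def sum_negf)

lemma forms_Lie:
  assumes "X \<in> vfields A"
  shows "Lie A X \<omega> \<in> forms A"
proof (cases "\<omega> \<in> forms A")
  case True
  \<comment> \<open>Contracting a Lie derivative leaves a Lie derivative plus a contraction with a
    bracket; the arbitrary summand \<open>\<eta>\<close> absorbs the latter, so the set is closed
    under contraction.\<close>
  let ?\<Phi> = "{Lie A X \<omega> + \<eta> | \<omega> \<eta>. \<omega> \<in> forms A \<and> \<eta> \<in> forms A}"
  show ?thesis
  proof (rule forms_coinduct[where \<Phi> = ?\<Phi>])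
    show "Lie A X \<omega> \<in> ?\<Phi>"
      using True zero_forms by force
  next
    fix \<mu> assume "\<mu> \<in> ?\<Phi>"
    then obtain \<omega> \<eta> where \<mu>: "\<mu> = Lie A X \<omega> + \<eta>" "\<omega> \<in> forms A" "\<eta> \<in> forms A" by blast
    show "\<mu> [] \<in> Cinf A"
      using \<mu> assms by (simp add: form_apply Lie_Nil Cinf_add vf_Cinf forms_Cinf)
    show "contr Y \<mu> \<in> ?\<Phi>" if Y: "Y \<in> vfields A" for Y
    proof -
      have "contr Y \<mu> = Lie A X (contr Y \<omega>) + (contr Y \<eta> - contr (vbracket X Y) \<omega>)"
        using \<mu> assms Y by (simp add: contr_simps contr_Lie)
      moreover have "contr Y \<eta> - contr (vbracket X Y) \<omega> \<in> forms A"
        by (intro forms_diff forms_contr \<mu> vfields_vbracket assms Y)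
      ultimately show ?thesis
        using forms_contr[OF \<mu>(2) Y] by blast
    qed
    show "contr Y \<mu> = 0" if "Y \<notin> vfields A" for Y
      using \<mu> that by (simp add: contr_simps contr_Lie_outside contr_outside)
    show "contr (vscale f Y + Z) \<mu> = fn f \<^bold>\<and> contr Y \<mu> + contr Z \<mu>"
      if that: "f \<in> Cinf A" "Y \<in> vfields A" "Z \<in> vfields A" for f Y Z
    proof -
      note b = vfields_vbracket[OF assms that(2)] vfields_vbracket[OF assms that(3)]
      have V: "vscale f Y + Z \<in> vfields A"
        using that by (intro vfields_intros)
      \<comment> \<open>Neither of the two terms of \<open>contr_Lie\<close> is linear over
        functions in the contracted field: both contain \<open>fn (X f)\<close> times
        \<open>contr Y \<omega>\<close>, which cancels in their difference.\<close>
      have "Lie A X (contr (vscale f Y + Z) \<omega>)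
          = fn (X f) \<^bold>\<and> contr Y \<omega> + fn f \<^bold>\<and> Lie A X (contr Y \<omega>) + Lie A X (contr Z \<omega>)"
        unfolding contr_slot[OF \<mu>(2) that]
        using \<mu>(2) that assms by (simp only: Lie_add Lie_fn_wedge forms_mult forms_contr)
      moreover have "contr (vbracket X (vscale f Y + Z)) \<omega>
          = fn (X f) \<^bold>\<and> contr Y \<omega> + (fn f \<^bold>\<and> contr (vbracket X Y) \<omega> + contr (vbracket X Z) \<omega>)"
        unfolding vbracket_slot[OF assms that]
          contr_slot[OF \<mu>(2) vf_Cinf[OF assms] that(2) vfields_add[OF vfields_vscale[OF that(1) b(1)] b(2)]]
          contr_slot[OF \<mu>(2) that(1) b] ..
      ultimately show ?thesis
        unfolding \<mu>(1) contr_simps contr_Lie[OF \<mu>(2) assms V] contr_slot[OF \<mu>(3) that]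
          contr_Lie[OF \<mu>(2) assms that(2)] contr_Lie[OF \<mu>(2) assms that(3)] wedge_linear
        by (simp only: algebra_simps)
    qed
    show "contr Y (contr Y \<mu>) = 0" if Y: "Y \<in> vfields A" for Y
      using \<mu> Y assms contr_swap[OF \<mu>(2) Y vfields_vbracket[OF assms Y]]
      by (simp add: contr_simps contr_Lie contr_contr forms_contr Lie_zero)
  qed
qed (simp add: Lie_outside zero_forms)

lemma Lie_wedge:
  assumes "X \<in> vfields A" "\<alpha> \<in> forms A" "\<beta> \<in> forms A"
  shows "Lie A X (\<alpha> \<^bold>\<and> \<beta>) = Lie A X \<alpha> \<^bold>\<and> \<beta> + \<alpha> \<^bold>\<and> Lie A X \<beta>"
proof
  fix xs
  show "Lie A X (\<alpha> \<^bold>\<and> \<beta>) xs = (Lie A X \<alpha> \<^bold>\<and> \<beta> + \<alpha> \<^bold>\<and> Lie A X \<beta>) xs"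
    using assms(2,3)
  proof (induction xs arbitrary: \<alpha> \<beta>)
    case Nil
    then show ?case
      by (simp add: form_apply Lie_Nil forms_wedge wedge_Nil vf_mult assms(1) forms_Cinf)
  next
    case (Cons Y xs)
    note ab = Cons.prems
    show ?case
    proof (cases "Y \<in> vfields A")
      case False
      then show ?thesis
        using ab assms(1) contr_outside[of _ Y]
        by (simp add: form_apply wedge_Cons contr_Lie_outside contr_outside wedge_zero Lie_apply_outside)
    next
      case Y: True
      have "Lie A X (\<alpha> \<^bold>\<and> \<beta>) (Y # xs) = contr Y (Lie A X (\<alpha> \<^bold>\<and> \<beta>)) xs"
        by (simp add: form_apply contr_def)
      also have "\<dots> = Lie A X (contr Y (\<alpha> \<^bold>\<and> \<beta>)) xs - contr (vbracket X Y) (\<alpha> \<^bold>\<and> \<beta>) xs"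
        using ab assms(1) Y by (simp add: contr_Lie forms_wedge form_apply)
      also have "Lie A X (contr Y (\<alpha> \<^bold>\<and> \<beta>))
          = Lie A X (contr Y \<alpha> \<^bold>\<and> \<beta>) + Lie A X (grade_inv \<alpha> \<^bold>\<and> contr Y \<beta>)"
        unfolding contr_wedge
        by (intro Lie_add assms forms_wedge forms_contr forms_grade_inv ab Y)
      finally show ?thesis
        using Cons.IH[OF forms_contr[OF ab(1) Y] ab(2)]
          Cons.IH[OF forms_grade_inv[OF ab(1)] forms_contr[OF ab(2) Y]] Y
        by (simp add: form_apply contr_wedge wedge_Cons contr_Lie[OF ab(1) assms(1) Y] contr_Lie[OF ab(2) assms(1) Y]
            wedge_linear Lie_grade_inv[OF assms(1) ab(1)] algebra_simps)
    qed
  qed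
qed

lemma Lie_bracket:
  assumes "X \<in> vfields A" "Y \<in> vfields A" "\<omega> \<in> forms A"
  shows "Lie A X (Lie A Y \<omega>) - Lie A Y (Lie A X \<omega>) = Lie A (vbracket X Y) \<omega>"
proof
  fix xs
  note XY = vfields_vbracket[OF assms(1,2)]
  show "(Lie A X (Lie A Y \<omega>) - Lie A Y (Lie A X \<omega>)) xs = Lie A (vbracket X Y) \<omega> xs"
    using assms(3)
  proof (induction xs arbitrary: \<omega>)
    case Nil
    then show ?case
      using assms by (simp add: form_apply Lie_Nil forms_Lie) (simp add: vbracket_def)
  next
    case (Cons Z xs)
    note \<omega> = Cons.prems
    show ?case
    proof (cases "Z \<in> vfields A")
      case False
      then show ?thesis by (simp add: form_apply Lie_apply_outside)
    next
      case Z: True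
      \<comment> \<open>The recursion for \<open>Lie\<close> applied twice. The terms with a single
        bracket occur in both orders of \<open>V\<close> and \<open>W\<close> and cancel in the
        commutator; the iterated brackets are left to the Jacobi identity.\<close>
      have ZZ: "Lie A V (Lie A W \<omega>) (Z # xs) = Lie A V (Lie A W (contr Z \<omega>)) xs
          - Lie A V (contr (vbracket W Z) \<omega>) xs
          - (Lie A W (contr (vbracket V Z) \<omega>) xs - contr (vbracket W (vbracket V Z)) \<omega> xs)"
        if V: "V \<in> vfields A" and W: "W \<in> vfields A" for V W
      proof -
        have "Lie A V (Lie A W \<omega>) (Z # xs) = contr Z (Lie A V (Lie A W \<omega>)) xs"
          by (simp add: form_apply contr_def)
        also have "\<dots> = Lie A V (contr Z (Lie A W \<omega>)) xs - contr (vbracket V Z) (Lie A W \<omega>) xs"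
          by (simp add: contr_Lie V Z forms_Lie W form_apply)
        also have "contr (vbracket V Z) (Lie A W \<omega>)
            = Lie A W (contr (vbracket V Z) \<omega>) - contr (vbracket W (vbracket V Z)) \<omega>"
          by (simp add: contr_Lie V Z W \<omega> vfields_vbracket)
        also have "Lie A V (contr Z (Lie A W \<omega>))
            = Lie A V (Lie A W (contr Z \<omega>)) - Lie A V (contr (vbracket W Z) \<omega>)"
        proof -
          have "contr Z (Lie A W \<omega>) + contr (vbracket W Z) \<omega> = Lie A W (contr Z \<omega>)"
            by (simp add: contr_Lie \<omega> W Z)
          moreover have "Lie A V (contr Z (Lie A W \<omega>) + contr (vbracket W Z) \<omega>)
              = Lie A V (contr Z (Lie A W \<omega>)) + Lie A V (contr (vbracket W Z) \<omega>)"
            by (intro Lie_add V forms_contr forms_Lie W Z \<omega> vfields_vbracket)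
          ultimately show ?thesis by (simp add: eq_diff_eq)
        qed
        finally show ?thesis by (simp add: form_apply)
      qed
      have "contr (vbracket (vbracket X Y) Z) \<omega>
          = contr (vbracket X (vbracket Y Z)) \<omega> - contr (vbracket Y (vbracket X Z)) \<omega>"
        unfolding vbracket_jacobi[OF assms(1,2) Z, symmetric]
        by (intro contr_vdiff \<omega> vfields_vbracket assms Z)
      then have "contr (vbracket (vbracket X Y) Z) \<omega> xs
          = contr (vbracket X (vbracket Y Z)) \<omega> xs - contr (vbracket Y (vbracket X Z)) \<omega> xs"
        by (simp only: form_apply)
      moreover have "Lie A (vbracket X Y) \<omega> (Z # xs) = contr Z (Lie A (vbracket X Y) \<omega>) xs"
        by (simp add: form_apply contr_def)
      moreover have "(a - b - (c - d)) - (a' - c - (b - d')) = m - k"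
        if "k = d' - d" "a - a' = m" for a b c d a' d' m k :: "'a \<Rightarrow> real"
        unfolding that(1) that(2)[symmetric] by (simp add: algebra_simps)
      ultimately show ?thesis
        using Cons.IH[OF forms_contr[OF \<omega> Z]]
        by (simp only: form_apply ZZ[OF assms(1,2)] ZZ[OF assms(2,1)] contr_Lie[OF \<omega> XY Z])
    qed
  qed
qed

lemma Lie_homog: assumes "X \<in> vfields A" "\<omega> \<in> forms A" "homog p \<omega>" shows "homog p (Lie A X \<omega>)"
  using assms unfolding homog_def by (simp add: Lie_def vf_zero)

lemma iprod_eq: "iprod A X \<omega> = (if \<omega> \<in> forms A then contr X \<omega> else 0)"
  by (simp add: iprod_def contr_def)

section \<open>Homogeneous forms and the module of graded derivations\<close>

lemma hforms_iff: "\<omega> \<in> hforms A p \<longleftrightarrow> \<omega> \<in> forms A \<and> homog p \<omega>"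
  by (simp add: hforms_def homog_def)

lemma hforms_forms: "\<omega> \<in> hforms A p \<Longrightarrow> \<omega> \<in> forms A"
  by (simp add: hforms_iff)

lemma hforms_cong: "even p = even q \<Longrightarrow> hforms A p = hforms A q"
  by (auto simp: hforms_def)

lemma hforms_add: "\<alpha> \<in> hforms A p \<Longrightarrow> \<beta> \<in> hforms A p \<Longrightarrow> \<alpha> + \<beta> \<in> hforms A p"
  by (simp add: hforms_iff forms_add homog_def form_apply)

lemma hforms_diff: "\<alpha> \<in> hforms A p \<Longrightarrow> \<beta> \<in> hforms A p \<Longrightarrow> \<alpha> - \<beta> \<in> hforms A p"
  by (simp add: hforms_iff forms_diff homog_def form_apply)

lemma hforms_zero: "0 \<in> hforms A p"
  by (simp add: hforms_iff zero_forms homog_def form_apply)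

lemma hforms_wedge: "\<alpha> \<in> hforms A p \<Longrightarrow> \<beta> \<in> hforms A q \<Longrightarrow> \<alpha> \<^bold>\<and> \<beta> \<in> hforms A (p + q)"
  by (simp add: hforms_iff forms_wedge homog_wedge)

lemma hforms_fn: "f \<in> Cinf A \<Longrightarrow> fn f \<in> hforms A 0"
  by (simp add: hforms_iff forms_fn homog_def) (simp add: fn_def)

lemma hforms_df: "df A f \<in> hforms A 1"
  by (simp add: hforms_iff forms_df homog_def) (auto simp: df_def)

lemma hforms_commute:
  "\<alpha> \<in> hforms A p \<Longrightarrow> \<beta> \<in> hforms A q \<Longrightarrow> \<alpha> \<^bold>\<and> \<beta> = psign (p * q) (\<beta> \<^bold>\<and> \<alpha>)"
  by (simp add: hforms_iff wedge_commute)

text \<open>Real multiples become products with constant functions, so that the scaling clause of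
  \<open>hder\<close> is covered by the rules for \<open>fn\<close>.\<close>

lemma real_scale_eq: "(\<lambda>xs x. c * \<alpha> xs x) = fn (\<lambda>_. c) \<^bold>\<and> \<alpha>"
  by (rule ext) (simp add: fn_wedge times_fun_def)

lemma hderI:
  assumes "\<And>\<omega>. \<omega> \<notin> forms A \<Longrightarrow> D \<omega> = 0"
    and "\<And>q \<omega>. \<omega> \<in> hforms A q \<Longrightarrow> D \<omega> \<in> hforms A (p + q)"
    and "\<And>\<alpha> \<beta>. \<alpha> \<in> forms A \<Longrightarrow> \<beta> \<in> forms A \<Longrightarrow> D (\<alpha> + \<beta>) = D \<alpha> + D \<beta>"
    and "\<And>c \<alpha>. \<alpha> \<in> forms A \<Longrightarrow> D (fn (\<lambda>_. c) \<^bold>\<and> \<alpha>) = fn (\<lambda>_. c) \<^bold>\<and> D \<alpha>"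
    and "\<And>q \<alpha> \<beta>. \<alpha> \<in> hforms A q \<Longrightarrow> \<beta> \<in> forms A \<Longrightarrow>
      D (\<alpha> \<^bold>\<and> \<beta>) = D \<alpha> \<^bold>\<and> \<beta> + psign (p * q) (\<alpha> \<^bold>\<and> D \<beta>)"
  shows "D \<in> hder A p"
  using assms unfolding hder_def mem_Collect_eq real_scale_eq by blast

context
  fixes D p assumes D: "D \<in> hder A p"
begin

lemma hder_outside: "\<omega> \<notin> forms A \<Longrightarrow> D \<omega> = 0"
  using D unfolding hder_def by blast

lemma hder_hforms: "\<omega> \<in> hforms A q \<Longrightarrow> D \<omega> \<in> hforms A (p + q)"
  using D unfolding hder_def by blast

lemma hder_add: "\<alpha> \<in> forms A \<Longrightarrow> \<beta> \<in> forms A \<Longrightarrow> D (\<alpha> + \<beta>) = D \<alpha> + D \<beta>"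
  using D unfolding hder_def by blast

lemma hder_scale: "\<alpha> \<in> forms A \<Longrightarrow> D (fn (\<lambda>_. c) \<^bold>\<and> \<alpha>) = fn (\<lambda>_. c) \<^bold>\<and> D \<alpha>"
  using D unfolding hder_def mem_Collect_eq real_scale_eq by blast

lemma hder_wedge:
  "\<alpha> \<in> hforms A q \<Longrightarrow> \<beta> \<in> forms A \<Longrightarrow> D (\<alpha> \<^bold>\<and> \<beta>) = D \<alpha> \<^bold>\<and> \<beta> + psign (p * q) (\<alpha> \<^bold>\<and> D \<beta>)"
  using D unfolding hder_def by blast

text \<open>The definition places only the values on homogeneous forms; a general form is the sum of
  its two parity parts.\<close>

lemma hder_forms: "D \<omega> \<in> forms A"
proof (cases "\<omega> \<in> forms A")
  case True
  have "D \<omega> = D (form_part 0 \<omega>) + D (form_part 1 \<omega>)"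
    using hder_add[OF hforms_forms[OF form_part_forms[OF True]] hforms_forms[OF form_part_forms[OF True]], of 0 1]
    by (simp only: form_part_sum)
  then show ?thesis
    using hforms_forms[OF hder_hforms[OF form_part_forms[OF True]]] by (simp only: forms_add)
qed (simp add: hder_outside zero_forms)

lemma hder_uminus: "\<alpha> \<in> forms A \<Longrightarrow> D (- \<alpha>) = - D \<alpha>"
proof -
  assume "\<alpha> \<in> forms A"
  then have "D (\<alpha> + - \<alpha>) = D \<alpha> + D (- \<alpha>)"
    by (intro hder_add forms_uminus)
  then show ?thesis
    by (simp add: hder_zero[OF D] minus_unique)
qed

lemma hder_diff: "\<alpha> \<in> forms A \<Longrightarrow> \<beta> \<in> forms A \<Longrightarrow> D (\<alpha> - \<beta>) = D \<alpha> - D \<beta>"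
  by (metis hder_add forms_uminus hder_uminus add_uminus_conv_diff)

lemma hder_sum: "(\<And>i. i \<in> I \<Longrightarrow> \<omega> i \<in> forms A) \<Longrightarrow> D (sum \<omega> I) = (\<Sum>i\<in>I. D (\<omega> i))"
  by (induction I rule: infinite_finite_induct) (simp_all add: hder_zero[OF D] hder_add forms_sum)

lemma hder_fn_wedge:
  "f \<in> Cinf A \<Longrightarrow> \<beta> \<in> forms A \<Longrightarrow> D (fn f \<^bold>\<and> \<beta>) = D (fn f) \<^bold>\<and> \<beta> + fn f \<^bold>\<and> D \<beta>"
  using hder_wedge[OF hforms_fn] by (simp add: psign_simps)

end

lemma hder_cong: "even p = even q \<Longrightarrow> hder A p = hder A q"
proof -
  assume pq: "even p = even q"
  then have "hforms A (p + r) = hforms A (q + r)" for r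
    by (intro hforms_cong) simp
  moreover have "psign (p * r) x = psign (q * r) x" for r and x :: "'a form"
    using pq by (simp add: psign_def)
  ultimately show ?thesis
    unfolding hder_def by simp
qed

lemma hder_zero_mem: "0 \<in> hder A p"
proof -
  have [simp]: "(0 :: 'a oper) \<omega> = 0" for \<omega> by (rule zero_fun_apply)
  show ?thesis
    by (rule hderI) (simp_all add: hforms_zero wedge_zero psign_simps)
qed

lemma hder_plus:
  assumes "D \<in> hder A p" "E \<in> hder A p"
  shows "D + E \<in> hder A p"
proof -
  have [simp]: "(D + E) \<omega> = D \<omega> + E \<omega>" for \<omega> by (rule plus_fun_apply)
  show ?thesis
    by (rule hderI)
      (simp_all add: hder_outside[OF assms(1)] hder_outside[OF assms(2)]
        hforms_add hder_hforms[OF assms(1)] hder_hforms[OF assms(2)]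
        hder_add[OF assms(1)] hder_add[OF assms(2)] hder_scale[OF assms(1)] hder_scale[OF assms(2)]
        hder_wedge[OF assms(1)] hder_wedge[OF assms(2)] wedge_linear psign_simps)
qed

text \<open>Moving \<open>\<alpha>\<close> past an argument of parity \<open>r\<close> costs
  \<open>q * r\<close>, which adds to the \<open>p * r\<close> of \<open>D\<close> in the Leibniz
  rule.\<close>

lemma hder_lmul:
  assumes "\<alpha> \<in> hforms A q" "D \<in> hder A p"
  shows "\<alpha> \<odot> D \<in> hder A (q + p)"
proof (rule hderI)
  show "(\<alpha> \<odot> D) \<omega> = 0" if "\<omega> \<notin> forms A" for \<omega>
    using that by (simp add: lmul_def hder_outside[OF assms(2)] wedge_zero)
  show "(\<alpha> \<odot> D) \<omega> \<in> hforms A (q + p + r)" if "\<omega> \<in> hforms A r" for r \<omega>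
    using hforms_wedge[OF assms(1) hder_hforms[OF assms(2) that]] by (simp add: lmul_def add.assoc)
  show "(\<alpha> \<odot> D) (\<mu> + \<nu>) = (\<alpha> \<odot> D) \<mu> + (\<alpha> \<odot> D) \<nu>" if "\<mu> \<in> forms A" "\<nu> \<in> forms A" for \<mu> \<nu>
    using that by (simp add: lmul_def hder_add[OF assms(2)] wedge_linear)
  show "(\<alpha> \<odot> D) (fn (\<lambda>_. c) \<^bold>\<and> \<mu>) = fn (\<lambda>_. c) \<^bold>\<and> (\<alpha> \<odot> D) \<mu>" if "\<mu> \<in> forms A" for c \<mu>
    using that by (simp add: lmul_def hder_scale[OF assms(2)] wedge_fn_left)
  fix r \<mu> \<nu> assume \<mu>: "\<mu> \<in> hforms A r" and \<nu>: "\<nu> \<in> forms A"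
  have "\<alpha> \<^bold>\<and> (\<mu> \<^bold>\<and> D \<nu>) = psign (q * r) (\<mu> \<^bold>\<and> (\<alpha> \<^bold>\<and> D \<nu>))"
    by (simp only: wedge_assoc[symmetric] hforms_commute[OF assms(1) \<mu>] wedge_psign)
  then show "(\<alpha> \<odot> D) (\<mu> \<^bold>\<and> \<nu>) = (\<alpha> \<odot> D) \<mu> \<^bold>\<and> \<nu> + psign ((q + p) * r) (\<mu> \<^bold>\<and> (\<alpha> \<odot> D) \<nu>)"
    by (simp add: lmul_def hder_wedge[OF assms(2) \<mu> \<nu>] wedge_linear wedge_assoc)
      (auto simp: psign_def)
qed

lemma hder_minus:
  assumes "D \<in> hder A p" "E \<in> hder A p"
  shows "D - E \<in> hder A p"
proof -
  have eq: "D - E = D + fn (- 1) \<odot> E"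
    by (intro ext) (simp add: lmul_def fn_wedge fun_apply)
  show ?thesis
    unfolding eq
    by (rule hder_plus[OF assms(1) hder_lmul[OF hforms_fn[OF Cinf_uminus[OF Cinf_one]] assms(2), simplified]])
qed

lemma Lie_hder:
  assumes "X \<in> vfields A"
  shows "Lie A X \<in> hder A 0"
proof (rule hderI)
  fix c \<alpha> assume "\<alpha> \<in> forms A"
  moreover have "fn (0 :: 'a \<Rightarrow> real) = 0"
    by (rule ext) (simp add: fn_def form_apply)
  ultimately show "Lie A X (fn (\<lambda>_. c) \<^bold>\<and> \<alpha>) = fn (\<lambda>_. c) \<^bold>\<and> Lie A X \<alpha>"
    by (simp add: Lie_fn_wedge[OF assms _ Cinf_const] vf_const[OF assms] wedge_zero)
qed (simp_all add: Lie_outside Lie_add Lie_wedge hforms_iff Lie_homog forms_Lie assms psign_simps)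

lemma iprod_hder:
  assumes "X \<in> vfields A"
  shows "iprod A X \<in> hder A 1"
proof (rule hderI)
  fix q \<alpha> \<beta> assume "\<alpha> \<in> hforms A q" "\<beta> \<in> forms A"
  then show "iprod A X (\<alpha> \<^bold>\<and> \<beta>) = iprod A X \<alpha> \<^bold>\<and> \<beta> + psign (1 * q) (\<alpha> \<^bold>\<and> iprod A X \<beta>)"
    by (auto simp: iprod_eq hforms_iff forms_wedge contr_wedge grade_inv_homog wedge_psign)
next
  fix c \<alpha> assume "\<alpha> \<in> forms A"
  then show "iprod A X (fn (\<lambda>_. c) \<^bold>\<and> \<alpha>) = fn (\<lambda>_. c) \<^bold>\<and> iprod A X \<alpha>"
    by (simp add: iprod_eq forms_mult Cinf_const contr_wedge contr_simps wedge_zero grade_inv_simps)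
qed (simp_all add: iprod_eq contr_simps forms_add hforms_iff homog_contr forms_contr assms)

lemma lmul_simps:
  "\<alpha> \<odot> (D + E) = \<alpha> \<odot> D + \<alpha> \<odot> E" "(\<alpha> + \<beta>) \<odot> D = \<alpha> \<odot> D + \<beta> \<odot> D"
  "\<alpha> \<odot> (D - E) = \<alpha> \<odot> D - \<alpha> \<odot> E" "(\<alpha> - \<beta>) \<odot> D = \<alpha> \<odot> D - \<beta> \<odot> D"
  "\<alpha> \<odot> (- D) = - (\<alpha> \<odot> D)" "(- \<alpha>) \<odot> D = - (\<alpha> \<odot> D)" "\<alpha> \<odot> 0 = 0" "0 \<odot> D = 0"
  "\<alpha> \<odot> (\<beta> \<odot> D) = (\<alpha> \<^bold>\<and> \<beta>) \<odot> D" "\<alpha> \<odot> psign n D = psign n (\<alpha> \<odot> D)"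
  "psign n \<alpha> \<odot> D = psign n (\<alpha> \<odot> D)"
  by (rule ext, simp only: lmul_def fun_apply wedge_linear wedge_assoc psign_def split: if_split, simp?)+

lemma hder_Der: "D \<in> hder A p \<Longrightarrow> D \<in> Der A"
proof (cases "even p")
  case True
  assume "D \<in> hder A p"
  then have "D \<in> hder A 0"
    using hder_cong[of p 0] True by simp
  then show ?thesis
    unfolding Der_def using hder_zero_mem[of 1] by force
next
  case False
  assume "D \<in> hder A p"
  then have "D \<in> hder A 1"
    using hder_cong[of p 1] False by simp
  then show ?thesis
    unfolding Der_def using hder_zero_mem[of 0] by force
qed

lemma Der_cases:
  assumes "D \<in> Der A"
  obtains D0 D1 where "D = D0 + D1" "D0 \<in> hder A 0" "D1 \<in> hder A 1"
  using assms unfolding Der_def by blast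

lemma Der_add: assumes "D \<in> Der A" "E \<in> Der A" shows "D + E \<in> Der A"
proof -
  obtain D0 D1 where D: "D = D0 + D1" "D0 \<in> hder A 0" "D1 \<in> hder A 1"
    using assms(1) by (rule Der_cases)
  obtain E0 E1 where E: "E = E0 + E1" "E0 \<in> hder A 0" "E1 \<in> hder A 1"
    using assms(2) by (rule Der_cases)
  have "D + E = (D0 + E0) + (D1 + E1)"
    by (simp add: D E ac_simps)
  then show ?thesis
    unfolding Der_def using hder_plus[OF D(2) E(2)] hder_plus[OF D(3) E(3)] by blast
qed

lemma Der_zero: "0 \<in> Der A"
  using hder_Der[OF hder_zero_mem[of 0]] .

text \<open>Both factors are split into parity parts; each of the four products is
  homogeneous.\<close>

lemma Der_lmul: assumes "\<alpha> \<in> forms A" "D \<in> Der A" shows "\<alpha> \<odot> D \<in> Der A"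
proof -
  obtain D0 D1 where D: "D = D0 + D1" "D0 \<in> hder A 0" "D1 \<in> hder A 1"
    using assms(2) by (rule Der_cases)
  have "\<alpha> \<odot> D = form_part 0 \<alpha> \<odot> D0 + form_part 0 \<alpha> \<odot> D1 + (form_part 1 \<alpha> \<odot> D0 + form_part 1 \<alpha> \<odot> D1)"
    by (simp only: form_part_sum lmul_simps(1,2)[symmetric] D(1))
  then show ?thesis
    using hder_Der[OF hder_lmul[OF form_part_forms[OF assms(1)] D(2)]]
      hder_Der[OF hder_lmul[OF form_part_forms[OF assms(1)] D(3)]]
    by (simp only: Der_add)
qed

lemma fn_one_lmul: "fn 1 \<odot> D = D"
  by (rule ext, rule ext) (simp add: lmul_def fn_wedge)

lemma Der_uminus: "D \<in> Der A \<Longrightarrow> - D \<in> Der A"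
  using Der_lmul[OF forms_uminus[OF forms_fn[OF Cinf_one]], of D] by (simp only: lmul_simps fn_one_lmul)

lemma Der_diff: "D \<in> Der A \<Longrightarrow> E \<in> Der A \<Longrightarrow> D - E \<in> Der A"
  by (metis Der_add Der_uminus add_uminus_conv_diff)

end

section \<open>Local generators of the graded derivations\<close>

lemma sum_fun_apply: "(\<Sum>i\<in>I. f i) x = (\<Sum>i\<in>I. f i x)"
  for f :: "'i \<Rightarrow> 'x \<Rightarrow> 'y::comm_monoid_add"
  by (induction I rule: infinite_finite_induct) (simp_all add: zero_fun_apply plus_fun_apply)

lemma wedge_sum_right: "\<alpha> \<^bold>\<and> (\<Sum>i\<in>I. \<beta> i) = (\<Sum>i\<in>I. \<alpha> \<^bold>\<and> \<beta> i)"
  by (induction I rule: infinite_finite_induct) (simp_all add: wedge_zero wedge_add_right)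

context smooth_mfd begin

text \<open>The image of \<open>K\<close> under the inverse chart is compact, hence closed because
  the manifold is Hausdorff. Every other chart domain is covered by two open sets: the part where
  \<open>u\<close> applies, treated by the transition map, and the complement of this closed set,
  where the extension is 0.\<close>

lemma Cinf_extend:
  assumes "(D, \<phi>) \<in> A" "open W" "W \<subseteq> \<phi> ` D" "compact K" "K \<subseteq> W" "smooth_on W u"
    and supp: "\<And>x. x \<in> W \<Longrightarrow> x \<notin> K \<Longrightarrow> u x = 0"
  shows "(\<lambda>q. if q \<in> D \<and> \<phi> q \<in> W then u (\<phi> q) else 0) \<in> Cinf A" (is "?f \<in> _")
  unfolding Cinf_iff
proof (intro allI impI)
  fix E \<psi> assume E: "(E, \<psi>) \<in> A"
  note hD = chart_homeomorphism[OF assms(1)] and hE = chart_homeomorphism[OF E]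
  define D' where "D' = D \<inter> \<phi> -` W"
  define K' where "K' = inv_into D \<phi> ` K"
  have "open D'"
    unfolding D'_def
    using hD by (intro continuous_open_preimage chart_open(1)[OF assms(1)] assms(2))
      (simp add: homeomorphism_def)
  have "continuous_on K (inv_into D \<phi>)"
    using homeomorphism_cont2[OF hD] assms(3,5) by (meson continuous_on_subset subset_trans)
  then have "closed K'"
    unfolding K'_def using assms(4) by (intro compact_imp_closed compact_continuous_image)
  then have oK: "open (- K')" by (rule open_Compl)
  have "K' \<subseteq> D'"
  proof
    fix q assume "q \<in> K'"
    then obtain x where x: "x \<in> K" "q = inv_into D \<phi> x" by (auto simp: K'_def)
    then have "x \<in> \<phi> ` D" "x \<in> W" using assms(3,5) by auto
    then show "q \<in> D'"
      by (simp add: x D'_def inv_into_into f_inv_into_f)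
  qed
  then have cover: "\<psi> ` E = \<psi> ` (E \<inter> D') \<union> \<psi> ` (E \<inter> - K')" by blast
  have inv: "inv_into E \<psi> (\<psi> q) = q" if "q \<in> E" for q
    using that by (rule homeomorphism_apply1[OF hE])
  show "smooth_on (\<psi> ` E) (\<lambda>x. ?f (inv_into E \<psi> x))"
    unfolding cover
  proof (rule smooth_on_Un)
    show o1: "open (\<psi> ` (E \<inter> D'))" and o2: "open (\<psi> ` (E \<inter> - K'))"
      by (rule chart_image_open[OF E \<open>open D'\<close>], rule chart_image_open[OF E oK])
    have "smooth_on (\<psi> ` (E \<inter> D')) (\<phi> \<circ> inv_into E \<psi>)"
      by (rule smooth_on_mono[OF chart_transition[OF E assms(1)]]) (auto simp: D'_def)
    moreover have "(\<phi> \<circ> inv_into E \<psi>) ` \<psi> ` (E \<inter> D') \<subseteq> W"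
      using inv by (auto simp: D'_def)
    ultimately have "smooth_on (\<psi> ` (E \<inter> D')) (\<lambda>x. u ((\<phi> \<circ> inv_into E \<psi>) x))"
      by (intro smooth_on_compose[OF o1 assms(2) _ _ assms(6)])
    then show "smooth_on (\<psi> ` (E \<inter> D')) (\<lambda>x. ?f (inv_into E \<psi> x))"
      by (rule smooth_on_cong[OF o1, rotated]) (auto simp: D'_def inv)
    have z: "?f q = 0" if "q \<notin> K'" for q
    proof (cases "q \<in> D \<and> \<phi> q \<in> W")
      case True
      then have "\<phi> q \<notin> K"
        using that homeomorphism_apply1[OF hD, of q] by (force simp: K'_def)
      then show ?thesis using supp True by simp
    qed auto
    show "smooth_on (\<psi> ` (E \<inter> - K')) (\<lambda>x. ?f (inv_into E \<psi> x))"
    proof (rule smooth_on_cong[OF o2 _ smooth_on_const[of _ 0]])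
      fix x assume "x \<in> \<psi> ` (E \<inter> - K')"
      then obtain q where q: "x = \<psi> q" "q \<in> E" "q \<notin> K'" by blast
      show "0 = ?f (inv_into E \<psi> x)"
        unfolding q(1) inv[OF q(2)] by (rule z[OF q(3), symmetric])
    qed
  qed
qed

text \<open>By the quotient rule \<open>\<rho> * V (y e) - y e * V \<rho>\<close> stands for
  \<open>\<rho>\<^sup>2 V (y e / \<rho>)\<close>, where \<open>y e / \<rho>\<close> is meant to be a
  coordinate. With \<open>X e\<close> as \<open>\<rho>\<close> times the coordinate field, the
  condition is \<open>\<rho>\<^sup>3\<close> times the usual expansion of \<open>V f\<close> in
  coordinates, written without division.\<close>

definition local_frame :: "('a \<Rightarrow> real) \<Rightarrow> ('b \<Rightarrow> 'a \<Rightarrow> real) \<Rightarrow> ('b \<Rightarrow> 'a vfield) \<Rightarrow> bool" where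
  "local_frame \<rho> y X \<longleftrightarrow> \<rho> \<in> Cinf A \<and> (\<forall>e. y e \<in> Cinf A \<and> X e \<in> vfields A) \<and>
     (\<forall>V\<in>vfields A. \<forall>f\<in>Cinf A.
        \<rho> * \<rho> * \<rho> * V f = (\<Sum>e\<in>Basis. (\<rho> * V (y e) - y e * V \<rho>) * X e f))"

text \<open>With a bump function \<open>\<rho>\<close> supported in a chart with coordinates \<open>x\<^sub>e\<close>, take \<open>y e = \<rho> x\<^sub>e\<close> and
  \<open>X e = \<rho> \<partial>/\<partial>x\<^sub>e\<close>. The formula for \<open>V f\<close> at \<open>p\<close> results from applying \<open>V\<close> to Hadamard's expansion
  of \<open>\<rho>\<^sup>2 f\<close> around \<open>p\<close>; the powers of \<open>\<rho>\<close> make all functions in it globally defined.\<close>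

lemma ex_frame: "\<exists>\<rho> y X. local_frame \<rho> y X \<and> \<rho> q \<noteq> 0"
proof -
  obtain D \<phi> where c: "(D, \<phi>) \<in> A" "q \<in> D"
    using ex_chart by blast
  note h = chart_homeomorphism[OF c(1)]
  have "\<phi> q \<in> \<phi> ` D" using c(2) by simp
  then obtain R where R: "R > 0" "ball (\<phi> q) R \<subseteq> \<phi> ` D"
    using chart_open(2)[OF c(1)] open_contains_ball by blast
  define W where "W = ball (\<phi> q) R"
  \<comment> \<open>With half the radius the support of the bump function is compact and stays
    inside of \<open>W\<close>.\<close>
  define K where "K = cball (\<phi> q) (R / 2)"
  have W: "open W" "convex W" "W \<subseteq> \<phi> ` D" and K: "compact K" "K \<subseteq> W"
    using R by (auto simp: W_def K_def)
  obtain u :: "'b \<Rightarrow> real" where u: "smooth_on UNIV u" "\<And>x. dist (\<phi> q) x < R / 2 \<Longrightarrow> u x > 0"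
    "\<And>x. dist (\<phi> q) x \<ge> R / 2 \<Longrightarrow> u x = 0"
    by (rule smooth_bump[of "\<phi> q" "R / 2"]) (rule that)
  have uW: "smooth_on W u" by (rule smooth_on_mono[OF u(1)]) simp
  define ex where "ex w = (\<lambda>p. if p \<in> D \<and> \<phi> p \<in> W then w (\<phi> p) else 0)" for w :: "'b \<Rightarrow> real"
  have ex_Cinf: "ex (\<lambda>x. u x * w x) \<in> Cinf A" if "smooth_on W w" for w
    unfolding ex_def
    by (rule Cinf_extend[OF c(1) W(1,3) K]) (auto simp: smooth_on_mult W(1) uW that K_def intro!: u(3))
  define pull where "pull f x = f (inv_into D \<phi> x)" for f :: "'a \<Rightarrow> real" and x
  have pull: "smooth_on W (pull f)" if "f \<in> Cinf A" for f
    using that c(1) smooth_on_mono[OF _ W(3)] unfolding Cinf_iff pull_def by blast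
  have pull_ap: "pull f (\<phi> p) = f p" if "p \<in> D" for f p
    unfolding pull_def using homeomorphism_apply1[OF h that] by simp
  define dd where "dd e f x = frechet_derivative (pull f) (at x) e" for e f x
  have dd_eq: "dd e f x = F' e" if "(pull f has_derivative F') (at x)" for e f x F'
    using frechet_derivative_eq[OF that] by (simp add: dd_def)
  define \<rho> where "\<rho> = ex u"
  define y where "y e = ex (\<lambda>x. u x * (x \<bullet> e))" for e
  define X where "X e f = (if f \<in> Cinf A then ex (\<lambda>x. u x * dd e f x) else 0)" for e f
  have \<rho>: "\<rho> \<in> Cinf A"
    using ex_Cinf[OF smooth_on_const[of _ 1]] by (simp add: \<rho>_def)
  have y: "y e \<in> Cinf A" for e
    unfolding y_def by (rule ex_Cinf[OF smooth_on_inner[OF W(1)]])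
  have exI: "ex v = f" if "\<And>p. p \<in> D \<Longrightarrow> \<phi> p \<in> W \<Longrightarrow> v (\<phi> p) = f p"
    "\<And>p. \<not> (p \<in> D \<and> \<phi> p \<in> W) \<Longrightarrow> f p = 0" for v f
    using that by (auto simp: ex_def)
  have X: "X e \<in> vfields A" for e
  proof (rule vfieldsI)
    show "X e f \<in> Cinf A" if "f \<in> Cinf A" for f
      using that by (simp add: X_def dd_def ex_Cinf smooth_on_derivative pull)
    show "X e f = 0" if "f \<notin> Cinf A" for f
      using that by (simp add: X_def)
    fix f assume f: "f \<in> Cinf A"
    note df = smooth_on_has_derivative[OF pull[OF f]]
    show "X e (\<lambda>p. r * f p) = (\<lambda>p. r * X e f p)" for r
    proof -
      have "dd e (\<lambda>p. r * f p) x = r * dd e f x" if "x \<in> W" for x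
      proof (rule trans[OF dd_eq])
        show "(pull (\<lambda>p. r * f p) has_derivative (\<lambda>v. r * frechet_derivative (pull f) (at x) v)) (at x)"
        proof -
          have "pull (\<lambda>p. r * f p) = (\<lambda>x. r * pull f x)"
            by (simp add: pull_def fun_eq_iff)
          then show ?thesis
            using has_derivative_mult_right[OF df[OF that], of r] by (simp only:)
        qed
      qed (simp add: dd_def)
      moreover have "(\<lambda>p. r * f p) \<in> Cinf A"
        using Cinf_mult[OF Cinf_const f] by (simp add: times_fun_def)
      ultimately show ?thesis
        using f by (auto simp: X_def ex_def)
    qed
    fix k assume k: "k \<in> Cinf A"
    note dk = smooth_on_has_derivative[OF pull[OF k]]
    show "X e (f + k) = X e f + X e k"
    proof -
      have "dd e (f + k) x = dd e f x + dd e k x" if "x \<in> W" for x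
      proof (rule trans[OF dd_eq])
        have "pull (f + k) = (\<lambda>x. pull f x + pull k x)"
          by (simp add: pull_def fun_eq_iff fun_apply)
        then show "(pull (f + k) has_derivative (\<lambda>v. frechet_derivative (pull f) (at x) v
            + frechet_derivative (pull k) (at x) v)) (at x)"
          using has_derivative_add[OF df[OF that] dk[OF that]] by (simp only:)
      qed (simp add: dd_def)
      then show ?thesis
        using f k by (auto simp: X_def ex_def Cinf_add fun_eq_iff fun_apply distrib_left)
    qed
    show "X e (f * k) = X e f * k + f * X e k"
    proof -
      have "dd e (f * k) x = pull f x * dd e k x + dd e f x * pull k x" if "x \<in> W" for x
      proof (rule trans[OF dd_eq])
        have "pull (f * k) = (\<lambda>x. pull f x * pull k x)"
          by (simp add: pull_def fun_eq_iff fun_apply)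
        then show "(pull (f * k) has_derivative (\<lambda>v. pull f x * frechet_derivative (pull k) (at x) v
            + frechet_derivative (pull f) (at x) v * pull k x)) (at x)"
          using has_derivative_mult[OF df[OF that] dk[OF that]] by (simp only:)
      qed (simp add: dd_def)
      then show ?thesis
        using f k by (auto simp: X_def ex_def Cinf_mult fun_eq_iff fun_apply pull_ap algebra_simps)
    qed
  qed
  have "\<rho> * \<rho> * \<rho> * V f = (\<Sum>e\<in>Basis. (\<rho> * V (y e) - y e * V \<rho>) * X e f)"
    if V: "V \<in> vfields A" and f: "f \<in> Cinf A" for V f
  proof
    fix p
    show "(\<rho> * \<rho> * \<rho> * V f) p = (\<Sum>e\<in>Basis. (\<rho> * V (y e) - y e * V \<rho>) * X e f) p"
    proof (cases "p \<in> D \<and> \<phi> p \<in> W")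
      case False
      then have "\<rho> p = 0" "y e p = 0" for e
        by (auto simp: \<rho>_def y_def ex_def)
      then show ?thesis
        by (simp add: sum_fun_apply fun_apply)
    next
      case p: True
      define a where "a = \<phi> p"
      have a: "a \<in> W" using p by (simp add: a_def)
      \<comment> \<open>The expansion is around the image of the very point \<open>p\<close> at
        which the formula is checked; \<open>W\<close> is a ball and therefore convex.\<close>
      obtain H where H: "\<And>e. smooth_on W (H e)"
        "\<And>x. x \<in> W \<Longrightarrow> pull f x = pull f a + (\<Sum>e\<in>Basis. (x \<bullet> e - a \<bullet> e) * H e x)"
        "\<And>e. H e a = frechet_derivative (pull f) (at a) e"
        by (rule hadamard_lemma[OF W(1,2) a pull[OF f]]) (rule that)
      define k where "k e = ex (\<lambda>x. u x * H e x)" for e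
      have k: "k e \<in> Cinf A" for e
        unfolding k_def by (rule ex_Cinf[OF H(1)])
      \<comment> \<open>In the chart \<open>m e\<close> is \<open>\<rho>\<close> times the
        difference of the coordinate from its value at \<open>p\<close>. It vanishes at
        \<open>p\<close>, so only \<open>V (m e) * k e\<close> survives there from
        \<open>V (m e * k e)\<close>.\<close>
      define m where "m e = y e - (\<lambda>_. a \<bullet> e) * \<rho>" for e
      have m: "m e \<in> Cinf A" for e
        unfolding m_def by (intro Cinf_intros y \<rho>)
      have fa: "f p = pull f a"
        using p by (simp add: a_def pull_ap)
      have e1: "\<rho> * \<rho> * f = (\<lambda>_. f p) * (\<rho> * \<rho>) + (\<Sum>e\<in>Basis. m e * k e)"
      proof
        fix s
        show "(\<rho> * \<rho> * f) s = ((\<lambda>_. f p) * (\<rho> * \<rho>) + (\<Sum>e\<in>Basis. m e * k e)) s"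
        proof (cases "s \<in> D \<and> \<phi> s \<in> W")
          case True
          have "f s = f p + (\<Sum>e\<in>Basis. (\<phi> s \<bullet> e - a \<bullet> e) * H e (\<phi> s))"
            using H(2)[of "\<phi> s"] True by (simp add: pull_ap fa)
          then show ?thesis
            using True by (simp add: fun_apply sum_fun_apply \<rho>_def m_def y_def k_def ex_def
                distrib_left sum_distrib_left algebra_simps)
        next
          case False
          then show ?thesis
            by (auto simp: fun_apply sum_fun_apply \<rho>_def k_def ex_def)
        qed
      qed
      have "V (\<rho> * \<rho> * f) = V ((\<lambda>_. f p) * (\<rho> * \<rho>) + (\<Sum>e\<in>Basis. m e * k e))"
        using e1 by simp
      also have "\<dots> = V ((\<lambda>_. f p) * (\<rho> * \<rho>)) + (\<Sum>e\<in>Basis. V (m e * k e))"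
        by (simp add: vf_add[OF V] vf_sum[OF V] Cinf_intros \<rho> m k)
      also have "V ((\<lambda>_. f p) * (\<rho> * \<rho>)) = (\<lambda>_. f p) * (V \<rho> * \<rho> + \<rho> * V \<rho>)"
        by (simp add: vf_mult[OF V] Cinf_intros \<rho> vf_const[OF V])
      also have "(\<lambda>e. V (m e * k e)) = (\<lambda>e. V (m e) * k e + m e * V (k e))"
        by (simp add: vf_mult[OF V] m k)
      also have "V (\<rho> * \<rho> * f) = (V \<rho> * \<rho> + \<rho> * V \<rho>) * f + \<rho> * \<rho> * V f"
        by (simp add: vf_mult[OF V] Cinf_intros \<rho> f)
      finally have e2: "(V \<rho> * \<rho> + \<rho> * V \<rho>) * f + \<rho> * \<rho> * V f
          = (\<lambda>_. f p) * (V \<rho> * \<rho> + \<rho> * V \<rho>) + (\<Sum>e\<in>Basis. V (m e) * k e + m e * V (k e))" .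
      have Vm: "V (m e) = V (y e) - (\<lambda>_. a \<bullet> e) * V \<rho>" for e
        unfolding m_def by (simp add: vf_diff[OF V] vf_mult[OF V] Cinf_intros y \<rho> vf_const[OF V])
      have at_p: "\<rho> p = u a" "y e p = u a * (a \<bullet> e)" "m e p = 0" "k e p = u a * H e a"
        "X e f p = u a * H e a" for e
        using p f by (simp_all add: \<rho>_def y_def m_def k_def X_def ex_def a_def fun_apply H(3)[unfolded a_def] dd_def)
      have "\<rho> p * \<rho> p * V f p = (\<Sum>e\<in>Basis. V (m e) p * k e p)"
        using fun_cong[OF e2, of p] by (simp add: fun_apply sum_fun_apply at_p(3))
      \<comment> \<open>A third factor \<open>\<rho>\<close> turns \<open>V (m e)\<close> at
        \<open>p\<close> into the coefficient in \<open>local_frame\<close>, since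
        \<open>y e p = \<rho> p * (a \<bullet> e)\<close>; moreover \<open>k e\<close> and
        \<open>X e f\<close> agree at \<open>p\<close>.\<close>
      then have "\<rho> p * (\<rho> p * \<rho> p * V f p) = (\<Sum>e\<in>Basis. \<rho> p * (V (m e) p * k e p))"
        by (simp only: sum_distrib_left)
      then show ?thesis
        by (simp add: fun_apply sum_fun_apply Vm at_p algebra_simps)
    qed
  qed
  moreover have "\<rho> q \<noteq> 0"
    using c(2) R(1) u(2)[of "\<phi> q"] by (simp add: \<rho>_def ex_def W_def)
  ultimately show ?thesis
    unfolding local_frame_def using \<rho> y X by blast
qed

section \<open>The generators on functions and on differentials\<close>

lemma Lie_fn: "X \<in> vfields A \<Longrightarrow> f \<in> Cinf A \<Longrightarrow> Lie A X (fn f) = fn (X f)"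
  by (rule ext) (simp add: Lie_def forms_fn, auto simp: fn_def vf_zero)

lemma iprod_fn: "f \<in> Cinf A \<Longrightarrow> iprod A X (fn f) = 0"
  by (simp add: iprod_eq forms_fn contr_simps)

lemma iprod_df: "X \<in> vfields A \<Longrightarrow> iprod A X (df A f) = fn (X f)"
  by (simp add: iprod_eq forms_df contr_df)

lemma Lie_df:
  assumes "X \<in> vfields A"
  shows "Lie A X (df A f) = df A (X f)"
proof
  fix xs
  show "Lie A X (df A f) xs = df A (X f) xs"
  proof (cases xs)
    case Nil
    then show ?thesis
      using assms by (simp add: Lie_Nil forms_df) (simp add: df_def vf_zero)
  next
    case (Cons Y ys)
    show ?thesis
    proof (cases "Y \<in> vfields A")
      case True
      have b: "vbracket X Y \<in> vfields A"
        using vfields_vbracket assms True .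
      have "contr Y (Lie A X (df A f)) = fn (X (Y f)) - fn (vbracket X Y f)"
        using True b assms by (simp add: contr_Lie forms_df contr_df Lie_fn vf_Cinf)
      also have "\<dots> = contr Y (df A (X f))"
        using True by (auto simp: contr_df vbracket_def fn_def fun_eq_iff fun_apply)
      finally have "contr Y (Lie A X (df A f)) ys = contr Y (df A (X f)) ys"
        by (simp only:)
      then show ?thesis
        by (simp only: Cons contr_def)
    next
      case False
      then show ?thesis
        by (simp add: Cons Lie_apply_outside) (simp add: df_def)
    qed
  qed
qed

lemma df_mult:
  assumes "f \<in> Cinf A" "h \<in> Cinf A"
  shows "df A (f * h) = fn f \<^bold>\<and> df A h + fn h \<^bold>\<and> df A f"
proof
  fix xs
  have "hd xs (f * h) = f * hd xs h + h * hd xs f" if "length xs = 1" "set xs \<subseteq> vfields A"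
    using that vf_mult[OF _ assms, of "hd xs"] by (cases xs) (simp_all add: mult.commute)
  then show "df A (f * h) xs = (fn f \<^bold>\<and> df A h + fn h \<^bold>\<and> df A f) xs"
    by (simp add: form_apply fn_wedge df_def)
qed

lemma df_add:
  assumes "f \<in> Cinf A" "h \<in> Cinf A"
  shows "df A (f + h) = df A f + df A h"
proof
  fix xs
  have "hd xs (f + h) = hd xs f + hd xs h" if "length xs = 1" "set xs \<subseteq> vfields A"
    using that vf_add[OF _ assms, of "hd xs"] by (cases xs) simp_all
  then show "df A (f + h) xs = (df A f + df A h) xs"
    by (simp add: form_apply df_def)
qed

lemma fn_add: "fn (f + h) = fn f + fn h"
  by (rule ext) (simp add: fn_def form_apply)

lemma fn_mult: "fn (f * h) = fn f \<^bold>\<and> fn h"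
  by (rule ext) (simp only: fn_wedge, simp add: fn_def)

text \<open>Evaluated on fixed arguments, a derivation restricted to functions or to their differentials
  is a vector field, to which the expansion in a frame applies.\<close>

lemma vfields_of_derivation:
  assumes "\<And>f. f \<in> Cinf A \<Longrightarrow> T f \<in> forms A"
    and "\<And>f h. f \<in> Cinf A \<Longrightarrow> h \<in> Cinf A \<Longrightarrow> T (f + h) = T f + T h"
    and "\<And>c f. f \<in> Cinf A \<Longrightarrow> T ((\<lambda>_. c) * f) = fn (\<lambda>_. c) \<^bold>\<and> T f"
    and "\<And>f h. f \<in> Cinf A \<Longrightarrow> h \<in> Cinf A \<Longrightarrow> T (f * h) = fn h \<^bold>\<and> T f + fn f \<^bold>\<and> T h"
  shows "(\<lambda>f. if f \<in> Cinf A then T f xs else 0) \<in> vfields A"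
proof (rule vfieldsI)
  fix c f assume f: "f \<in> Cinf A"
  have e: "(\<lambda>p. c * k p) = (\<lambda>_. c) * k" for k :: "'a \<Rightarrow> real"
    by (simp add: times_fun_def)
  show "(if (\<lambda>p. c * f p) \<in> Cinf A then T (\<lambda>p. c * f p) xs else 0)
      = (\<lambda>p. c * (if f \<in> Cinf A then T f xs else 0) p)"
    unfolding e using f by (simp add: Cinf_mult Cinf_const assms(3) fn_wedge)
qed (simp_all add: assms Cinf_add Cinf_mult forms_Cinf form_apply fn_wedge mult.commute)

section \<open>Expansions with respect to a fixed local frame\<close>

context
  fixes \<rho> y X assumes frame: "local_frame \<rho> y X"
begin

lemma frame_Cinf: "\<rho> \<in> Cinf A" "y e \<in> Cinf A" and frame_vfields: "X e \<in> vfields A"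
  using frame by (auto simp: local_frame_def)

abbreviation "\<kappa> \<equiv> \<rho> * \<rho> * \<rho>"

lemma frame_expand:
  "V \<in> vfields A \<Longrightarrow> f \<in> Cinf A \<Longrightarrow> \<kappa> * V f = (\<Sum>e\<in>Basis. (\<rho> * V (y e) - y e * V \<rho>) * X e f)"
  using frame unfolding local_frame_def by blast

lemma kappa_Cinf: "\<kappa> \<in> Cinf A"
  by (intro Cinf_mult frame_Cinf)

lemma frame_derivation:
  assumes "\<And>f. f \<in> Cinf A \<Longrightarrow> T f \<in> forms A"
    and "\<And>f h. f \<in> Cinf A \<Longrightarrow> h \<in> Cinf A \<Longrightarrow> T (f + h) = T f + T h"
    and "\<And>c f. f \<in> Cinf A \<Longrightarrow> T ((\<lambda>_. c) * f) = fn (\<lambda>_. c) \<^bold>\<and> T f"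
    and "\<And>f h. f \<in> Cinf A \<Longrightarrow> h \<in> Cinf A \<Longrightarrow> T (f * h) = fn h \<^bold>\<and> T f + fn f \<^bold>\<and> T h"
    and f: "f \<in> Cinf A"
  shows "fn \<kappa> \<^bold>\<and> T f = (\<Sum>e\<in>Basis. fn (X e f) \<^bold>\<and> (fn \<rho> \<^bold>\<and> T (y e) - fn (y e) \<^bold>\<and> T \<rho>))"
proof
  fix xs
  show "(fn \<kappa> \<^bold>\<and> T f) xs = (\<Sum>e\<in>Basis. fn (X e f) \<^bold>\<and> (fn \<rho> \<^bold>\<and> T (y e) - fn (y e) \<^bold>\<and> T \<rho>)) xs"
  proof -
    define V where "V g = (if g \<in> Cinf A then T g xs else 0)" for g
    have "V \<in> vfields A"
      unfolding V_def by (rule vfields_of_derivation) (fact assms)+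
    from frame_expand[OF this f]
    have "\<kappa> * T f xs = (\<Sum>e\<in>Basis. (\<rho> * T (y e) xs - y e * T \<rho> xs) * X e f)"
      by (simp only: V_def f frame_Cinf if_True)
    then show ?thesis
      by (simp only: sum_fun_apply[where x = xs] fn_wedge form_apply mult.commute[of "X _ f"])
  qed
qed

text \<open>In coordinates this is \<open>\<rho>\<^sup>2\<close> times the differential of a
  coordinate: the coframe belonging to \<open>X\<close>, again without division.\<close>

definition eps where "eps e = fn \<rho> \<^bold>\<and> df A (y e) - fn (y e) \<^bold>\<and> df A \<rho>"

lemma eps_hforms: "eps e \<in> hforms A 1"
  unfolding eps_def using hforms_wedge[OF hforms_fn hforms_df] frame_Cinf
  by (intro hforms_diff) simp_all

lemma contr_eps: "V \<in> vfields A \<Longrightarrow> contr V (eps e) = fn (\<rho> * V (y e) - y e * V \<rho>)"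
  unfolding eps_def contr_simps contr_wedge contr_df wedge_zero grade_inv_simps
  by (rule ext) (simp add: form_apply fn_wedge, simp add: fn_def)

text \<open>The expansion of \<open>V\<close> multiplied by \<open>\<kappa>\<close> is an identity
  between vector fields, and contraction is linear over functions in the vector field; the
  coefficients are the contractions of the coframe.\<close>

lemma contr_frame:
  assumes "\<omega> \<in> forms A" "V \<in> vfields A"
  shows "fn \<kappa> \<^bold>\<and> contr V \<omega> = (\<Sum>e\<in>Basis. contr V (eps e) \<^bold>\<and> contr (X e) \<omega>)"
proof -
  let ?c = "\<lambda>e. \<rho> * V (y e) - y e * V \<rho>"
  have c: "?c e \<in> Cinf A" for e
    by (intro Cinf_intros frame_Cinf vf_Cinf[OF assms(2)])
  have "vscale \<kappa> V = (\<Sum>e\<in>Basis. vscale (?c e) (X e))"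
  proof
    fix f
    show "vscale \<kappa> V f = (\<Sum>e\<in>Basis. vscale (?c e) (X e)) f"
    proof (cases "f \<in> Cinf A")
      case True
      then show ?thesis
        using frame_expand[OF assms(2) True] by (simp add: vscale_def sum_fun_apply)
    next
      case False
      then show ?thesis
        by (simp add: vscale_def sum_fun_apply vf_outside[OF assms(2)] vf_outside[OF frame_vfields])
    qed
  qed
  then have "contr (vscale \<kappa> V) \<omega> = (\<Sum>e\<in>Basis. contr (vscale (?c e) (X e)) \<omega>)"
    using contr_vsum[OF assms(1), of Basis "\<lambda>e. vscale (?c e) (X e)"]
    by (simp add: vfields_vscale c frame_vfields)
  then show ?thesis
    by (simp add: contr_vscale assms kappa_Cinf c frame_vfields contr_eps)
qed

text \<open>Where \<open>\<rho>\<close> is nonzero, each argument can be replaced by a combination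
  of the fields \<open>X e\<close>. More than \<open>DIM('b)\<close> entries taken from at most
  \<open>DIM('b)\<close> fields contain a repetition. The induction moves the arguments one by one
  from \<open>zs\<close>, where they are arbitrary, to \<open>ys\<close>, where they belong to the
  frame.\<close>

lemma frame_degree:
  assumes "\<omega> \<in> forms A" "\<rho> p \<noteq> 0" "length xs > DIM('b)"
  shows "\<omega> xs p = 0"
proof -
  have "\<omega> (ys @ zs) p = 0" if "set ys \<subseteq> X ` Basis" "length (ys @ zs) > DIM('b)" for ys zs
    using that
  proof (induction zs arbitrary: ys)
    case Nil
    have "card (set ys) \<le> DIM('b)"
      using card_mono[OF _ Nil(1)] card_image_le[of "Basis :: 'b set" X] by simp
    then have "\<not> distinct ys"
      using Nil(2) distinct_card[of ys] by auto
    then show ?case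
      using forms_not_distinct[OF assms(1)] by (simp add: fun_apply)
  next
    case (Cons V zs)
    show ?case
    proof (cases "V \<in> vfields A \<and> set ys \<subseteq> vfields A")
      case False
      then show ?thesis
        by (subst forms_outside[OF assms(1)]) (auto simp: fun_apply)
    next
      case True
      then have V: "V \<in> vfields A" and ys: "set ys \<subseteq> vfields A" by auto
      let ?c = "\<lambda>e. \<rho> * V (y e) - y e * V \<rho>"
      \<comment> \<open>Contracting with the entries of \<open>ys\<close> makes the argument after
        them the leading one, to which \<open>contr_frame\<close> applies.\<close>
      define ctr where "ctr = fold contr ys"
      have ctr: "ctr \<mu> \<in> forms A" "ctr \<mu> zs = \<mu> (ys @ zs)" if "\<mu> \<in> forms A" for \<mu> zs
        using that ys unfolding ctr_def
        by (induction ys arbitrary: \<mu> rule: list.induct) (simp_all add: forms_contr, simp_all add: contr_def)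
      have "(fn \<kappa> \<^bold>\<and> contr V (ctr \<omega>)) zs = (\<Sum>e\<in>Basis. contr V (eps e) \<^bold>\<and> contr (X e) (ctr \<omega>)) zs"
        by (simp only: contr_frame[OF ctr(1)[OF assms(1)] V])
      then have "(\<kappa> * ctr \<omega> (V # zs)) p = (\<Sum>e\<in>Basis. ?c e * ctr \<omega> (X e # zs)) p"
        unfolding sum_fun_apply[where x = zs] contr_eps[OF V] fn_wedge by (simp only: contr_def)
      also have "\<dots> = (\<Sum>e\<in>Basis. ?c e p * \<omega> ((ys @ [X e]) @ zs) p)"
        by (simp add: sum_fun_apply fun_apply ctr(2)[OF assms(1)])
      also have "\<dots> = 0"
      proof (intro sum.neutral ballI)
        fix e :: 'b assume "e \<in> Basis"
        with Cons.prems have "\<omega> ((ys @ [X e]) @ zs) p = 0"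
          by (intro Cons.IH) auto
        then show "?c e p * \<omega> ((ys @ [X e]) @ zs) p = 0" by simp
      qed
      finally show ?thesis
        using assms(2) by (simp add: fun_apply ctr(2)[OF assms(1)])
    qed
  qed
  from this[of "[]" xs] show ?thesis using assms(3) by simp
qed

text \<open>Contracting with the frame and multiplying by the coframe counts the degree: contraction
  with \<open>V\<close> passes \<open>eps e\<close> and the inner contraction with two signs that
  cancel, and hitting \<open>eps e\<close> contributes one more \<open>\<kappa>\<close>.\<close>

lemma frame_euler:
  assumes "\<omega> \<in> forms A"
  shows "(\<Sum>e\<in>Basis. eps e \<^bold>\<and> contr (X e) \<omega>) xs = (\<lambda>_. real (length xs)) * \<kappa> * \<omega> xs"
  using assms
proof (induction xs arbitrary: \<omega>)
  case Nil
  have "eps e [] = 0" for e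
    using eps_hforms[of e] by (simp add: hforms_def)
  then show ?case
    by (simp add: sum_fun_apply wedge_Nil) (simp add: fun_eq_iff fun_apply)
next
  case (Cons V xs)
  note f = forms_wedge[OF hforms_forms[OF eps_hforms] forms_contr[OF Cons.prems frame_vfields]]
  show ?case
  proof (cases "V \<in> vfields A")
    case False
    then have "\<omega> (V # xs) = 0" "(eps e \<^bold>\<and> contr (X e) \<omega>) (V # xs) = 0" for e
      using forms_outside[OF Cons.prems, of "V # xs"] forms_outside[OF f, of "V # xs"] by simp_all
    then show ?thesis
      by (simp add: sum_fun_apply)
  next
    case V: True
    have e: "grade_inv (eps e) = - eps e" for e
      using eps_hforms[of e] grade_inv_homog[of 1 "eps e"] by (simp add: hforms_iff psign_simps)
    have "(\<Sum>e\<in>Basis. eps e \<^bold>\<and> contr (X e) \<omega>) (V # xs)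
        = (\<Sum>e\<in>Basis. (contr V (eps e) \<^bold>\<and> contr (X e) \<omega>) xs + (eps e \<^bold>\<and> contr (X e) (contr V \<omega>)) xs)"
      unfolding sum_fun_apply[where x = "V # xs"]
      by (rule sum.cong[OF refl])
        (simp add: wedge_Cons e contr_swap[OF Cons.prems V frame_vfields] wedge_uminus)
    also have "\<dots> = (fn \<kappa> \<^bold>\<and> contr V \<omega>) xs + (\<Sum>e\<in>Basis. eps e \<^bold>\<and> contr (X e) (contr V \<omega>)) xs"
      by (simp add: sum.distrib contr_frame[OF Cons.prems V] sum_fun_apply)
    also have "\<dots> = \<kappa> * \<omega> (V # xs) + (\<lambda>_. real (length xs)) * \<kappa> * \<omega> (V # xs)"
      unfolding Cons.IH[OF forms_contr[OF Cons.prems V]] fn_wedge by (simp only: contr_def)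
    finally show ?thesis
      by (simp add: fun_eq_iff fun_apply algebra_simps)
  qed
qed

lemma derivation_vanishes:
  assumes D: "D \<in> hder A p" and D0: "\<And>f. f \<in> Cinf A \<Longrightarrow> D (fn f) = 0"
    and D1: "\<And>f. f \<in> Cinf A \<Longrightarrow> D (df A f) = 0" and \<omega>: "\<omega> \<in> forms A"
  shows "fn \<rho> \<^bold>\<and> D \<omega> = 0"
proof -
  have Dfn: "D (fn f \<^bold>\<and> \<mu>) = fn f \<^bold>\<and> D \<mu>" if "f \<in> Cinf A" "\<mu> \<in> forms A" for f \<mu>
    using hder_fn_wedge[OF D that] D0[OF that(1)] by (simp add: wedge_zero)
  \<comment> \<open>As \<open>D\<close> kills functions it is linear over them, and
    \<open>eps e\<close> is a combination of differentials, which \<open>D\<close> kills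
    too.\<close>
  have "D (eps e) = 0" for e
    using frame_Cinf unfolding eps_def
    by (simp add: hder_diff[OF D] forms_mult forms_df Dfn D1 wedge_zero)
  then have Deps: "D (eps e \<^bold>\<and> \<mu>) = psign p (eps e \<^bold>\<and> D \<mu>)" if "\<mu> \<in> forms A" for e \<mu>
    using hder_wedge[OF D eps_hforms that, of e] by (simp add: wedge_zero)
  have deg: "fn \<rho> \<^bold>\<and> D \<mu> = 0" if "\<mu> \<in> forms A" "\<And>xs. length xs \<noteq> j \<Longrightarrow> \<mu> xs = 0" for j \<mu>
    using that
  proof (induction j arbitrary: \<mu>)
    case 0
    then have "\<mu> = fn (\<mu> [])"
      by (auto simp: fn_def fun_eq_iff)
    then show ?case
      using D0[OF forms_Cinf[OF 0(1), of "[]"]] by (simp add: wedge_zero)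
  next
    case (Suc j)
    \<comment> \<open>By \<open>frame_euler\<close> this multiple of \<open>\<mu>\<close> is a sum
      of products of \<open>eps e\<close> with contractions of degree \<open>j\<close>.\<close>
    let ?h = "(\<lambda>_. real (Suc j)) * \<kappa>"
    have h: "?h \<in> Cinf A"
      by (intro Cinf_mult Cinf_const kappa_Cinf)
    note c = forms_contr[OF Suc.prems(1) frame_vfields]
    have IH: "fn \<rho> \<^bold>\<and> D (contr (X e) \<mu>) = 0" for e
      by (rule Suc.IH[OF c]) (simp add: contr_def Suc.prems(2))
    have "fn ?h \<^bold>\<and> \<mu> = (\<Sum>e\<in>Basis. eps e \<^bold>\<and> contr (X e) \<mu>)"
    proof
      fix xs
      show "(fn ?h \<^bold>\<and> \<mu>) xs = (\<Sum>e\<in>Basis. eps e \<^bold>\<and> contr (X e) \<mu>) xs"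
        unfolding frame_euler[OF Suc.prems(1)] fn_wedge
        using Suc.prems(2)[of xs] by (cases "length xs = Suc j") simp_all
    qed
    then have "D (fn ?h \<^bold>\<and> \<mu>) = D (\<Sum>e\<in>Basis. eps e \<^bold>\<and> contr (X e) \<mu>)"
      by (rule arg_cong)
    then have "fn ?h \<^bold>\<and> D \<mu> = (\<Sum>e\<in>Basis. psign p (eps e \<^bold>\<and> D (contr (X e) \<mu>)))"
      by (simp add: Dfn h Suc.prems(1) hder_sum[OF D] forms_wedge hforms_forms[OF eps_hforms] c Deps
          del: of_nat_Suc)
    then have "fn \<rho> \<^bold>\<and> (fn ?h \<^bold>\<and> D \<mu>) = fn \<rho> \<^bold>\<and> (\<Sum>e\<in>Basis. psign p (eps e \<^bold>\<and> D (contr (X e) \<mu>)))"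
      by simp
    also have "\<dots> = 0"
      by (simp add: wedge_sum_right wedge_psign wedge_fn_left[of "eps _", symmetric] IH wedge_zero psign_simps)
    finally have z: "\<rho> * (?h * D \<mu> xs) = 0" for xs
      by (metis fn_wedge form_apply(4))
    \<comment> \<open>Where \<open>\<rho>\<close> is nonzero, the factor
      \<open>(j + 1) \<rho>\<^sup>4\<close> can be cancelled; where it is 0, so is the left-hand
      side.\<close>
    show ?case
    proof (intro ext)
      fix xs s
      show "(fn \<rho> \<^bold>\<and> D \<mu>) xs s = 0 xs s"
        using fun_cong[OF z[of xs], of s] by (simp add: fn_wedge fun_apply)
    qed
  qed
  define part where "part j = (\<lambda>xs. if length xs = j then \<omega> xs else 0)" for j
  have part: "part j \<in> forms A" for j
    by (rule forms_alternatingI)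
      (use \<omega> in \<open>simp_all add: part_def zero_Cinf forms_Cinf forms_outside forms_slot forms_not_distinct\<close>)
  \<comment> \<open>Additivity of \<open>D\<close> reaches finite sums only. After multiplication by
    \<open>\<rho>\<close> the components of degree above \<open>DIM('b)\<close> are gone by
    \<open>frame_degree\<close>, also at the zeros of \<open>\<rho>\<close>.\<close>
  have "fn \<rho> \<^bold>\<and> \<omega> = (\<Sum>j\<le>DIM('b). fn \<rho> \<^bold>\<and> part j)"
  proof (intro ext)
    fix xs s
    have "\<rho> s * \<omega> xs s = 0" if "length xs > DIM('b)"
      using frame_degree[OF \<omega> _ that, of s] by auto
    then show "(fn \<rho> \<^bold>\<and> \<omega>) xs s = (\<Sum>j\<le>DIM('b). fn \<rho> \<^bold>\<and> part j) xs s"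
      by (auto simp: sum_fun_apply fn_wedge part_def fun_apply if_distrib[where f = "\<lambda>f. f s"] sum.delta
          if_distrib[where f = "\<lambda>r. _ * r"] cong: if_cong)
  qed
  then have "D (fn \<rho> \<^bold>\<and> \<omega>) = (\<Sum>j\<le>DIM('b). D (fn \<rho> \<^bold>\<and> part j))"
    by (simp add: hder_sum[OF D] forms_mult frame_Cinf part)
  moreover have "fn \<rho> \<^bold>\<and> D (part j) = 0" for j
    by (rule deg[OF part, of j j]) (simp add: part_def)
  ultimately show ?thesis
    by (simp add: Dfn frame_Cinf \<omega> part)
qed

end

text \<open>The left span of the generators given by global vector fields, built up one term at a
  time, so that plain induction shows the vanishing of a linear map that vanishes on
  generators.\<close>

inductive_set gen_span :: "'a oper set" where
  zero: "0 \<in> gen_span"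
| Lie: "\<alpha> \<in> hforms A q \<Longrightarrow> V \<in> vfields A \<Longrightarrow> D \<in> gen_span \<Longrightarrow> \<alpha> \<odot> Lie A V + D \<in> gen_span"
| iprod: "\<alpha> \<in> hforms A q \<Longrightarrow> V \<in> vfields A \<Longrightarrow> D \<in> gen_span \<Longrightarrow> \<alpha> \<odot> iprod A V + D \<in> gen_span"

lemma gen_span_add: "D \<in> gen_span \<Longrightarrow> E \<in> gen_span \<Longrightarrow> D + E \<in> gen_span"
  by (induction D rule: gen_span.induct) (simp_all add: add.assoc gen_span.intros)

lemma gen_span_lmul:
  assumes "\<beta> \<in> hforms A r" "D \<in> gen_span"
  shows "\<beta> \<odot> D \<in> gen_span"
  using assms(2)
  by (induction D rule: gen_span.induct)
    (auto simp: lmul_simps intro: gen_span.intros hforms_wedge[OF assms(1)])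

lemma gen_span_sum: "(\<And>i. i \<in> I \<Longrightarrow> D i \<in> gen_span) \<Longrightarrow> sum D I \<in> gen_span"
  by (induction I rule: infinite_finite_induct) (simp_all add: gen_span.zero gen_span_add)

lemma gen_span_generators:
  assumes "\<alpha> \<in> hforms A q" "V \<in> vfields A"
  shows "\<alpha> \<odot> Lie A V \<in> gen_span" "\<alpha> \<odot> iprod A V \<in> gen_span"
  using gen_span.Lie[OF assms gen_span.zero] gen_span.iprod[OF assms gen_span.zero] by simp_all

text \<open>One \<open>\<kappa>\<close> comes from expanding \<open>D\<close> on functions, where a
  combination of Lie derivatives reproduces it, and one from expanding the remainder
  \<open>D1\<close> on differentials, where interior products do. The last \<open>\<rho>\<close> is
  that of \<open>derivation_vanishes\<close>, applied to the rest \<open>D2\<close>.\<close>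

lemma frame_generates:
  assumes fr: "local_frame \<rho> y X" and D: "D \<in> hder A p"
  shows "fn (\<rho> * (\<kappa> \<rho> * \<kappa> \<rho>)) \<odot> D \<in> gen_span"
proof -
  let ?k = "\<kappa> \<rho>"
  note C = frame_Cinf[OF fr] and k = kappa_Cinf[OF fr] and X = frame_vfields[OF fr]
  note fnm = hder_lmul[OF hforms_fn[OF k], simplified]
  define \<gamma> where "\<gamma> e = fn \<rho> \<^bold>\<and> D (fn (y e)) - fn (y e) \<^bold>\<and> D (fn \<rho>)" for e
  have \<gamma>: "\<gamma> e \<in> hforms A p" for e
    using hforms_wedge[OF hforms_fn hder_hforms[OF D hforms_fn]] C unfolding \<gamma>_def
    by (intro hforms_diff) simp_all
  define S where "S = (\<Sum>e\<in>Basis. \<gamma> e \<odot> Lie A (X e))"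
  have hsum: "sum F I \<in> hder A p" if "\<And>i. i \<in> I \<Longrightarrow> F i \<in> hder A p" for F and I :: "'b set"
    using that by (induction I rule: infinite_finite_induct) (simp_all add: hder_zero_mem hder_plus)
  have S: "S \<in> hder A p"
    unfolding S_def by (rule hsum) (use hder_lmul[OF \<gamma> Lie_hder[OF X]] in simp)
  define D1 where "D1 = fn ?k \<odot> D - S"
  have D1: "D1 \<in> hder A p"
    unfolding D1_def by (intro hder_minus fnm D S)
  have D1_fn: "D1 (fn f) = 0" if f: "f \<in> Cinf A" for f
  proof -
    have "fn ?k \<^bold>\<and> D (fn f) = (\<Sum>e\<in>Basis. fn (X e f) \<^bold>\<and> \<gamma> e)"
      unfolding \<gamma>_def
    proof (rule frame_derivation[OF fr _ _ _ _ f, where T = "\<lambda>f. D (fn f)"])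
      show "D (fn (f * h)) = fn h \<^bold>\<and> D (fn f) + fn f \<^bold>\<and> D (fn h)" if "f \<in> Cinf A" "h \<in> Cinf A" for f h
        by (simp only: fn_mult hder_fn_wedge[OF D that(1) forms_fn[OF that(2)]] wedge_fn[of "D (fn f)"])
    qed (simp_all add: hder_forms[OF D] fn_add fn_mult hder_add[OF D] hder_scale[OF D] forms_fn)
    also have "\<dots> = S (fn f)"
      unfolding S_def sum_fun_apply lmul_def by (simp add: Lie_fn X f wedge_fn[of "\<gamma> _"])
    finally show ?thesis
      by (simp add: D1_def lmul_def fun_apply)
  qed
  \<comment> \<open>\<open>D1\<close> kills functions and so is linear over them; hence
    \<open>D1 (df A f)\<close> is a derivation in \<open>f\<close> and has a frame expansion.
    Interior products kill functions as well, so subtracting \<open>S'\<close> does not disturb the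
    vanishing on functions.\<close>
  define \<gamma>' where "\<gamma>' e = fn \<rho> \<^bold>\<and> D1 (df A (y e)) - fn (y e) \<^bold>\<and> D1 (df A \<rho>)" for e
  have \<gamma>': "\<gamma>' e \<in> hforms A (p + 1)" for e
    using hforms_wedge[OF hforms_fn hder_hforms[OF D1 hforms_df]] C unfolding \<gamma>'_def
    by (intro hforms_diff) simp_all
  define S' where "S' = (\<Sum>e\<in>Basis. \<gamma>' e \<odot> iprod A (X e))"
  have S': "S' \<in> hder A p"
    unfolding S'_def
    by (rule hsum) (use hder_lmul[OF \<gamma>' iprod_hder[OF X]] hder_cong[of "p + 1 + 1" p] in simp)
  define D2 where "D2 = fn ?k \<odot> D1 - S'"
  have D2: "D2 \<in> hder A p"
    unfolding D2_def by (intro hder_minus fnm D1 S')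
  have "D2 (fn f) = 0" if f: "f \<in> Cinf A" for f
  proof -
    have "S' (fn f) = 0"
      unfolding S'_def sum_fun_apply[where x = "fn f"] lmul_def
      by (simp add: iprod_fn f wedge_zero)
    then show ?thesis
      by (simp add: D2_def minus_apply[where x = "fn f"] lmul_def D1_fn f wedge_zero)
  qed
  moreover have "D2 (df A f) = 0" if f: "f \<in> Cinf A" for f
  proof -
    have D1m: "D1 (fn f \<^bold>\<and> \<mu>) = fn f \<^bold>\<and> D1 \<mu>" if "f \<in> Cinf A" "\<mu> \<in> forms A" for f \<mu>
      using that by (simp add: hder_fn_wedge[OF D1] D1_fn wedge_zero)
    have dc: "df A (\<lambda>_. c) = 0" for c
    proof
      fix xs show "df A (\<lambda>_. c) xs = 0 xs"
        by (cases xs) (auto simp: df_def vf_const form_apply)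
    qed
    have "fn ?k \<^bold>\<and> D1 (df A f) = (\<Sum>e\<in>Basis. fn (X e f) \<^bold>\<and> \<gamma>' e)"
      unfolding \<gamma>'_def
    proof (rule frame_derivation[OF fr _ _ _ _ f, where T = "\<lambda>f. D1 (df A f)"])
      show "D1 (df A (f * h)) = fn h \<^bold>\<and> D1 (df A f) + fn f \<^bold>\<and> D1 (df A h)" if "f \<in> Cinf A" "h \<in> Cinf A" for f h
        using that by (simp add: df_mult hder_add[OF D1] forms_mult forms_df D1m add.commute)
    qed (simp_all add: hder_forms[OF D1] df_add hder_add[OF D1] forms_df df_mult Cinf_const dc wedge_zero D1m)
    also have "\<dots> = S' (df A f)"
      unfolding S'_def sum_fun_apply lmul_def by (simp add: iprod_df X wedge_fn[of "\<gamma>' _"])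
    finally show ?thesis
      by (simp add: D2_def lmul_def fun_apply)
  qed
  ultimately have "fn \<rho> \<odot> D2 = 0"
  proof (intro ext, goal_cases)
    case (1 \<omega> xs s)
    then show ?case
      using derivation_vanishes[OF fr D2, of \<omega>] hder_outside[OF D2, of \<omega>]
      by (cases "\<omega> \<in> forms A") (simp_all add: lmul_def wedge_zero fun_apply)
  qed
  then have "fn \<rho> \<odot> (fn ?k \<odot> (fn ?k \<odot> D)) = fn \<rho> \<odot> (fn ?k \<odot> S + S')"
    unfolding D2_def D1_def by (simp only: lmul_simps(1,3) algebra_simps) (simp add: algebra_simps)
  moreover have "fn \<rho> \<odot> (fn ?k \<odot> S + S') \<in> gen_span"
    unfolding S_def S'_def
    by (intro gen_span_lmul[OF hforms_fn] gen_span_add gen_span_sum gen_span_generators[OF \<gamma>]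
        gen_span_generators[OF \<gamma>'] X C k)
  ultimately show ?thesis
    by (simp only: lmul_simps(9) fn_mult)
qed

text \<open>Vanishing is checked at each point \<open>q\<close> with a frame whose
  \<open>\<rho>\<close> is nonzero at \<open>q\<close>: the product of \<open>D\<close> with a power
  of \<open>\<rho>\<close> lies in the span, and linearity of \<open>\<theta>\<close> pulls this
  power out.\<close>

theorem Der_determined:
  assumes add: "\<And>D E. D \<in> Der A \<Longrightarrow> E \<in> Der A \<Longrightarrow> \<theta> (D + E) = \<theta> D + \<theta> E"
    and lmul: "\<And>\<alpha> D q. \<alpha> \<in> hforms A q \<Longrightarrow> D \<in> Der A \<Longrightarrow> \<theta> (\<alpha> \<odot> D) = \<alpha> \<^bold>\<and> \<theta> D"
    and Lie: "\<And>V. V \<in> vfields A \<Longrightarrow> \<theta> (Lie A V) = 0"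
    and iprod: "\<And>V. V \<in> vfields A \<Longrightarrow> \<theta> (iprod A V) = 0"
    and D: "D \<in> Der A"
  shows "\<theta> D = 0"
proof (intro ext)
  fix xs q
  have zero: "\<theta> 0 = 0"
    using add[OF Der_zero Der_zero] by simp
  have L: "Lie A V \<in> Der A" "iprod A V \<in> Der A" if "V \<in> vfields A" for V
    using that by (auto intro: hder_Der Lie_hder iprod_hder)
  have span: "E \<in> Der A \<and> \<theta> E = 0" if "E \<in> gen_span" for E
    using that
  proof (induction E rule: gen_span.induct)
    case (Lie \<alpha> q V D)
    then have "\<alpha> \<odot> Lie A V \<in> Der A"
      by (intro Der_lmul hforms_forms L)
    then show ?case
      using Lie L by (simp add: add lmul assms(3) wedge_zero Der_add)
  next
    case (iprod \<alpha> q V D)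
    then have "\<alpha> \<odot> iprod A V \<in> Der A"
      by (intro Der_lmul hforms_forms L)
    then show ?case
      using iprod L by (simp add: add lmul assms(4) wedge_zero Der_add)
  qed (simp add: zero Der_zero)
  obtain \<rho> y X where fr: "local_frame \<rho> y X" "\<rho> q \<noteq> 0"
    using ex_frame by blast
  let ?r = "\<rho> * (\<kappa> \<rho> * \<kappa> \<rho>)"
  have r: "?r \<in> Cinf A"
    by (intro Cinf_mult frame_Cinf(1)[OF fr(1)])
  obtain D0 D1 where D01: "D = D0 + D1" "D0 \<in> hder A 0" "D1 \<in> hder A 1"
    using D by (rule Der_cases)
  have "fn ?r \<odot> D \<in> gen_span"
    unfolding D01(1) lmul_simps(1) by (intro gen_span_add frame_generates[OF fr(1) D01(2)] frame_generates[OF fr(1) D01(3)])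
  then have "fn ?r \<^bold>\<and> \<theta> D = 0"
    using span lmul[OF hforms_fn[OF r] D] by simp
  then have "?r * \<theta> D xs = 0"
    by (metis fn_wedge form_apply(4))
  from fun_cong[OF this, of q] show "\<theta> D xs q = 0 xs q"
    using fr(2) by (simp add: fun_apply)
qed

end

section \<open>The graded Levi-Civita connection\<close>

lemma diff_swap: "a - b = c - d \<Longrightarrow> a - c = b - d" for a b c d :: "'c::ab_group_add"
  by (simp add: algebra_simps)

lemma add_diff_swap: "a + b = c + d \<Longrightarrow> a - c = - (b - d)" for a b c d :: "'c::ab_group_add"
  by (simp add: algebra_simps)

context smooth_mfd begin

lemma vbracket_add_left:
  assumes "X \<in> vfields A" "Y \<in> vfields A" "Z \<in> vfields A"
  shows "vbracket (X + Y) Z = vbracket X Z + vbracket Y Z"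
  by (rule ext) (simp add: vbracket_def vfield_apply vf_add assms vf_Cinf)

lemma vbracket_commute: "vbracket Y X = 0 - vbracket X Y"
  by (rule ext) (simp add: vbracket_def vfield_apply)

lemma Lie_vadd:
  assumes "X \<in> vfields A" "Y \<in> vfields A"
  shows "Lie A (X + Y) = Lie A X + Lie A Y"
proof (intro ext)
  fix \<omega> xs s
  have "Lie A (X + Y) \<omega> xs = Lie A X \<omega> xs + Lie A Y \<omega> xs" if "\<omega> \<in> forms A"
    using that
  proof (induction xs arbitrary: \<omega>)
    case Nil
    then show ?case by (simp add: Lie_Nil vfield_apply)
  next
    case (Cons Z xs)
    show ?case
    proof (cases "Z \<in> vfields A")
      case True
      have "Lie A V \<omega> (Z # xs) = Lie A V (contr Z \<omega>) xs - contr (vbracket V Z) \<omega> xs"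
        if "V \<in> vfields A" for V
        using fun_cong[OF contr_Lie[OF Cons.prems that True], of xs] by (simp only: form_apply contr_def)
      moreover have "contr (vbracket (X + Y) Z) \<omega> xs = contr (vbracket X Z) \<omega> xs + contr (vbracket Y Z) \<omega> xs"
        using assms True
        by (simp only: vbracket_add_left contr_vadd[OF Cons.prems] vfields_vbracket form_apply)
      ultimately show ?thesis
        using Cons.IH[OF forms_contr[OF Cons.prems True]] assms
        by (simp only: vfields_add) (simp add: algebra_simps)
    qed (simp add: Lie_apply_outside)
  qed
  then show "Lie A (X + Y) \<omega> xs s = (Lie A X + Lie A Y) \<omega> xs s"
    by (cases "\<omega> \<in> forms A") (simp_all add: fun_apply Lie_outside)
qed

lemma Lie_vdiff:
  assumes "X \<in> vfields A" "Y \<in> vfields A"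
  shows "Lie A (X - Y) = Lie A X - Lie A Y"
  using Lie_vadd[OF vfields_diff[OF assms] assms(2)] by (simp add: eq_diff_eq)

lemma iprod_vdiff:
  assumes "X \<in> vfields A" "Y \<in> vfields A"
  shows "iprod A (X - Y) = iprod A X - iprod A Y"
proof
  fix \<omega> show "iprod A (X - Y) \<omega> = (iprod A X - iprod A Y) \<omega>"
    by (cases "\<omega> \<in> forms A") (simp_all add: iprod_eq minus_apply[where x = \<omega>] contr_vdiff assms)
qed

text \<open>Both kinds of generators as one family indexed by parity. The value 0 from parity 2 on
  encodes the rules in which two interior products give zero, so that \<open>gen (p + q)\<close> can
  be used uniformly.\<close>

definition gen :: "nat \<Rightarrow> 'a vfield \<Rightarrow> 'a oper" where
  "gen p X = (if p = 0 then Lie A X else if p = 1 then iprod A X else 0)"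

lemma gen_simps: "gen 0 X = Lie A X" "gen 1 X = iprod A X" "gen (Suc 0) X = iprod A X" "gen 2 X = 0"
  "gen (Suc (Suc 0)) X = 0"
  by (simp_all add: gen_def)

lemma gen_hder: "X \<in> vfields A \<Longrightarrow> gen p X \<in> hder A p"
  by (simp add: gen_def Lie_hder iprod_hder hder_zero_mem) (metis One_nat_def iprod_hder)

lemma gen_vdiff: "X \<in> vfields A \<Longrightarrow> Y \<in> vfields A \<Longrightarrow> gen p (X - Y) = gen p X - gen p Y"
  by (simp add: gen_def Lie_vdiff iprod_vdiff)

lemma gbracket_Lie_Lie:
  assumes "X \<in> vfields A" "Y \<in> vfields A"
  shows "gbracket A (Lie A X) (Lie A Y) = Lie A (vbracket X Y)"
  unfolding gbracket_homogeneous[OF Lie_hder[OF assms(1)] Lie_hder[OF assms(2)]]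
proof
  fix \<omega>
  have "Lie A X (Lie A Y \<omega>) - Lie A Y (Lie A X \<omega>) = Lie A (vbracket X Y) \<omega>"
    using assms by (cases "\<omega> \<in> forms A") (simp_all add: Lie_bracket Lie_outside Lie_zero)
  then show "((Lie A X \<circ> Lie A Y) - psign (0 * 0) (Lie A Y \<circ> Lie A X)) \<omega> = Lie A (vbracket X Y) \<omega>"
    by (simp add: psign_def minus_apply[where x = \<omega>])
qed

lemma gbracket_Lie_iprod:
  assumes "X \<in> vfields A" "Y \<in> vfields A"
  shows "gbracket A (Lie A X) (iprod A Y) = iprod A (vbracket X Y)"
  unfolding gbracket_homogeneous[OF Lie_hder[OF assms(1)] iprod_hder[OF assms(2)]]
proof
  fix \<omega>
  have "Lie A X (iprod A Y \<omega>) - iprod A Y (Lie A X \<omega>) = iprod A (vbracket X Y) \<omega>"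
    using assms
    by (cases "\<omega> \<in> forms A") (simp_all add: iprod_eq forms_Lie contr_Lie Lie_outside Lie_zero contr_simps)
  then show "((Lie A X \<circ> iprod A Y) - psign (0 * 1) (iprod A Y \<circ> Lie A X)) \<omega> = iprod A (vbracket X Y) \<omega>"
    by (simp add: psign_def minus_apply[where x = \<omega>])
qed

lemma gbracket_iprod_Lie:
  assumes "X \<in> vfields A" "Y \<in> vfields A"
  shows "gbracket A (iprod A X) (Lie A Y) = iprod A (vbracket X Y)"
  unfolding gbracket_homogeneous[OF iprod_hder[OF assms(1)] Lie_hder[OF assms(2)]]
proof
  fix \<omega>
  have "contr (vbracket Y X) \<omega> = 0 - contr (vbracket X Y) \<omega>" if "\<omega> \<in> forms A"
    unfolding vbracket_commute[of Y X]
    using contr_vdiff[OF that vfields_zero vfields_vbracket[OF assms]]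
    by (simp only: contr_vzero[OF that])
  then have "iprod A X (Lie A Y \<omega>) - Lie A Y (iprod A X \<omega>) = iprod A (vbracket X Y) \<omega>"
    using assms
    by (cases "\<omega> \<in> forms A") (simp_all add: iprod_eq forms_Lie contr_Lie Lie_outside Lie_zero contr_simps)
  then show "((iprod A X \<circ> Lie A Y) - psign (1 * 0) (Lie A Y \<circ> iprod A X)) \<omega> = iprod A (vbracket X Y) \<omega>"
    by (simp add: psign_def minus_apply[where x = \<omega>])
qed

lemma gbracket_iprod_iprod:
  assumes "X \<in> vfields A" "Y \<in> vfields A"
  shows "gbracket A (iprod A X) (iprod A Y) = 0"
  unfolding gbracket_homogeneous[OF iprod_hder[OF assms(1)] iprod_hder[OF assms(2)]]
proof
  fix \<omega>
  have "iprod A X (iprod A Y \<omega>) + iprod A Y (iprod A X \<omega>) = 0"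
    using assms contr_swap[of \<omega> X Y]
    by (cases "\<omega> \<in> forms A") (simp_all add: iprod_eq forms_contr zero_forms contr_simps)
  then show "((iprod A X \<circ> iprod A Y) - psign (1 * 1) (iprod A Y \<circ> iprod A X)) \<omega> = 0 \<omega>"
    by (simp add: psign_def minus_apply[where x = \<omega>] uminus_apply[where x = \<omega>] plus_fun_apply[where x = \<omega>] zero_fun_apply[where x = \<omega>])
qed

text \<open>These are Cartan's relations; for \<open>p = q = 1\<close> the value 0 of
  \<open>gen 2\<close> says that interior products anticommute.\<close>

lemma gbracket_gen:
  assumes "X \<in> vfields A" "Y \<in> vfields A" "p \<in> {0, 1}" "q \<in> {0, 1}"
  shows "gbracket A (gen p X) (gen q Y) = gen (p + q) (vbracket X Y)"
  using assms
  by (auto simp: gen_simps gbracket_Lie_Lie gbracket_Lie_iprod gbracket_iprod_Lie gbracket_iprod_iprod)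

end

section \<open>The values of the graded Levi-Civita connection on generators\<close>

locale graded_riemannian = smooth_mfd A
  for A :: "('a::{t2_space,second_countable_topology}, 'b::euclidean_space) atlas" +
  fixes g :: "'a vfield \<Rightarrow> 'a vfield \<Rightarrow> 'a \<Rightarrow> real"
    and Dg :: "'a vfield \<Rightarrow> 'a vfield \<Rightarrow> 'a vfield"
    and G :: "'a gmetric"
    and NL :: "'a gconn"
  assumes g: "riemannian_metric A g"
    and Dg: "levi_civita_connection A g Dg"
    and G: "associated_graded_metric A g G"
    and NL: "graded_levi_civita A G NL"
begin

lemma g_Cinf: "X \<in> vfields A \<Longrightarrow> Y \<in> vfields A \<Longrightarrow> g X Y \<in> Cinf A"
  using g unfolding riemannian_metric_def by blast

lemma g_commute: "X \<in> vfields A \<Longrightarrow> Y \<in> vfields A \<Longrightarrow> g X Y = g Y X"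
  using g unfolding riemannian_metric_def by blast

lemma g_add_left:
  "X \<in> vfields A \<Longrightarrow> Y \<in> vfields A \<Longrightarrow> Z \<in> vfields A \<Longrightarrow> g (X + Y) Z = g X Z + g Y Z"
  using g unfolding riemannian_metric_def by blast

lemma g_diff_left:
  assumes "X \<in> vfields A" "Y \<in> vfields A" "Z \<in> vfields A"
  shows "g (X - Y) Z = g X Z - g Y Z"
  using g_add_left[OF vfields_diff[OF assms(1,2)] assms(2,3)] by (simp add: eq_diff_eq)

lemma Dg_vfields: "X \<in> vfields A \<Longrightarrow> Y \<in> vfields A \<Longrightarrow> Dg X Y \<in> vfields A"
  using Dg unfolding levi_civita_connection_def by blast

lemma Dg_torsion: "X \<in> vfields A \<Longrightarrow> Y \<in> vfields A \<Longrightarrow> vbracket X Y = Dg X Y - Dg Y X"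
  using Dg unfolding levi_civita_connection_def by metis

lemma Dg_metric:
  "X \<in> vfields A \<Longrightarrow> Y \<in> vfields A \<Longrightarrow> Z \<in> vfields A \<Longrightarrow> X (g Y Z) = g (Dg X Y) Z + g Y (Dg X Z)"
  using Dg unfolding levi_civita_connection_def by blast

lemma gm: "graded_metric A G"
  using G unfolding associated_graded_metric_def by blast

lemma G_gens:
  assumes "X \<in> vfields A" "Y \<in> vfields A"
  shows "G (Lie A X) (Lie A Y) = df A (g X Y)" "G (Lie A X) (iprod A Y) = fn (g X Y)"
    "G (iprod A X) (Lie A Y) = fn (g X Y)" "G (iprod A X) (iprod A Y) = 0"
  using G assms unfolding associated_graded_metric_def by blast+

lemma G_forms: "X \<in> Der A \<Longrightarrow> Y \<in> Der A \<Longrightarrow> G X Y \<in> forms A"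
  using gm by (simp add: graded_metric_def)

lemma G_add_left: "X \<in> Der A \<Longrightarrow> Y \<in> Der A \<Longrightarrow> Z \<in> Der A \<Longrightarrow> G (X + Y) Z = G X Z + G Y Z"
  using gm unfolding graded_metric_def by blast

lemma G_add_right: "X \<in> Der A \<Longrightarrow> Y \<in> Der A \<Longrightarrow> Z \<in> Der A \<Longrightarrow> G X (Y + Z) = G X Y + G X Z"
  using gm unfolding graded_metric_def by blast

lemma G_commute: "X \<in> hder A p \<Longrightarrow> Y \<in> hder A q \<Longrightarrow> G X Y = psign (p * q) (G Y X)"
  using gm unfolding graded_metric_def by blast

lemma G_lmul_left: "\<alpha> \<in> forms A \<Longrightarrow> X \<in> Der A \<Longrightarrow> Y \<in> Der A \<Longrightarrow> G (\<alpha> \<odot> X) Y = \<alpha> \<^bold>\<and> G X Y"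
  using gm unfolding graded_metric_def by blast

lemma G_lmul_right:
  assumes "\<alpha> \<in> hforms A q" "X \<in> hder A p" "Y \<in> Der A"
  shows "G X (\<alpha> \<odot> Y) = psign (p * q) (\<alpha> \<^bold>\<and> G X Y)"
proof -
  have "\<alpha> \<^bold>\<and> G X Y = psign (p * q) (G X (\<alpha> \<odot> Y))"
    using gm assms unfolding graded_metric_def by blast
  then show ?thesis
    by (simp add: psign_def)
qed

lemma G_zero: "X \<in> Der A \<Longrightarrow> G 0 X = 0" "X \<in> Der A \<Longrightarrow> G X 0 = 0"
  using G_add_left[of 0 0 X] G_add_right[of X 0 0] Der_zero by simp_all

lemma G_diff_left:
  assumes "X \<in> Der A" "Y \<in> Der A" "Z \<in> Der A"
  shows "G (X - Y) Z = G X Z - G Y Z"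
  using G_add_left[OF Der_diff[OF assms(1,2)] assms(2,3)] by (simp add: eq_diff_eq)

lemma G_diff_right:
  assumes "X \<in> Der A" "Y \<in> Der A" "Z \<in> Der A"
  shows "G X (Y - Z) = G X Y - G X Z"
  using G_add_right[OF assms(1) Der_diff[OF assms(2,3)] assms(3)] by (simp add: eq_diff_eq)

lemma gen_Der: "X \<in> vfields A \<Longrightarrow> gen p X \<in> Der A"
  by (rule hder_Der[OF gen_hder])

text \<open>The zero functional is represented by \<open>E\<close> as well as by 0, and its
  representation is unique.\<close>

lemma G_nondegenerate:
  assumes E: "E \<in> Der A" and "\<And>D. D \<in> Der A \<Longrightarrow> G D E = 0"
  shows "E = 0"
proof -
  have z: "(\<lambda>_. 0) \<in> Der_dual A"
    by (simp add: Der_dual_def zero_forms wedge_zero)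
  have "\<forall>\<theta>\<in>Der_dual A. \<exists>!X. X \<in> Der A \<and> (\<forall>Y\<in>Der A. \<theta> Y = G Y X)"
    using gm by (simp add: graded_metric_def)
  from bspec[OF this z] have "\<exists>!X. X \<in> Der A \<and> (\<forall>Y\<in>Der A. 0 = G Y X)" .
  moreover have "E \<in> Der A \<and> (\<forall>Y\<in>Der A. 0 = G Y E)"
    using assms by simp
  moreover have "0 \<in> Der A \<and> (\<forall>Y\<in>Der A. 0 = G Y 0)"
    by (simp add: Der_zero G_zero)
  ultimately show ?thesis by blast
qed

lemma G_nondegenerate_gen:
  assumes E: "E \<in> Der A" and gen: "\<And>r V. r \<in> {0, 1} \<Longrightarrow> V \<in> vfields A \<Longrightarrow> G (gen r V) E = 0"
  shows "E = 0"
proof (rule G_nondegenerate[OF E])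
  fix D assume D: "D \<in> Der A"
  show "G D E = 0"
  proof (rule Der_determined[OF _ _ _ _ D, where \<theta> = "\<lambda>D. G D E"])
    show "G (Lie A V) E = 0" "G (iprod A V) E = 0" if "V \<in> vfields A" for V
      using gen[of 0 V] gen[of 1 V] that by (simp_all add: gen_simps)
  qed (simp_all add: G_add_left G_lmul_left hforms_forms E)
qed

lemma conn: "graded_connection A NL"
  using NL unfolding graded_levi_civita_def by blast

lemma NL_torsion:
  "X \<in> hder A p \<Longrightarrow> Y \<in> hder A q \<Longrightarrow> NL X Y - psign (p * q) (NL Y X) = gbracket A X Y"
  using NL unfolding graded_levi_civita_def by blast

lemma NL_metric:
  "X \<in> hder A p \<Longrightarrow> Y \<in> hder A q \<Longrightarrow> Z \<in> Der A \<Longrightarrow>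
    X (G Y Z) = G (NL X Y) Z + psign (p * q) (G Y (NL X Z))"
  using NL unfolding graded_levi_civita_def by blast

lemma NL_hder: "X \<in> hder A p \<Longrightarrow> Y \<in> hder A q \<Longrightarrow> NL X Y \<in> hder A (p + q)"
  using conn unfolding graded_connection_def by blast

lemma NL_add_left: "X \<in> Der A \<Longrightarrow> Y \<in> Der A \<Longrightarrow> Z \<in> Der A \<Longrightarrow> NL (X + Y) Z = NL X Z + NL Y Z"
  using conn unfolding graded_connection_def by blast

lemma NL_add_right: "X \<in> Der A \<Longrightarrow> Y \<in> Der A \<Longrightarrow> Z \<in> Der A \<Longrightarrow> NL X (Y + Z) = NL X Y + NL X Z"
  using conn unfolding graded_connection_def by blast

lemma NL_leibniz:
  "\<alpha> \<in> hforms A q \<Longrightarrow> X \<in> hder A p \<Longrightarrow> Y \<in> Der A \<Longrightarrow>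
    NL X (\<alpha> \<odot> Y) = X \<alpha> \<odot> Y + psign (p * q) (\<alpha> \<odot> NL X Y)"
  using conn unfolding graded_connection_def by blast

lemma NL_Der: assumes "X \<in> hder A p" "Y \<in> Der A" shows "NL X Y \<in> Der A"
proof -
  obtain Y0 Y1 where Y: "Y = Y0 + Y1" "Y0 \<in> hder A 0" "Y1 \<in> hder A 1"
    using assms(2) by (rule Der_cases)
  have "NL X Y = NL X Y0 + NL X Y1"
    unfolding Y(1) by (intro NL_add_right hder_Der[OF assms(1)] hder_Der[OF Y(2)] hder_Der[OF Y(3)])
  then show ?thesis
    using hder_Der[OF NL_hder[OF assms(1) Y(2)]] hder_Der[OF NL_hder[OF assms(1) Y(3)]]
    by (simp only: Der_add)
qed

text \<open>On a differential \<open>df A f\<close> the interior product gives \<open>X f\<close>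
  and the Lie derivative gives \<open>df A (X f)\<close>, so every nontrivial case is the metric
  property of \<open>Dg\<close>. This is the counterpart of \<open>NL_metric\<close> for the
  expected connection.\<close>

lemma gen_metric:
  assumes "X \<in> vfields A" "Y \<in> vfields A" "Z \<in> vfields A" "p \<in> {0, 1}" "q \<in> {0, 1}" "r \<in> {0, 1}"
  shows "gen p X (G (gen q Y) (gen r Z))
    = G (gen (p + q) (Dg X Y)) (gen r Z) + psign (p * q) (G (gen q Y) (gen (p + r) (Dg X Z)))"
proof -
  have i0: "Lie A X 0 = 0" "iprod A X 0 = 0"
    using hder_zero[OF Lie_hder[OF assms(1)]] hder_zero[OF iprod_hder[OF assms(1)]] .
  have L: "Lie A V \<in> Der A" "iprod A V \<in> Der A" if "V \<in> vfields A" for V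
    using that by (auto intro: hder_Der Lie_hder iprod_hder)
  note D = Dg_vfields[OF assms(1,2)] Dg_vfields[OF assms(1,3)]
  have gs: "Lie A X (df A (g Y Z)) = df A (g (Dg X Y) Z) + df A (g Y (Dg X Z))"
    "Lie A X (fn (g Y Z)) = fn (g (Dg X Y) Z) + fn (g Y (Dg X Z))"
    "iprod A X (df A (g Y Z)) = fn (g (Dg X Y) Z) + fn (g Y (Dg X Z))"
    "iprod A X (fn (g Y Z)) = 0"
    using assms D by (simp_all add: Lie_df Lie_fn iprod_df iprod_fn Dg_metric df_add fn_add g_Cinf)
  from assms(4-6) show ?thesis
    using assms(1-3) D
    by (elim insertE emptyE)
      (simp_all add: gen_simps G_gens gs i0 G_zero L psign_simps)
qed

text \<open>The uniqueness proof for Levi-Civita connections, applied to the deviation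
  \<open>K\<close> on generators, where the expected values obey the same torsion and metric
  conditions by \<open>gbracket_gen\<close> and \<open>gen_metric\<close>.\<close>

lemma NL_gen:
  assumes "X \<in> vfields A" "Y \<in> vfields A" "p \<in> {0, 1}" "q \<in> {0, 1}"
  shows "NL (gen p X) (gen q Y) = gen (p + q) (Dg X Y)"
proof -
  define K where "K p q X Y = NL (gen p X) (gen q Y) - gen (p + q) (Dg X Y)" for p q X Y
  define W where "W p q r X Y Z = G (K p q X Y) (gen r Z)" for p q r X Y Z
  have Kh: "K p q X Y \<in> hder A (p + q)" if "X \<in> vfields A" "Y \<in> vfields A" for p q X Y
    unfolding K_def by (intro hder_minus NL_hder gen_hder Dg_vfields that)
  have Ks: "K p q X Y = psign (p * q) (K q p Y X)"
    if "X \<in> vfields A" "Y \<in> vfields A" "p \<in> {0, 1}" "q \<in> {0, 1}" for p q X Y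
  proof -
    have e1: "NL (gen p X) (gen q Y) - psign (p * q) (NL (gen q Y) (gen p X))
        = gen (p + q) (Dg X Y) - gen (p + q) (Dg Y X)"
      using that NL_torsion[OF gen_hder gen_hder, of X Y p q]
      by (simp only: gbracket_gen Dg_torsion gen_vdiff Dg_vfields)
    \<comment> \<open>The sign is nontrivial only for \<open>p = q = 1\<close>, where
      \<open>gen 2\<close> is 0.\<close>
    have e2: "gen (p + q) (Dg Y X) = psign (p * q) (gen (q + p) (Dg Y X))"
      using that(3,4) by (auto simp: gen_def psign_def)
    show ?thesis
      unfolding K_def psign_simps(4) e2[symmetric] by (rule diff_swap[OF e1])
  qed
  have Ws: "W p q r X Y Z = psign (p * q) (W q p r Y X Z)"
    if "X \<in> vfields A" "Y \<in> vfields A" "Z \<in> vfields A" "p \<in> {0, 1}" "q \<in> {0, 1}" for p q r X Y Z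
  proof -
    have "G (- K q p Y X) (gen r Z) = - G (K q p Y X) (gen r Z)"
      using G_diff_left[OF Der_zero hder_Der[OF Kh] gen_Der, of Y X Z q p r] that
      by (simp add: G_zero gen_Der)
    then show ?thesis
      unfolding W_def by (subst Ks[OF that(1,2,4,5)]) (simp add: psign_def)
  qed
  have Wa: "W p q r X Y Z = - psign (q * r) (W p r q X Z Y)"
    if XYZ: "X \<in> vfields A" "Y \<in> vfields A" "Z \<in> vfields A"
      and pqr: "p \<in> {0, 1}" "q \<in> {0, 1}" "r \<in> {0, 1}" for p q r X Y Z
  proof -
    have "gen p X (G (gen q Y) (gen r Z)) = G (NL (gen p X) (gen q Y)) (gen r Z)
        + psign (p * q) (G (gen q Y) (NL (gen p X) (gen r Z)))"
      by (rule NL_metric[OF gen_hder[OF XYZ(1)] gen_hder[OF XYZ(2)] gen_Der[OF XYZ(3)]])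
    then have "G (NL (gen p X) (gen q Y)) (gen r Z) + psign (p * q) (G (gen q Y) (NL (gen p X) (gen r Z)))
        = G (gen (p + q) (Dg X Y)) (gen r Z) + psign (p * q) (G (gen q Y) (gen (p + r) (Dg X Z)))"
      using gen_metric[OF XYZ pqr] by simp
    moreover have "W p q r X Y Z = G (NL (gen p X) (gen q Y)) (gen r Z) - G (gen (p + q) (Dg X Y)) (gen r Z)"
      unfolding W_def K_def
      by (intro G_diff_left gen_Der NL_Der[OF gen_hder] Dg_vfields XYZ)
    moreover have "G (gen q Y) (K p r X Z) = G (gen q Y) (NL (gen p X) (gen r Z)) - G (gen q Y) (gen (p + r) (Dg X Z))"
      unfolding K_def
      by (intro G_diff_right gen_Der NL_Der[OF gen_hder] Dg_vfields XYZ)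
    ultimately have "W p q r X Y Z = - psign (p * q) (G (gen q Y) (K p r X Z))"
      by (simp only: psign_simps(4) add_diff_swap)
    also have "G (gen q Y) (K p r X Z) = psign (q * (p + r)) (W p r q X Z Y)"
      unfolding W_def by (rule G_commute[OF gen_hder[OF XYZ(2)] Kh[OF XYZ(1,3)]])
    also have "- psign (p * q) (psign (q * (p + r)) w) = - psign (q * r) w" for w :: "'a form"
      by (auto simp: psign_def)
    finally show ?thesis .
  qed
  have "W p q r X Y Z = 0"
    if XYZ: "X \<in> vfields A" "Y \<in> vfields A" "Z \<in> vfields A"
      and pqr: "p \<in> {0, 1}" "q \<in> {0, 1}" "r \<in> {0, 1}" for p q r X Y Z
  proof -
    have "W p q r X Y Z = psign (p * q) (W q p r Y X Z)"
      by (rule Ws[OF XYZ(1,2,3) pqr(1,2)])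
    also have "W q p r Y X Z = - psign (p * r) (W q r p Y Z X)"
      by (rule Wa[OF XYZ(2,1,3) pqr(2,1,3)])
    also have "W q r p Y Z X = psign (q * r) (W r q p Z Y X)"
      by (rule Ws[OF XYZ(2,3,1) pqr(2,3)])
    also have "W r q p Z Y X = - psign (q * p) (W r p q Z X Y)"
      by (rule Wa[OF XYZ(3,2,1) pqr(3,2,1)])
    also have "W r p q Z X Y = psign (r * p) (W p r q X Z Y)"
      by (rule Ws[OF XYZ(3,1,2) pqr(3,1)])
    also have "W p r q X Z Y = - psign (r * q) (W p q r X Y Z)"
      by (rule Wa[OF XYZ(1,3,2) pqr(1,3,2)])
    \<comment> \<open>Each of the three products of parities occurs twice, up to the order of its
      factors; what remains are the three minus signs of \<open>Wa\<close>.\<close>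
    also have "psign (p * q) (- psign (p * r) (psign (q * r) (- psign (q * p) (psign (r * p)
        (- psign (r * q) w))))) = - w" for w :: "'a form"
      by (auto simp: psign_def)
    finally have "W p q r X Y Z = - W p q r X Y Z" .
    \<comment> \<open>The equation \<open>w = - w\<close> is read off at single points, where the
      values are real numbers.\<close>
    then show ?thesis
    proof (intro ext)
      fix xs s
      assume "W p q r X Y Z = - W p q r X Y Z"
      from fun_cong[OF fun_cong[OF this, of xs], of s] show "W p q r X Y Z xs s = 0 xs s"
        by (simp add: fun_apply)
    qed
  qed
  then have "G (gen r V) (K p q X Y) = 0" if "r \<in> {0, 1}" "V \<in> vfields A" for r V
    using that assms G_commute[OF gen_hder[OF that(2)] Kh[OF assms(1,2)], of r p q]
    by (simp add: W_def psign_simps)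
  then have "K p q X Y = 0"
    by (rule G_nondegenerate_gen[OF hder_Der[OF Kh[OF assms(1,2)]]])
  then show ?thesis
    by (simp add: K_def)
qed

end

section \<open>The semi-symmetric connection and its curvature\<close>

lemma form_part_add: "form_part p (\<alpha> + \<beta>) = form_part p \<alpha> + form_part p \<beta>"
  by (rule ext) (simp add: form_part_def form_apply)

context smooth_mfd begin

lemma rmul_hder:
  assumes "X \<in> hder A p"
  shows "rmul A X \<beta> = form_part 0 \<beta> \<odot> X + psign p (form_part 1 \<beta> \<odot> X)"
proof -
  have "rmul A X \<beta> = (\<Sum>r<2. psign (r * 0) (form_part 0 \<beta> \<odot> (if even (r + p) then X else 0))
      + psign (r * 1) (form_part 1 \<beta> \<odot> (if even (r + p) then X else 0)))"
    unfolding rmul_def sum_lessThan_2 der_part_hder[OF assms] ..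
  then show ?thesis
    unfolding sum_lessThan_2 by (cases "even p") (simp_all add: lmul_simps psign_simps psign_def)
qed

lemma rmul_add: "X \<in> hder A p \<Longrightarrow> rmul A X (\<alpha> + \<beta>) = rmul A X \<alpha> + rmul A X \<beta>"
  by (simp add: rmul_hder form_part_add lmul_simps psign_simps)

lemma rmul_zero: "X \<in> hder A p \<Longrightarrow> rmul A X 0 = 0"
  using rmul_add[of X p 0 0] by simp

lemma rmul_Der:
  assumes "X \<in> hder A p" "\<beta> \<in> forms A"
  shows "rmul A X \<beta> \<in> Der A"
proof -
  have "form_part r \<beta> \<odot> X \<in> Der A" for r
    by (rule Der_lmul[OF hforms_forms[OF form_part_forms[OF assms(2)]] hder_Der[OF assms(1)]])
  then show ?thesis
    unfolding rmul_hder[OF assms(1)] by (simp add: psign_def Der_add Der_uminus)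
qed

text \<open>In the exponent of \<open>rmul\<close> the parity of \<open>\<alpha>\<close> adds to
  that of each part of \<open>\<beta>\<close>; the share \<open>p * q\<close> of
  \<open>\<alpha>\<close> comes out as a common sign.\<close>

lemma rmul_wedge:
  assumes X: "X \<in> hder A p" and \<alpha>: "\<alpha> \<in> hforms A q" and \<beta>: "\<beta> \<in> forms A"
  shows "rmul A X (\<alpha> \<^bold>\<and> \<beta>) = psign (p * q) (\<alpha> \<odot> rmul A X \<beta>)"
proof -
  have h: "rmul A X (\<alpha> \<^bold>\<and> form_part r \<beta>) = psign (p * q) (\<alpha> \<odot> rmul A X (form_part r \<beta>))" for r
  proof -
    note b = form_part_forms[OF \<beta>, of r]
    show ?thesis
      unfolding rmul_homogeneous[OF X hforms_wedge[OF \<alpha> b]] rmul_homogeneous[OF X b]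
      by (simp add: lmul_simps distrib_left psign_simps(1))
  qed
  have "rmul A X (\<alpha> \<^bold>\<and> (form_part 0 \<beta> + form_part 1 \<beta>))
      = psign (p * q) (\<alpha> \<odot> rmul A X (form_part 0 \<beta> + form_part 1 \<beta>))"
    by (simp only: wedge_add_right rmul_add[OF X] h lmul_simps psign_simps)
  then show ?thesis
    by (simp only: form_part_sum)
qed

end

context graded_riemannian begin

context
  fixes U :: "'a vfield" assumes U: "U \<in> vfields A"
begin

definition S :: "'a gconn" where "S = semi_symmetric A G NL (iprod A U)"

lemma S_eq: "S X Y = NL X Y + rmul A X (G Y (iprod A U)) - G X Y \<odot> iprod A U"
  by (simp add: S_def semi_symmetric_def)

lemma iU: "iprod A U \<in> Der A"
  by (rule hder_Der[OF iprod_hder[OF U]])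

lemma S_Der:
  assumes "X \<in> hder A p" "Y \<in> Der A"
  shows "S X Y \<in> Der A"
  unfolding S_eq
  by (intro Der_diff Der_add NL_Der[OF assms] rmul_Der[OF assms(1)] G_forms Der_lmul iU
      hder_Der[OF assms(1)] assms(2))

lemma S_add:
  assumes "X \<in> hder A p" "Y \<in> Der A" "Z \<in> Der A"
  shows "S X (Y + Z) = S X Y + S X Z"
  using assms hder_Der[OF assms(1)] iU
  by (simp add: S_eq NL_add_right G_add_left G_add_right rmul_add lmul_simps algebra_simps)

lemma S_zero: "X \<in> hder A p \<Longrightarrow> S X 0 = 0"
  using S_add[OF _ Der_zero Der_zero] by simp

lemma S_zero_left: "Y \<in> Der A \<Longrightarrow> S 0 Y = 0"
  using NL_add_left[OF Der_zero Der_zero, of Y] rmul_hder[OF hder_zero_mem[of 0]]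
  by (simp add: S_eq G_zero lmul_simps psign_simps)

lemma S_uminus: assumes "X \<in> hder A p" "Y \<in> Der A" shows "S X (- Y) = - S X Y"
  using S_add[OF assms Der_uminus[OF assms(2)]] S_zero[OF assms(1)]
  by (simp add: eq_neg_iff_add_eq_0 add.commute)

lemma S_diff:
  assumes "X \<in> hder A p" "Y \<in> Der A" "Z \<in> Der A"
  shows "S X (Y - Z) = S X Y - S X Z"
  using S_add[OF assms(1,2) Der_uminus[OF assms(3)]] S_uminus[OF assms(1,3)] by simp

text \<open>Both correction terms of the semi-symmetric connection are linear over forms in
  \<open>Y\<close>, with the same sign \<open>p * q\<close> for passing \<open>X\<close>; the term
  with \<open>X \<alpha>\<close> is that of \<open>NL\<close>.\<close>

lemma S_leibniz:
  assumes "X \<in> hder A p" "\<alpha> \<in> hforms A q" "Y \<in> Der A"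
  shows "S X (\<alpha> \<odot> Y) = X \<alpha> \<odot> Y + psign (p * q) (\<alpha> \<odot> S X Y)"
  unfolding S_eq NL_leibniz[OF assms(2,1,3)] G_lmul_left[OF hforms_forms[OF assms(2)] assms(3) iU]
    rmul_wedge[OF assms(1,2) G_forms[OF assms(3) iU]] G_lmul_right[OF assms(2,1,3)]
  by (simp add: lmul_simps psign_simps algebra_simps)

text \<open>Of the four summands of the additive extension only the one with the parities of
  \<open>X\<close> and \<open>Y\<close> survives; with \<open>p\<close> and \<open>q\<close> in
  \<open>{0, 1}\<close> these are the summation indices themselves.\<close>

lemma curvature_hder:
  assumes X: "X \<in> hder A p" and Y: "Y \<in> hder A q" and Z: "Z \<in> Der A"
    and pq: "p \<in> {0, 1}" "q \<in> {0, 1}"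
  shows "graded_curvature A S X Y Z
    = S X (S Y Z) - psign (p * q) (S Y (S X Z)) - S (gbracket A X Y) Z"
proof -
  have b0: "gbracket A 0 Y = 0"
    unfolding gbracket_homogeneous[OF hder_zero_mem[of 0] Y]
    by (simp add: fun_eq_iff fun_apply psign_def hder_zero[OF Y])
  have b1: "gbracket A X 0 = 0"
    unfolding gbracket_homogeneous[OF X hder_zero_mem[of 0]]
    by (simp add: fun_eq_iff fun_apply psign_def hder_zero[OF X])
  have b2: "gbracket A 0 0 = (0 :: 'a oper)"
    unfolding gbracket_homogeneous[OF hder_zero_mem[of 0] hder_zero_mem[of 0]]
    by (simp add: fun_eq_iff fun_apply psign_def)
  note z = b0 b1 b2 S_zero_left[OF Z] S_zero_left[OF Der_zero] S_zero[OF X] S_zero[OF Y]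
    S_zero_left[OF S_Der[OF X Z]] S_zero_left[OF S_Der[OF Y Z]]
  show ?thesis
    using pq unfolding graded_curvature_def sum_lessThan_2 der_part_hder[OF X] der_part_hder[OF Y] Let_def
    by (elim insertE emptyE) (simp_all add: z psign_simps)
qed

section \<open>The semi-symmetric connection on generators and its curvature\<close>

lemma Lie_Der: "V \<in> vfields A \<Longrightarrow> Lie A V \<in> Der A" and iprod_Der: "V \<in> vfields A \<Longrightarrow> iprod A V \<in> Der A"
  by (auto intro: hder_Der Lie_hder iprod_hder)

lemma S_gens:
  assumes "X \<in> vfields A" "Y \<in> vfields A"
  shows "S (Lie A X) (Lie A Y) = Lie A (Dg X Y) + fn (g Y U) \<odot> Lie A X - df A (g X Y) \<odot> iprod A U"
    and "S (Lie A X) (iprod A Y) = iprod A (Dg X Y) - fn (g X Y) \<odot> iprod A U"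
    and "S (iprod A X) (Lie A Y) = iprod A (Dg X Y) + fn (g Y U) \<odot> iprod A X - fn (g X Y) \<odot> iprod A U"
    and "S (iprod A X) (iprod A Y) = 0"
proof -
  note N = NL_gen[OF assms, of 0 0] NL_gen[OF assms, of 0 1] NL_gen[OF assms, of 1 0] NL_gen[OF assms, of 1 1]
  note N' = N[simplified gen_simps, simplified]
  have r: "rmul A (Lie A X) (fn (g Y U)) = fn (g Y U) \<odot> Lie A X"
    "rmul A (iprod A X) (fn (g Y U)) = fn (g Y U) \<odot> iprod A X"
    using rmul_homogeneous[OF Lie_hder[OF assms(1)] hforms_fn[OF g_Cinf[OF assms(2) U]]]
      rmul_homogeneous[OF iprod_hder[OF assms(1)] hforms_fn[OF g_Cinf[OF assms(2) U]]]
    by (simp_all add: psign_simps)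
  note z = rmul_zero[OF Lie_hder[OF assms(1)]] rmul_zero[OF iprod_hder[OF assms(1)]]
  show "S (Lie A X) (Lie A Y) = Lie A (Dg X Y) + fn (g Y U) \<odot> Lie A X - df A (g X Y) \<odot> iprod A U"
    "S (Lie A X) (iprod A Y) = iprod A (Dg X Y) - fn (g X Y) \<odot> iprod A U"
    "S (iprod A X) (Lie A Y) = iprod A (Dg X Y) + fn (g Y U) \<odot> iprod A X - fn (g X Y) \<odot> iprod A U"
    "S (iprod A X) (iprod A Y) = 0"
    using assms U by (simp_all add: S_eq N' G_gens r z lmul_simps gen_simps)
qed

lemma S_fn_df:
  assumes "X \<in> vfields A" "f \<in> Cinf A" "E \<in> Der A"
  shows "S (Lie A X) (fn f \<odot> E) = fn (X f) \<odot> E + fn f \<odot> S (Lie A X) E"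
    and "S (Lie A X) (df A f \<odot> E) = df A (X f) \<odot> E + df A f \<odot> S (Lie A X) E"
    and "S (iprod A X) (fn f \<odot> E) = fn f \<odot> S (iprod A X) E"
    and "S (iprod A X) (df A f \<odot> E) = fn (X f) \<odot> E - df A f \<odot> S (iprod A X) E"
  using S_leibniz[OF Lie_hder[OF assms(1)] hforms_fn[OF assms(2)] assms(3)]
    S_leibniz[OF Lie_hder[OF assms(1)] hforms_df assms(3), of f]
    S_leibniz[OF iprod_hder[OF assms(1)] hforms_fn[OF assms(2)] assms(3)]
    S_leibniz[OF iprod_hder[OF assms(1)] hforms_df assms(3), of f]
  by (simp_all add: Lie_fn Lie_df iprod_fn iprod_df assms psign_simps lmul_simps)

lemma fn_df_Der: "f \<in> Cinf A \<Longrightarrow> E \<in> Der A \<Longrightarrow> fn f \<odot> E \<in> Der A" "E \<in> Der A \<Longrightarrow> df A f \<odot> E \<in> Der A"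
  by (auto intro: Der_lmul forms_fn forms_df)

text \<open>Two interior products have bracket 0, so the curvature is the anticommutator
  \<open>T\<close> of the two covariant derivatives. It is linear over forms in its argument and
  hence determined by its values on generators.\<close>

lemma curvature_iprod_iprod:
  assumes X: "X \<in> vfields A" and Y: "Y \<in> vfields A" and E: "E \<in> Der A"
  shows "graded_curvature A S (iprod A X) (iprod A Y) E = 0"
proof -
  note hX = iprod_hder[OF X] and hY = iprod_hder[OF Y]
  define T where "T D = S (iprod A X) (S (iprod A Y) D) + S (iprod A Y) (S (iprod A X) D)" for D
  have "T D \<omega> = 0" if D: "D \<in> Der A" for D \<omega>
  \<comment> \<open>\<open>Der_determined\<close> is about maps into forms, so \<open>T D\<close> is
    evaluated at a fixed \<open>\<omega>\<close>.\<close>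
  proof (rule Der_determined[OF _ _ _ _ D, where \<theta> = "\<lambda>D. T D \<omega>"])
    show "T (D + E) \<omega> = T D \<omega> + T E \<omega>" if "D \<in> Der A" "E \<in> Der A" for D E
    proof -
      have "T (D + E) = T D + T E"
        unfolding T_def
        by (simp only: S_add[OF hX that] S_add[OF hY that] S_add[OF hX S_Der[OF hY that(1)] S_Der[OF hY that(2)]]
            S_add[OF hY S_Der[OF hX that(1)] S_Der[OF hX that(2)]] ac_simps)
      then show ?thesis
        by (simp only: plus_fun_apply[where x = \<omega>])
    qed
    show "T (\<alpha> \<odot> D) \<omega> = \<alpha> \<^bold>\<and> T D \<omega>" if \<alpha>: "\<alpha> \<in> hforms A q" and D: "D \<in> Der A" for \<alpha> D q
    proof -
      \<comment> \<open>The two middle terms have opposite signs and are interchanged with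
        \<open>V\<close> and \<open>W\<close>, so they cancel in the sum over both orders; the
        leading terms cancel because interior products anticommute.\<close>
      have SS: "S (iprod A V) (S (iprod A W) (\<alpha> \<odot> D))
          = iprod A V (iprod A W \<alpha>) \<odot> D - psign q (iprod A W \<alpha> \<odot> S (iprod A V) D)
            + psign q (iprod A V \<alpha> \<odot> S (iprod A W) D) + \<alpha> \<odot> S (iprod A V) (S (iprod A W) D)"
        if V: "V \<in> vfields A" and W: "W \<in> vfields A" for V W
      proof -
        note v = iprod_hder[OF V] and w = iprod_hder[OF W]
        have a: "iprod A W \<alpha> \<in> hforms A (1 + q)"
          by (rule hder_hforms[OF w \<alpha>])
        have "S (iprod A W) (\<alpha> \<odot> D) = iprod A W \<alpha> \<odot> D + psign q (\<alpha> \<odot> S (iprod A W) D)"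
          using S_leibniz[OF w \<alpha> D] by simp
        moreover have "S (iprod A V) (iprod A W \<alpha> \<odot> D)
            = iprod A V (iprod A W \<alpha>) \<odot> D - psign q (iprod A W \<alpha> \<odot> S (iprod A V) D)"
          using S_leibniz[OF v a D] by (simp add: psign_simps)
        moreover have "S (iprod A V) (psign q (\<alpha> \<odot> S (iprod A W) D))
            = psign q (S (iprod A V) (\<alpha> \<odot> S (iprod A W) D))"
          using S_uminus[OF v Der_lmul[OF hforms_forms[OF \<alpha>] S_Der[OF w D]]] by (simp add: psign_def)
        moreover have "S (iprod A V) (\<alpha> \<odot> S (iprod A W) D)
            = iprod A V \<alpha> \<odot> S (iprod A W) D + psign q (\<alpha> \<odot> S (iprod A V) (S (iprod A W) D))"
          using S_leibniz[OF v \<alpha> S_Der[OF w D]] by simp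
        moreover have "psign q (\<alpha> \<odot> S (iprod A W) D) \<in> Der A"
          using Der_lmul[OF hforms_forms[OF \<alpha>] S_Der[OF w D]] by (simp add: psign_def Der_uminus)
        moreover have "psign q (psign q F) = F" for F :: "'a oper"
          by (simp add: psign_def)
        ultimately show ?thesis
          using S_add[OF v Der_lmul[OF hforms_forms[OF a] D], of "psign q (\<alpha> \<odot> S (iprod A W) D)"]
          by (simp only: psign_simps(3) add.assoc)
      qed
      have "iprod A X (iprod A Y \<alpha>) = - iprod A Y (iprod A X \<alpha>)"
        using contr_swap[OF hforms_forms[OF \<alpha>] X Y] hforms_forms[OF \<alpha>] X Y
        by (simp add: iprod_eq forms_contr)
      then have "T (\<alpha> \<odot> D) = \<alpha> \<odot> T D"
        unfolding T_def SS[OF X Y] SS[OF Y X] by (simp add: lmul_simps)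
      then show ?thesis
        by (simp add: lmul_def)
    qed
    fix V assume V: "V \<in> vfields A"
    have "T (iprod A V) = 0"
      unfolding T_def using V X Y hX hY by (simp add: S_gens S_zero)
    then show "T (iprod A V) \<omega> = 0"
      by (simp only: zero_fun_apply[where x = \<omega>])
    \<comment> \<open>The inner derivative is a combination of interior products with functions as
      coefficients. The outer one differentiates these coefficients by an interior product, which
      gives 0, and it vanishes on interior products.\<close>
    have SL: "S (iprod A W) (S (iprod A W') (Lie A V)) = 0" if "W \<in> vfields A" "W' \<in> vfields A" for W W'
    proof -
      note w = iprod_hder[OF that(1)]
      have c: "g V U \<in> Cinf A" "g W' V \<in> Cinf A"
        using g_Cinf V U that by blast+
      note D = iprod_Der[OF Dg_vfields[OF that(2) V]] fn_df_Der(1)[OF c(1) iprod_Der[OF that(2)]]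
        fn_df_Der(1)[OF c(2) iU]
      show ?thesis
        unfolding S_gens(3)[OF that(2) V] S_diff[OF w Der_add[OF D(1,2)] D(3)] S_add[OF w D(1,2)]
          S_fn_df(3)[OF that(1) c(1) iprod_Der[OF that(2)]] S_fn_df(3)[OF that(1) c(2) iU]
          S_gens(4)[OF that(1) Dg_vfields[OF that(2) V]] S_gens(4)[OF that] S_gens(4)[OF that(1) U]
        by (simp add: lmul_simps)
    qed
    have "T (Lie A V) = 0"
      unfolding T_def SL[OF X Y] SL[OF Y X] by simp
    then show "T (Lie A V) \<omega> = 0"
      by (simp only: zero_fun_apply[where x = \<omega>])
  qed
  then have "T E = 0"
    using E by (intro ext[where 'a = "'a form"]) (simp only: zero_fun_apply[where 'a = "'a form"])
  then show ?thesis
    using curvature_hder[OF hX hY E] gbracket_iprod_iprod[OF X Y] S_zero_left[OF E]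
    by (simp add: T_def psign_simps)
qed

lemma curvature_Lie_iprod_iprod:
  assumes "X \<in> vfields A" "Y \<in> vfields A" "Z \<in> vfields A"
  shows "graded_curvature A S (Lie A X) (iprod A Y) (iprod A Z) = 0"
proof -
  note hX = Lie_hder[OF assms(1)] and hY = iprod_hder[OF assms(2)]
  note c = g_Cinf[OF assms(1,3)] and D = Dg_vfields[OF assms(1,3)]
  have "S (iprod A Y) (S (Lie A X) (iprod A Z)) = 0"
    unfolding S_gens(2)[OF assms(1,3)] S_diff[OF hY iprod_Der[OF D] fn_df_Der(1)[OF c iU]]
      S_fn_df(3)[OF assms(2) c iU] S_gens(4)[OF assms(2) D] S_gens(4)[OF assms(2) U]
    by (simp add: lmul_simps)
  then show ?thesis
    unfolding curvature_hder[OF hX hY iprod_Der[OF assms(3)] insertI1 insertI2[OF singletonI]]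
      gbracket_Lie_iprod[OF assms(1,2)] S_gens(4)[OF assms(2,3)] S_zero[OF hX]
      S_gens(4)[OF vfields_vbracket[OF assms(1,2)] assms(3)]
    by (simp add: psign_simps)
qed

lemma gens_riemann_curvature:
  assumes "X \<in> vfields A" "Y \<in> vfields A" "Z \<in> vfields A"
  shows "iprod A (riemann_curvature Dg X Y Z)
    = iprod A (Dg X (Dg Y Z)) - iprod A (Dg Y (Dg X Z)) - iprod A (Dg (vbracket X Y) Z)"
    and "Lie A (riemann_curvature Dg X Y Z)
    = Lie A (Dg X (Dg Y Z)) - Lie A (Dg Y (Dg X Z)) - Lie A (Dg (vbracket X Y) Z)"
  unfolding riemann_curvature_def
  by (simp_all add: assms Dg_vfields vfields_intros iprod_vdiff Lie_vdiff)

lemma g_bracket: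
  assumes "X \<in> vfields A" "Y \<in> vfields A" "Z \<in> vfields A"
  shows "g (vbracket X Y) Z = g (Dg X Y) Z - g (Dg Y X) Z"
  unfolding Dg_torsion[OF assms(1,2)] by (intro g_diff_left Dg_vfields assms)

lemma fn_diff: "fn (f - h) = fn f - fn h"
  by (rule ext) (simp add: fn_def form_apply)

lemma df_diff:
  assumes "f \<in> Cinf A" "h \<in> Cinf A"
  shows "df A (f - h) = df A f - df A h"
  using df_add[OF Cinf_diff[OF assms] assms(2)] by (simp add: eq_diff_eq)

text \<open>After \<open>X (g Y Z)\<close> is expanded by the metric property, the terms
  \<open>g X (Dg Y Z)\<close> and \<open>g Y (Dg X Z)\<close> occur symmetrically in
  \<open>X\<close> and \<open>Y\<close> and cancel, while \<open>g (Dg X Y) Z\<close> and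
  \<open>g (Dg Y X) Z\<close> cancel against the bracket since \<open>Dg\<close> is torsion free.
  Besides the Riemannian curvature, there remain the derivatives of
  \<open>iprod A U\<close>.\<close>

lemma curvature_Lie_Lie_iprod:
  assumes V: "X \<in> vfields A" "Y \<in> vfields A" "Z \<in> vfields A"
  shows "graded_curvature A S (Lie A X) (Lie A Y) (iprod A Z) =
        iprod A (riemann_curvature Dg X Y Z) - fn (g Y Z) \<odot> iprod A (Dg X U) + fn (g X Z) \<odot> iprod A (Dg Y U)
        + fn (g Y Z) \<odot> fn (g X U) \<odot> iprod A U - fn (g X Z) \<odot> fn (g Y U) \<odot> iprod A U"
proof -
  have SS: "S (Lie A V) (S (Lie A W) (iprod A Z)) = iprod A (Dg V (Dg W Z)) - fn (g V (Dg W Z)) \<odot> iprod A U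
      - fn (g (Dg V W) Z) \<odot> iprod A U - fn (g W (Dg V Z)) \<odot> iprod A U
      - fn (g W Z) \<odot> iprod A (Dg V U) + fn (g W Z) \<odot> fn (g V U) \<odot> iprod A U"
    if V: "V \<in> vfields A" and W: "W \<in> vfields A" for V W
  proof -
    note D = Dg_vfields[OF W assms(3)]
    note c = g_Cinf[OF W assms(3)]
    have Vg: "fn (V (g W Z)) = fn (g (Dg V W) Z) + fn (g W (Dg V Z))"
      unfolding Dg_metric[OF V W assms(3)] fn_add ..
    show ?thesis
      unfolding S_gens(2)[OF W assms(3)] S_diff[OF Lie_hder[OF V] iprod_Der[OF D] fn_df_Der(1)[OF c iU]]
        S_fn_df(1)[OF V c iU] S_gens(2)[OF V D] S_gens(2)[OF V U] Vg lmul_simps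
      by (simp only: algebra_simps)
  qed
  have b: "S (Lie A (vbracket X Y)) (iprod A Z)
      = iprod A (Dg (vbracket X Y) Z) - (fn (g (Dg X Y) Z) \<odot> iprod A U - fn (g (Dg Y X) Z) \<odot> iprod A U)"
    unfolding S_gens(2)[OF vfields_vbracket[OF V(1,2)] V(3)] g_bracket[OF V] fn_diff lmul_simps ..
  show ?thesis
    unfolding curvature_hder[OF Lie_hder[OF V(1)] Lie_hder[OF V(2)] iprod_Der[OF V(3)] insertI1 insertI1]
      gbracket_Lie_Lie[OF V(1,2)] SS[OF V(1,2)] SS[OF V(2,1)] b gens_riemann_curvature[OF V] psign_simps(6) mult_0
    by (simp add: algebra_simps)
qed

text \<open>The two iterated derivatives are not exchanges of each other, but their terms match: the
  interior product turns \<open>df A (g X Z)\<close> into the function \<open>Y (g X Z)\<close>, so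
  both sides produce the same coefficients of \<open>iprod A U\<close> up to those of the bracket.
  The bracket also absorbs the products of \<open>g Z U\<close> with \<open>iprod A (Dg X Y)\<close>
  and \<open>iprod A (Dg Y X)\<close>.\<close>

lemma curvature_Lie_iprod_Lie:
  assumes V: "X \<in> vfields A" "Y \<in> vfields A" "Z \<in> vfields A"
  shows "graded_curvature A S (Lie A X) (iprod A Y) (Lie A Z) =
        iprod A (riemann_curvature Dg X Y Z) + fn (g Z (Dg X U)) \<odot> iprod A Y - fn (g Y Z) \<odot> iprod A (Dg X U)
        - fn (g Z U) \<odot> fn (g X U) \<odot> iprod A Y + fn (g Y Z) \<odot> fn (g X U) \<odot> iprod A U"
proof -
  note X = V(1) and Y = V(2) and Z = V(3)
  note hX = Lie_hder[OF X] and hY = iprod_hder[OF Y]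
  note D = Dg_vfields[OF X Y] Dg_vfields[OF Y X] Dg_vfields[OF X Z] Dg_vfields[OF Y Z]
  note c = g_Cinf[OF Y Z] g_Cinf[OF Z U] g_Cinf[OF X Z]
  have Xg: "fn (X (g Y Z)) = fn (g (Dg X Y) Z) + fn (g Y (Dg X Z))"
    "fn (X (g Z U)) = fn (g (Dg X Z) U) + fn (g Z (Dg X U))"
    "fn (Y (g X Z)) = fn (g (Dg Y X) Z) + fn (g X (Dg Y Z))"
    unfolding Dg_metric[OF X Y Z] Dg_metric[OF X Z U] Dg_metric[OF Y X Z] fn_add by (rule refl)+
  have ib: "iprod A (vbracket X Y) = iprod A (Dg X Y) - iprod A (Dg Y X)"
    unfolding Dg_torsion[OF X Y] iprod_vdiff[OF D(1,2)] ..
  have 1: "S (Lie A X) (S (iprod A Y) (Lie A Z))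
      = iprod A (Dg X (Dg Y Z)) - fn (g X (Dg Y Z)) \<odot> iprod A U
        + (fn (g (Dg X Z) U) \<odot> iprod A Y + fn (g Z (Dg X U)) \<odot> iprod A Y
          + fn (g Z U) \<odot> (iprod A (Dg X Y) - fn (g X Y) \<odot> iprod A U))
        - (fn (g (Dg X Y) Z) \<odot> iprod A U + fn (g Y (Dg X Z)) \<odot> iprod A U
          + fn (g Y Z) \<odot> (iprod A (Dg X U) - fn (g X U) \<odot> iprod A U))"
    unfolding S_gens(3)[OF Y Z]
      S_diff[OF hX Der_add[OF iprod_Der[OF D(4)] fn_df_Der(1)[OF c(2) iprod_Der[OF Y]]] fn_df_Der(1)[OF c(1) iU]]
      S_add[OF hX iprod_Der[OF D(4)] fn_df_Der(1)[OF c(2) iprod_Der[OF Y]]]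
      S_fn_df(1)[OF X c(2) iprod_Der[OF Y]] S_fn_df(1)[OF X c(1) iU]
      S_gens(2)[OF X D(4)] S_gens(2)[OF X Y] S_gens(2)[OF X U] Xg lmul_simps(2) ..
  \<comment> \<open>The 0 in the last term is \<open>S (iprod A Y) (iprod A U)\<close>.\<close>
  have 2: "S (iprod A Y) (S (Lie A X) (Lie A Z))
      = iprod A (Dg Y (Dg X Z)) + fn (g (Dg X Z) U) \<odot> iprod A Y - fn (g Y (Dg X Z)) \<odot> iprod A U
        + fn (g Z U) \<odot> (iprod A (Dg Y X) + fn (g X U) \<odot> iprod A Y - fn (g Y X) \<odot> iprod A U)
        - (fn (g (Dg Y X) Z) \<odot> iprod A U + fn (g X (Dg Y Z)) \<odot> iprod A U - df A (g X Z) \<odot> 0)"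
    unfolding S_gens(1)[OF X Z]
      S_diff[OF hY Der_add[OF Lie_Der[OF D(3)] fn_df_Der(1)[OF c(2) Lie_Der[OF X]]] fn_df_Der(2)[OF iU]]
      S_add[OF hY Lie_Der[OF D(3)] fn_df_Der(1)[OF c(2) Lie_Der[OF X]]]
      S_fn_df(3)[OF Y c(2) Lie_Der[OF X]] S_fn_df(4)[OF Y c(3) iU]
      S_gens(3)[OF Y D(3)] S_gens(3)[OF Y X] S_gens(4)[OF Y U] Xg lmul_simps(2) ..
  have 3: "S (iprod A (vbracket X Y)) (Lie A Z) = iprod A (Dg (vbracket X Y) Z)
      + (fn (g Z U) \<odot> iprod A (Dg X Y) - fn (g Z U) \<odot> iprod A (Dg Y X))
      - (fn (g (Dg X Y) Z) \<odot> iprod A U - fn (g (Dg Y X) Z) \<odot> iprod A U)"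
    unfolding S_gens(3)[OF vfields_vbracket[OF X Y] Z]
    unfolding ib g_bracket[OF V] fn_diff lmul_simps ..
  show ?thesis
    unfolding curvature_hder[OF hX hY Lie_Der[OF Z] insertI1 insertI2[OF singletonI]]
      gbracket_Lie_iprod[OF X Y] 1 2 3 gens_riemann_curvature[OF V] psign_simps(6) mult_0 g_commute[OF Y X] lmul_simps
    by (simp add: algebra_simps)
qed

text \<open>The coefficients of \<open>iprod A U\<close> cancel as in
  \<open>curvature_Lie_Lie_iprod\<close>, with differentials in place of functions. Here
  \<open>g Z U\<close> is differentiated as well: its part \<open>g (Dg X Z) U\<close> cancels
  against the same coefficient of \<open>Lie A Y\<close> in the opposite order of derivatives, and
  \<open>g Z (Dg X U)\<close> stays.\<close>

lemma curvature_Lie_Lie_Lie: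
  assumes V: "X \<in> vfields A" "Y \<in> vfields A" "Z \<in> vfields A"
  shows "graded_curvature A S (Lie A X) (Lie A Y) (Lie A Z) =
        Lie A (riemann_curvature Dg X Y Z) + fn (g Z (Dg X U)) \<odot> Lie A Y - fn (g Z (Dg Y U)) \<odot> Lie A X
        - df A (g Y Z) \<odot> iprod A (Dg X U) + df A (g X Z) \<odot> iprod A (Dg Y U)
        + fn (g Z U) \<odot> fn (g Y U) \<odot> Lie A X - fn (g Z U) \<odot> fn (g X U) \<odot> Lie A Y
        + df A (g Y Z) \<odot> fn (g X U) \<odot> iprod A U - df A (g X Z) \<odot> fn (g Y U) \<odot> iprod A U"
proof -
  have SS: "S (Lie A X) (S (Lie A Y) (Lie A Z))
      = Lie A (Dg X (Dg Y Z)) + fn (g (Dg Y Z) U) \<odot> Lie A X - df A (g X (Dg Y Z)) \<odot> iprod A U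
        + (fn (g (Dg X Z) U) \<odot> Lie A Y + fn (g Z (Dg X U)) \<odot> Lie A Y
          + fn (g Z U) \<odot> (Lie A (Dg X Y) + fn (g Y U) \<odot> Lie A X - df A (g X Y) \<odot> iprod A U))
        - (df A (g (Dg X Y) Z) \<odot> iprod A U + df A (g Y (Dg X Z)) \<odot> iprod A U
          + df A (g Y Z) \<odot> (iprod A (Dg X U) - fn (g X U) \<odot> iprod A U))"
    if X: "X \<in> vfields A" and Y: "Y \<in> vfields A" for X Y
  proof -
    note Z = V(3) and hX = Lie_hder[OF X] and D = Dg_vfields[OF Y V(3)]
    note c = g_Cinf[OF Y Z] g_Cinf[OF Z U]
    have Xg: "df A (X (g Y Z)) = df A (g (Dg X Y) Z) + df A (g Y (Dg X Z))"
      "fn (X (g Z U)) = fn (g (Dg X Z) U) + fn (g Z (Dg X U))"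
      unfolding Dg_metric[OF X Y Z] Dg_metric[OF X Z U] fn_add
      using df_add[OF g_Cinf[OF Dg_vfields[OF X Y] Z] g_Cinf[OF Y Dg_vfields[OF X Z]]] by (simp_all only:)
    show ?thesis
      unfolding S_gens(1)[OF Y Z]
        S_diff[OF hX Der_add[OF Lie_Der[OF D] fn_df_Der(1)[OF c(2) Lie_Der[OF Y]]] fn_df_Der(2)[OF iU]]
        S_add[OF hX Lie_Der[OF D] fn_df_Der(1)[OF c(2) Lie_Der[OF Y]]]
        S_fn_df(1)[OF X c(2) Lie_Der[OF Y]] S_fn_df(2)[OF X c(1) iU]
        S_gens(1)[OF X D] S_gens(1)[OF X Y] S_gens(2)[OF X U] Xg lmul_simps(2) ..
  qed
  note X = V(1) and Y = V(2) and Z = V(3)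
  note D = Dg_vfields[OF X Y] Dg_vfields[OF Y X]
  have Lb: "Lie A (vbracket X Y) = Lie A (Dg X Y) - Lie A (Dg Y X)"
    unfolding Dg_torsion[OF X Y] Lie_vdiff[OF D] ..
  have b: "S (Lie A (vbracket X Y)) (Lie A Z) = Lie A (Dg (vbracket X Y) Z)
      + (fn (g Z U) \<odot> Lie A (Dg X Y) - fn (g Z U) \<odot> Lie A (Dg Y X))
      - (df A (g (Dg X Y) Z) \<odot> iprod A U - df A (g (Dg Y X) Z) \<odot> iprod A U)"
    unfolding S_gens(1)[OF vfields_vbracket[OF X Y] Z]
    unfolding Lb g_bracket[OF V]
      df_diff[OF g_Cinf[OF D(1) Z] g_Cinf[OF D(2) Z]] lmul_simps ..
  show ?thesis
    unfolding curvature_hder[OF Lie_hder[OF X] Lie_hder[OF Y] Lie_Der[OF Z] insertI1 insertI1]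
      gbracket_Lie_Lie[OF X Y] SS[OF X Y] SS[OF Y X] b gens_riemann_curvature[OF V] psign_simps(6) mult_0
      g_commute[OF Y X] lmul_simps
    by (simp add: algebra_simps)
qed

end

end

theorem proposition2p13:
  fixes A :: "('a::{t2_space,second_countable_topology}, 'b::euclidean_space) atlas"
    and g :: "'a vfield \<Rightarrow> 'a vfield \<Rightarrow> 'a \<Rightarrow> real"
    and Dg :: "'a vfield \<Rightarrow> 'a vfield \<Rightarrow> 'a vfield"
    and G :: "'a gmetric"
    and NL :: "'a gconn"
    and U X Y Z :: "'a vfield"
  assumes "smooth_manifold A"
    and "riemannian_metric A g"
    and "levi_civita_connection A g Dg"
    and "associated_graded_metric A g G"
    and "graded_levi_civita A G NL"
    and "U \<in> vfields A" and "X \<in> vfields A" and "Y \<in> vfields A" and "Z \<in> vfields A"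
  shows "let L = Lie A; i = iprod A; d = df A;
      Rg = riemann_curvature Dg;
      R = graded_curvature A (semi_symmetric A G NL (i U))
    in
      R (L X) (L Y) (L Z) =
        L (Rg X Y Z) + fn (g Z (Dg X U)) \<odot> L Y - fn (g Z (Dg Y U)) \<odot> L X
        - d (g Y Z) \<odot> i (Dg X U) + d (g X Z) \<odot> i (Dg Y U)
        + fn (g Z U) \<odot> fn (g Y U) \<odot> L X - fn (g Z U) \<odot> fn (g X U) \<odot> L Y
        + d (g Y Z) \<odot> fn (g X U) \<odot> i U - d (g X Z) \<odot> fn (g Y U) \<odot> i U
      \<and> R (L X) (L Y) (i Z) =
        i (Rg X Y Z) - fn (g Y Z) \<odot> i (Dg X U) + fn (g X Z) \<odot> i (Dg Y U)
        + fn (g Y Z) \<odot> fn (g X U) \<odot> i U - fn (g X Z) \<odot> fn (g Y U) \<odot> i U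
      \<and> R (L X) (i Y) (L Z) =
        i (Rg X Y Z) + fn (g Z (Dg X U)) \<odot> i Y - fn (g Y Z) \<odot> i (Dg X U)
        - fn (g Z U) \<odot> fn (g X U) \<odot> i Y + fn (g Y Z) \<odot> fn (g X U) \<odot> i U
      \<and> R (L X) (i Y) (i Z) = 0
      \<and> (\<forall>D\<in>Der A. R (i X) (i Y) D = 0)"
proof -
  interpret graded_riemannian A g Dg G NL
    by unfold_locales (rule assms)+
  show ?thesis
    unfolding Let_def S_def[OF assms(6), symmetric]
    using curvature_Lie_Lie_Lie[OF assms(6-9)] curvature_Lie_Lie_iprod[OF assms(6-9)]
      curvature_Lie_iprod_Lie[OF assms(6-9)] curvature_Lie_iprod_iprod[OF assms(6-9)]
      curvature_iprod_iprod[OF assms(6-8)]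
    by blast
qed

end
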